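(* Let $N\ge2$. For every prime $\ell\nmid 2N$, we have $T_\ell\Theta_N=(\ell+\sigma_\ell)\Theta_N$ in $H^1(\tilde\Gamma_0(N),K_2(\mathbb{Q}(\mu_N))/Z_N)$. If $N$ is odd, then $2(T_2-2-\sigma_2)\Theta_N=0$ in this cohomology group.
   Context: $\zeta_N$ a primitive $N$th root of unity; $\sigma_j\in\mathrm{Gal}(\mathbb{Q}(\mu_N)/\mathbb{Q})$ with $\sigma_j(\zeta_N)=\zeta_N^j$; $Z_N=\langle\{-1,-\zeta_N\}\rangle\subset K_2(\mathbb{Q}(\mu_N))$. $\tilde\Gamma_0(N)=\{\begin{pmatrix}a&b\\c&d\end{pmatrix}\in\mathrm{GL}_2(\mathbb{Z}):N\mid c\}$ and $\Delta_0(N)$ is the monoid of integer matrices $\begin{pmatrix}a&b\\c&d\end{pmatrix}$ of nonzero determinant with $N\mid c$, $\gcd(d,N)=1$; it acts on $M=K_2(\mathbb{Q}(\mu_N))/Z_N$ by $\begin{pmatrix}a&b\\c&d\end{pmatrix}\mapsto\sigma_{d\bmod N}$. $\Theta_N$ is the $1$-cocycle $\tilde\Gamma_0(N)\to M$, $\Theta_{N,\gamma}=\sum_{i=1}^k\{1-\zeta_N^{d_i},1-\zeta_N^{-d_{i-1}}\}$, where $(b_i,d_i)_{i=0}^k$ is any sequence in $\mathbb{Z}^2$ with $(b_0,d_0)=(0,1)$, $(b_k,d_k)=\det(\gamma)(b,d)$, $b_{i-1}d_i-b_id_{i-1}=1$ and $N\nmid d_i$ for $i<k$ (the value is independent of the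 choice). Hecke operator $T_\ell$ for $\ell\nmid N$: with $g_j=\begin{pmatrix}\ell&j\\0&1\end{pmatrix}$ ($0\le j<\ell$), $g_\ell=\begin{pmatrix}1&0\\0&\ell\end{pmatrix}$, and $\gamma g_j=g_{\sigma(j)}\gamma_j$ with $\gamma_j\in\tilde\Gamma_0(N)$ and $\sigma$ a permutation, $(T_\ell\theta)(\gamma)=\sum_j g_{\sigma(j)}\cdot\theta(\gamma_j)$; this induces a well-defined action on $H^1$. *)

theory Defs
  imports "HOL-Analysis.Analysis" "HOL-Computational_Algebra.Polynomial" "HOL-Library.Poly_Mapping"
begin

definition zeta :: "nat \<Rightarrow> complex" where
  "zeta N = cis (2 * pi / real N)"

definition cyc_field :: "nat \<Rightarrow> complex set" where
  "cyc_field N = {poly (map_poly of_rat p) (zeta N) | p :: rat poly. True}"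

definition gal_sigma :: "nat \<Rightarrow> int \<Rightarrow> complex \<Rightarrow> complex" where
  "gal_sigma N j x = (SOME y. \<exists>p :: rat poly.
      x = poly (map_poly of_rat p) (zeta N) \<and>
      y = poly (map_poly of_rat p) (zeta N ^ nat (j mod int N)))"

section \<open>K_2 of the field via Matsumoto's presentation, modulo Z_N\<close>

type_synonym fgrp = "(complex \<times> complex) \<Rightarrow>\<^sub>0 int"

definition symb :: "complex \<Rightarrow> complex \<Rightarrow> fgrp" where
  "symb a b = Poly_Mapping.single (a, b) 1"

inductive_set zspan :: "fgrp set \<Rightarrow> fgrp set" for R where
  zspan_zero: "0 \<in> zspan R"
| zspan_gen: "r \<in> R \<Longrightarrow> r \<in> zspan R"
| zspan_diff: "x \<in> zspan R \<Longrightarrow> y \<in> zspan R \<Longrightarrow> x - y \<in> zspan R"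

definition units_F :: "nat \<Rightarrow> complex set" where
  "units_F N = cyc_field N - {0}"

text \<open>Relations: bilinearity, Steinberg relation (K_2 presentation), and the
  generator {-1,-zeta_N} of Z_N.\<close>
definition rels :: "nat \<Rightarrow> fgrp set" where
  "rels N =
     {symb (a1 * a2) b - symb a1 b - symb a2 b | a1 a2 b.
        a1 \<in> units_F N \<and> a2 \<in> units_F N \<and> b \<in> units_F N}
   \<union> {symb a (b1 * b2) - symb a b1 - symb a b2 | a b1 b2.
        a \<in> units_F N \<and> b1 \<in> units_F N \<and> b2 \<in> units_F N}
   \<union> {symb a (1 - a) | a. a \<in> units_F N \<and> a \<noteq> 1}
   \<union> {symb (-1) (- zeta N)}"

text \<open>Elements of M = K_2(Q(mu_N))/Z_N are represented by formal Z-combinations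
  of symbols {a,b} with a, b nonzero in the field; equality in M is congruence
  modulo the relations.\<close>
definition M_carrier :: "nat \<Rightarrow> fgrp set" where
  "M_carrier N = {x. Poly_Mapping.keys x \<subseteq> units_F N \<times> units_F N}"

definition eqM :: "nat \<Rightarrow> fgrp \<Rightarrow> fgrp \<Rightarrow> bool" where
  "eqM N x y \<longleftrightarrow> x - y \<in> zspan (rels N)"

definition galM :: "nat \<Rightarrow> int \<Rightarrow> fgrp \<Rightarrow> fgrp" where
  "galM N j x = (\<Sum>p\<in>Poly_Mapping.keys x.
      Poly_Mapping.single (gal_sigma N j (fst p), gal_sigma N j (snd p)) (Poly_Mapping.lookup x p))"

definition zsmult :: "int \<Rightarrow> fgrp \<Rightarrow> fgrp" where
  "zsmult k x = Poly_Mapping.map (\<lambda>v. k * v) x"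

type_synonym imat = "int \<times> int \<times> int \<times> int"  (* (a,b,c,d) = [[a,b],[c,d]] *)

fun mdet :: "imat \<Rightarrow> int" where
  "mdet (a, b, c, d) = a * d - b * c"

fun mmul :: "imat \<Rightarrow> imat \<Rightarrow> imat" where
  "mmul (a, b, c, d) (a', b', c', d') =
     (a * a' + b * c', a * b' + b * d', c * a' + d * c', c * b' + d * d')"

fun lower_right :: "imat \<Rightarrow> int" where
  "lower_right (a, b, c, d) = d"

definition Gamma0t :: "nat \<Rightarrow> imat set" where
  "Gamma0t N = {(a, b, c, d). int N dvd c \<and> \<bar>a * d - b * c\<bar> = 1}"

definition actM :: "nat \<Rightarrow> imat \<Rightarrow> fgrp \<Rightarrow> fgrp" where
  "actM N g x = galM N (lower_right g) x"

definition theta_seq :: "nat \<Rightarrow> imat \<Rightarrow> nat \<Rightarrow> (nat \<Rightarrow> int) \<Rightarrow> (nat \<Rightarrow> int) \<Rightarrow> bool" where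
  "theta_seq N \<gamma> k bs ds \<longleftrightarrow>
     (case \<gamma> of (a, b, c, d) \<Rightarrow>
       bs 0 = 0 \<and> ds 0 = 1 \<and> bs k = mdet \<gamma> * b \<and> ds k = mdet \<gamma> * d \<and>
       (\<forall>i\<in>{1..k}. bs (i - 1) * ds i - bs i * ds (i - 1) = 1) \<and>
       (\<forall>i<k. \<not> int N dvd ds i))"

definition theta_val :: "nat \<Rightarrow> nat \<Rightarrow> (nat \<Rightarrow> int) \<Rightarrow> fgrp" where
  "theta_val N k ds = (\<Sum>i\<in>{1..k}.
      symb (1 - zeta N powi ds i) (1 - zeta N powi (- ds (i - 1))))"

definition Theta :: "nat \<Rightarrow> imat \<Rightarrow> fgrp" where
  "Theta N \<gamma> = (SOME v. \<exists>k bs ds. theta_seq N \<gamma> k bs ds \<and> v = theta_val N k ds)"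

definition hg :: "nat \<Rightarrow> nat \<Rightarrow> imat" where
  "hg l j = (if j < l then (int l, int j, 0, 1) else (1, 0, 0, int l))"

text \<open>For gamma and j \<le> l, pick the (unique) k \<le> l and gamma_j in tilde Gamma_0(N)
  with gamma g_j = g_k gamma_j.\<close>
definition hecke_dec :: "nat \<Rightarrow> nat \<Rightarrow> imat \<Rightarrow> nat \<Rightarrow> nat \<times> imat" where
  "hecke_dec N l \<gamma> j = (SOME (k, \<gamma>'). k \<le> l \<and> \<gamma>' \<in> Gamma0t N \<and>
       mmul \<gamma> (hg l j) = mmul (hg l k) \<gamma>')"

definition hecke :: "nat \<Rightarrow> nat \<Rightarrow> (imat \<Rightarrow> fgrp) \<Rightarrow> imat \<Rightarrow> fgrp" where
  "hecke N l \<theta> \<gamma> = (\<Sum>j\<in>{0..l}.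
      (case hecke_dec N l \<gamma> j of (k, \<gamma>') \<Rightarrow> actM N (hg l k) (\<theta> \<gamma>')))"

definition cohom_eq :: "nat \<Rightarrow> (imat \<Rightarrow> fgrp) \<Rightarrow> (imat \<Rightarrow> fgrp) \<Rightarrow> bool" where
  "cohom_eq N f g \<longleftrightarrow> (\<exists>m\<in>M_carrier N. \<forall>\<gamma>\<in>Gamma0t N.
       eqM N (f \<gamma> - g \<gamma>) (actM N \<gamma> m - m))"

end

theory Submission
  imports Defs
    "HOL-Library.Function_Algebras"
    "HOL-Computational_Algebra.Group_Closure"
    "HOL-Computational_Algebra.Field_as_Ring"
    "HOL-Computational_Algebra.Fundamental_Theorem_Algebra"
    "HOL-Computational_Algebra.Polynomial_Factorial"
begin

text \<open>
Write z^v = t^b \<zeta>^d for v = (b, d). The symbols {1 - z^w, 1 - z^(-v)}, for v, w with determinant 1,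
satisfy the three-term relation of a Farey triangle, and the symbol of the loop v, w, -v, -w lies in
Z_N. Hence in M they are the differences of a potential on primitive vectors, which makes
the cocycle independent of the path and reduces the theorem to one identity for each edge from v to w:
the sum, over the l + 1 sublattices L of index l, of the symbols of a path in L from the direction of v
to that of w equals l + \<sigma>_l times the symbol of the edge, exactly and for every prime l not dividing N.
Only the change of base points produces a coboundary.

For the edge identity, keep x = z^v fixed and replace z^w by a variable t over k = Q(\<zeta>). The path symbols
{1 - x^m t^n, 1 - x^(-m') t^(-n')} have tame symbols that cancel at interior vertices of the paths; at the end
points they cancel by the factorization of 1 - x^(-l) over the l-th roots of unity. By Milnor's theorem on
K_2(k(t)) the difference of the two sides is constant in t. It is zero at t = 0, where all first entries
become 1, and one specializes t to z^w.
\<close>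

section \<open>Steinberg symbols\<close>

text \<open>K_2(k(t)) is never constructed. A combination of symbols of polynomials over k is
  recorded as a pair: its value under a specialization into M, and its tame symbols at all complex
  points. What is used of Milnor's theorem is that, in the group generated by such pairs, trivial
  tame symbols force a trivial value if the value vanishes on constants. Complex points replace
  residue fields, since one root of an irreducible polynomial determines a residue class. Two
  obstacles shape the rest. Interior vertices of a path in L may be bad, so that their functions
  vanish at the point of specialization; evaluation becomes a leading coefficient there, which a
  scaled uniformizer turns into an integer. Hence the potential is built for arbitrary substitutes
  at bad vectors. And negative exponents are not polynomials: the paths stay inside the cone spanned
  by v and w, where the exponents of t are nonnegative, and 1 - 1/z is expanded into 1 - z, - 1 and
  z.\<close>

locale steinberg_symbol =
  fixes R :: "'a::idom set" and C :: "'a \<Rightarrow> 'a \<Rightarrow> 'm::ab_group_add"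
  assumes one_closed: "1 \<in> R"
    and uminus_closed: "a \<in> R \<Longrightarrow> - a \<in> R"
    and add_closed: "a \<in> R \<Longrightarrow> b \<in> R \<Longrightarrow> a + b \<in> R"
    and mult_closed: "a \<in> R \<Longrightarrow> b \<in> R \<Longrightarrow> a * b \<in> R"
    and mult_left: "\<lbrakk>a \<in> R; b \<in> R; c \<in> R; a \<noteq> 0; b \<noteq> 0; c \<noteq> 0\<rbrakk> \<Longrightarrow> C (a * b) c = C a c + C b c"
    and mult_right: "\<lbrakk>a \<in> R; b \<in> R; c \<in> R; a \<noteq> 0; b \<noteq> 0; c \<noteq> 0\<rbrakk> \<Longrightarrow> C a (b * c) = C a b + C a c"
    \<comment> \<open>the Steinberg relation for f / (f + g) and g / (f + g), with denominators cleared\<close>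
    and steinberg: "\<lbrakk>f \<in> R; g \<in> R; f \<noteq> 0; g \<noteq> 0; f + g \<noteq> 0\<rbrakk>
      \<Longrightarrow> C f g + C (f + g) (f + g) = C f (f + g) + C (f + g) g"
begin

lemma one_left: "a \<in> R \<Longrightarrow> a \<noteq> 0 \<Longrightarrow> C 1 a = 0"
  using mult_left[of 1 1 a] one_closed by simp

lemma one_right: "a \<in> R \<Longrightarrow> a \<noteq> 0 \<Longrightarrow> C a 1 = 0"
  using mult_right[of a 1 1] one_closed by simp

text \<open>The Steinberg relation with f = 1 and g = a - 1 gives C a a = C a (a - 1); moreover a -
  1 = - (1 - a) and C a (1 - a) = 0. The case a = 1 is separate because g would be 0.\<close>

lemma self: assumes "a \<in> R" "a \<noteq> 0" shows "C a a = C a (- 1)"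
proof (cases "a = 1")
  case True
  then show ?thesis
    using one_left[of 1] one_left[of "-1"] one_closed uminus_closed[of 1] by simp
next
  case False
  have m: "- 1 \<in> R" "1 - a \<in> R" "a - 1 \<in> R"
    using assms one_closed uminus_closed add_closed[of 1 "- a"] add_closed[of a "- 1"] by auto
  have s: "C a (1 - a) = 0"
    using steinberg[of a "1 - a"] one_left[of 1] one_left[of "1 - a"] one_right[of a] assms m False
      one_closed by simp
  have "C 1 (a - 1) + C a a = C 1 a + C a (a - 1)"
    using steinberg[of 1 "a - 1"] assms m False one_closed by simp
  moreover have "C a (a - 1) = C a (- 1) + C a (1 - a)"
    using mult_right[of a "- 1" "1 - a"] assms m False by simp
  ultimately show ?thesis
    using s one_left[of "a - 1"] one_left[of a] assms m False by simp
qed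

lemma minus_right: "\<lbrakk>a \<in> R; b \<in> R; a \<noteq> 0; b \<noteq> 0\<rbrakk> \<Longrightarrow> C a (- b) = C a (- 1) + C a b"
  using mult_right[of a "- 1" b] one_closed uminus_closed[of 1] by simp

lemma minus_left: "\<lbrakk>a \<in> R; b \<in> R; a \<noteq> 0; b \<noteq> 0\<rbrakk> \<Longrightarrow> C (- a) b = C (- 1) b + C a b"
  using mult_left[of "- 1" a b] one_closed uminus_closed[of 1] by simp

lemma minus_one_right_twice: "\<lbrakk>a \<in> R; a \<noteq> 0\<rbrakk> \<Longrightarrow> C a (- 1) + C a (- 1) = 0"
  using mult_right[of a "- 1" "- 1"] one_right[of a] one_closed uminus_closed[of 1] by simp

lemma neg: "a \<in> R \<Longrightarrow> a \<noteq> 0 \<Longrightarrow> C a (- a) = 0"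
  using minus_right[of a a] self[of a] minus_one_right_twice[of a] by simp

text \<open>Expand C (a b) (- a b) = 0; the diagonal terms disappear by C a (- a) = 0.\<close>

lemma antisym:
  assumes "a \<in> R" "b \<in> R" "a \<noteq> 0" "b \<noteq> 0"
  shows "C b a = - C a b"
proof -
  have m: "- a \<in> R" "- b \<in> R" "a * b \<in> R"
    using assms uminus_closed mult_closed by auto
  have "C (a * b) (- (a * b)) = 0"
    using neg[of "a * b"] m assms by simp
  moreover have "C (a * b) (- (a * b)) = C a ((- a) * b) + C b ((- b) * a)"
    using mult_left[of a b "- (a * b)"] m assms uminus_closed by (simp add: mult.commute)
  ultimately have "C a b + C b a = 0"
    using mult_right[of a "- a" b] mult_right[of b "- b" a] neg[of a] neg[of b] m assms by simp
  then show ?thesis by (simp add: eq_neg_iff_add_eq_0 add.commute)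
qed

end

section \<open>The tame symbol of complex polynomials\<close>

text \<open>The group is written additively, so that a symbol and its tame symbols can be paired in one
  additive group.\<close>

typedef cunit = "{z :: complex. z \<noteq> 0}"
  morphisms cval cunit_of
  by (intro exI[of _ 1]) simp

setup_lifting type_definition_cunit

instantiation cunit :: ab_group_add
begin
lift_definition zero_cunit :: cunit is 1 by simp
lift_definition plus_cunit :: "cunit \<Rightarrow> cunit \<Rightarrow> cunit" is "(*)" by simp
lift_definition uminus_cunit :: "cunit \<Rightarrow> cunit" is inverse by simp
lift_definition minus_cunit :: "cunit \<Rightarrow> cunit \<Rightarrow> cunit" is "(/)" by simp
instance by standard (transfer; simp add: field_simps)+
end

lemma cval_nonzero [simp]: "cval a \<noteq> 0"
  by transfer simp

lemma cval_simps [simp]: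
  "cval 0 = 1" "cval (a + b) = cval a * cval b" "cval (- a) = inverse (cval a)"
  "cval (a - b) = cval a / cval b"
  by (transfer; simp)+

lemma cunit_eqI: "cval a = cval b \<Longrightarrow> a = b"
  by (simp add: cval_inject)

lemma cval_sum: "cval (\<Sum>i\<in>I. f i) = (\<Prod>i\<in>I. cval (f i))"
  by (induction I rule: infinite_finite_induct) auto

lemma cval_cunit_of [simp]: "z \<noteq> 0 \<Longrightarrow> cval (cunit_of z) = z"
  by (simp add: cunit_of_inverse)

text \<open>First nonzero Taylor coefficient at \<tau>: still multiplicative in f, and nonzero also
  at roots.\<close>

definition lead_at :: "complex \<Rightarrow> complex poly \<Rightarrow> complex" where
  "lead_at \<tau> f = poly (f div [:- \<tau>, 1:] ^ order \<tau> f) \<tau>"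

lemma order_lead_at_unique:
  assumes "f = [:- \<tau>, 1:] ^ n * q" "poly q \<tau> \<noteq> 0"
  shows "order \<tau> f = n" "lead_at \<tau> f = poly q \<tau>"
proof -
  have q: "q \<noteq> 0" using assms(2) by auto
  show *: "order \<tau> f = n"
    using assms q by (simp add: order_mult order_power_n_n order_0I)
  show "lead_at \<tau> f = poly q \<tau>"
    unfolding lead_at_def * using assms(1) by simp
qed

lemma lead_at_decomp:
  assumes "f \<noteq> 0"
  obtains q where "f = [:- \<tau>, 1:] ^ order \<tau> f * q" "poly q \<tau> = lead_at \<tau> f" "lead_at \<tau> f \<noteq> 0"
proof -
  from order_decomp[OF assms, of \<tau>] obtain q
    where q: "f = [:- \<tau>, 1:] ^ order \<tau> f * q" "\<not> [:- \<tau>, 1:] dvd q" by blast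
  then have "poly q \<tau> \<noteq> 0" by (simp add: poly_eq_0_iff_dvd)
  with q(1) order_lead_at_unique(2)[OF q(1)] show ?thesis using that by metis
qed

lemma lead_at_nonzero: "f \<noteq> 0 \<Longrightarrow> lead_at \<tau> f \<noteq> 0"
  by (metis lead_at_decomp)

lemma lead_at_mult:
  assumes "f \<noteq> 0" "g \<noteq> 0"
  shows "lead_at \<tau> (f * g) = lead_at \<tau> f * lead_at \<tau> g"
proof -
  obtain p where p: "f = [:- \<tau>, 1:] ^ order \<tau> f * p" "poly p \<tau> = lead_at \<tau> f" "lead_at \<tau> f \<noteq> 0"
    using lead_at_decomp[OF assms(1)] by blast
  obtain q where q: "g = [:- \<tau>, 1:] ^ order \<tau> g * q" "poly q \<tau> = lead_at \<tau> g" "lead_at \<tau> g \<noteq> 0"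
    using lead_at_decomp[OF assms(2)] by blast
  have "f * g = [:- \<tau>, 1:] ^ (order \<tau> f + order \<tau> g) * (p * q)"
    by (subst p(1), subst q(1)) (simp add: power_add algebra_simps)
  from order_lead_at_unique(2)[OF this] p q show ?thesis by simp
qed

lemma lead_at_nonroot: "poly f \<tau> \<noteq> 0 \<Longrightarrow> lead_at \<tau> f = poly f \<tau>"
  using order_lead_at_unique(2)[of f \<tau> 0 f] by simp

lemma lead_at_simple_root:
  assumes "poly f \<tau> = 0" "poly (pderiv f) \<tau> \<noteq> 0"
  shows "order \<tau> f = 1" "lead_at \<tau> f = poly (pderiv f) \<tau>"
proof -
  from assms(1) obtain q where q: "f = [:- \<tau>, 1:] * q"
    by (auto simp: poly_eq_0_iff_dvd elim: dvdE)
  have "pderiv f = q + [:- \<tau>, 1:] * pderiv q"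
    unfolding q by (subst pderiv_mult) (simp add: pderiv_pCons)
  then have d: "poly (pderiv f) \<tau> = poly q \<tau>" by simp
  show "order \<tau> f = 1" "lead_at \<tau> f = poly (pderiv f) \<tau>"
    using order_lead_at_unique[of f \<tau> 1 q] q d assms(2) by simp_all
qed

text \<open>These four possibilities are all that the Steinberg relation needs, both for the tame
  symbol and for the specialization. In the second one the leading terms cancel, and nothing has to
  be known about f + g.\<close>

lemma lead_at_add_cases:
  assumes "f \<noteq> 0" "g \<noteq> 0" "f + g \<noteq> 0"
  obtains
    "order \<tau> f = order \<tau> g" "order \<tau> (f + g) = order \<tau> f" "lead_at \<tau> (f + g) = lead_at \<tau> f + lead_at \<tau> g"
  | "order \<tau> f = order \<tau> g" "lead_at \<tau> g = - lead_at \<tau> f"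
  | "order \<tau> (f + g) = order \<tau> f" "lead_at \<tau> (f + g) = lead_at \<tau> f"
  | "order \<tau> (f + g) = order \<tau> g" "lead_at \<tau> (f + g) = lead_at \<tau> g"
proof -
  obtain p where p: "f = [:- \<tau>, 1:] ^ order \<tau> f * p" "poly p \<tau> = lead_at \<tau> f" "lead_at \<tau> f \<noteq> 0"
    using lead_at_decomp[OF assms(1)] by blast
  obtain q where q: "g = [:- \<tau>, 1:] ^ order \<tau> g * q" "poly q \<tau> = lead_at \<tau> g" "lead_at \<tau> g \<noteq> 0"
    using lead_at_decomp[OF assms(2)] by blast
  consider (eq) "order \<tau> f = order \<tau> g" | (lt) "order \<tau> f < order \<tau> g" | (gt) "order \<tau> g < order \<tau> f"
    by linarith
  then show ?thesis
  proof cases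
    case eq
    have s: "f + g = [:- \<tau>, 1:] ^ order \<tau> f * (p + q)"
      by (subst p(1), subst q(1)) (simp add: eq algebra_simps)
    show ?thesis
    proof (cases "lead_at \<tau> f + lead_at \<tau> g = 0")
      case True
      then have "lead_at \<tau> g = - lead_at \<tau> f" by (simp add: eq_neg_iff_add_eq_0 add.commute)
      then show ?thesis using that(2) eq by blast
    next
      case False
      then show ?thesis using that(1) eq order_lead_at_unique[OF s] p(2) q(2) by simp
    qed
  next
    case lt
    have s: "f + g = [:- \<tau>, 1:] ^ order \<tau> f * (p + [:- \<tau>, 1:] ^ (order \<tau> g - order \<tau> f) * q)"
      using lt by (subst p(1), subst q(1)) (simp add: algebra_simps flip: power_add)
    show ?thesis using that(3) order_lead_at_unique[OF s] p(2,3) lt by (simp add: power_0_left)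
  next
    case gt
    have s: "f + g = [:- \<tau>, 1:] ^ order \<tau> g * (q + [:- \<tau>, 1:] ^ (order \<tau> f - order \<tau> g) * p)"
      using gt by (subst p(1), subst q(1)) (simp add: algebra_simps flip: power_add)
    show ?thesis using that(4) order_lead_at_unique[OF s] q(2,3) gt by (simp add: power_0_left)
  qed
qed

text \<open>Taken at complex points instead of irreducible polynomials over K, so that no residue
  field has to be formed.\<close>

definition tame :: "complex \<Rightarrow> complex poly \<Rightarrow> complex poly \<Rightarrow> cunit" where
  "tame \<tau> f g = cunit_of ((- 1) ^ (order \<tau> f * order \<tau> g)
      * lead_at \<tau> f ^ order \<tau> g / lead_at \<tau> g ^ order \<tau> f)"

lemma cval_tame:
  assumes "f \<noteq> 0" "g \<noteq> 0"
  shows "cval (tame \<tau> f g) = (- 1) ^ (order \<tau> f * order \<tau> g)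
      * lead_at \<tau> f ^ order \<tau> g / lead_at \<tau> g ^ order \<tau> f"
  using lead_at_nonzero[OF assms(1)] lead_at_nonzero[OF assms(2)] unfolding tame_def by simp

lemma tame_nonroots:
  assumes "poly f \<tau> \<noteq> 0" "poly g \<tau> \<noteq> 0"
  shows "tame \<tau> f g = 0"
proof -
  have "f \<noteq> 0" "g \<noteq> 0" using assms by auto
  then have "cval (tame \<tau> f g) = 1"
    using assms by (simp add: cval_tame order_0I)
  then show ?thesis by (auto intro: cunit_eqI)
qed

lemma steinberg_symbol_tame: "steinberg_symbol UNIV (\<lambda>f g \<tau>. tame \<tau> f g)"
proof
  fix f g h :: "complex poly" assume nz: "f \<noteq> 0" "g \<noteq> 0" "h \<noteq> 0"
  show "(\<lambda>\<tau>. tame \<tau> (f * g) h) = (\<lambda>\<tau>. tame \<tau> f h) + (\<lambda>\<tau>. tame \<tau> g h)"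
  proof
    fix \<tau>
    have "cval (tame \<tau> (f * g) h) = cval (tame \<tau> f h + tame \<tau> g h)"
      using nz by (simp add: cval_tame order_mult lead_at_mult power_add algebra_simps power_mult_distrib)
    then show "tame \<tau> (f * g) h = ((\<lambda>\<tau>. tame \<tau> f h) + (\<lambda>\<tau>. tame \<tau> g h)) \<tau>"
      by (auto intro: cunit_eqI)
  qed
  show "(\<lambda>\<tau>. tame \<tau> f (g * h)) = (\<lambda>\<tau>. tame \<tau> f g) + (\<lambda>\<tau>. tame \<tau> f h)"
  proof
    fix \<tau>
    have "cval (tame \<tau> f (g * h)) = cval (tame \<tau> f g + tame \<tau> f h)"
      using nz by (simp add: cval_tame order_mult lead_at_mult power_add algebra_simps power_mult_distrib)
    then show "tame \<tau> f (g * h) = ((\<lambda>\<tau>. tame \<tau> f g) + (\<lambda>\<tau>. tame \<tau> f h)) \<tau>"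
      by (auto intro: cunit_eqI)
  qed
next
  fix f g :: "complex poly" assume nz: "f \<noteq> 0" "g \<noteq> 0" "f + g \<noteq> 0"
  show "(\<lambda>\<tau>. tame \<tau> f g) + (\<lambda>\<tau>. tame \<tau> (f + g) (f + g))
      = (\<lambda>\<tau>. tame \<tau> f (f + g)) + (\<lambda>\<tau>. tame \<tau> (f + g) g)"
  proof
    fix \<tau>
    have l: "lead_at \<tau> f \<noteq> 0" "lead_at \<tau> g \<noteq> 0" "lead_at \<tau> (f + g) \<noteq> 0"
      using nz lead_at_nonzero by blast+
    have sgn: "(- 1) ^ (n * n) = (- 1 :: complex) ^ n" for n :: nat
      by (simp add: minus_one_power_iff)
    have "cval (tame \<tau> f g + tame \<tau> (f + g) (f + g)) = cval (tame \<tau> f (f + g) + tame \<tau> (f + g) g)"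
    proof (rule lead_at_add_cases[OF nz, of \<tau>])
      assume "order \<tau> f = order \<tau> g" "lead_at \<tau> g = - lead_at \<tau> f"
      then show ?thesis using l nz
        by (simp add: cval_tame sgn power_minus[of "lead_at \<tau> f"] field_simps flip: power_add)
    qed (use l nz in \<open>simp_all add: cval_tame sgn field_simps\<close>)
    then show "((\<lambda>\<tau>. tame \<tau> f g) + (\<lambda>\<tau>. tame \<tau> (f + g) (f + g))) \<tau>
        = ((\<lambda>\<tau>. tame \<tau> f (f + g)) + (\<lambda>\<tau>. tame \<tau> (f + g) g)) \<tau>"
      by (auto intro: cunit_eqI)
  qed
qed auto


section \<open>Unramified elements over a rational function field\<close>

locale complex_subfield =
  fixes K :: "complex set"
  assumes K_one: "1 \<in> K"
    and K_uminus: "a \<in> K \<Longrightarrow> - a \<in> K"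
    and K_add: "a \<in> K \<Longrightarrow> b \<in> K \<Longrightarrow> a + b \<in> K"
    and K_mult: "a \<in> K \<Longrightarrow> b \<in> K \<Longrightarrow> a * b \<in> K"
    and K_inverse: "a \<in> K \<Longrightarrow> inverse a \<in> K"
begin

lemma K_zero: "0 \<in> K"
  using K_add[OF K_one K_uminus[OF K_one]] by simp

lemma K_diff: "a \<in> K \<Longrightarrow> b \<in> K \<Longrightarrow> a - b \<in> K"
  using K_add[of a "- b"] K_uminus[of b] by simp

lemma K_divide: "a \<in> K \<Longrightarrow> b \<in> K \<Longrightarrow> a / b \<in> K"
  using K_mult[of a "inverse b"] K_inverse[of b] by (simp add: divide_inverse)

lemma K_sum: "(\<And>i. i \<in> I \<Longrightarrow> f i \<in> K) \<Longrightarrow> sum f I \<in> K"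
  by (induction I rule: infinite_finite_induct) (auto simp: K_zero K_add)

lemma K_power: "a \<in> K \<Longrightarrow> a ^ n \<in> K"
  by (induction n) (auto simp: K_one K_mult)

lemma K_powi: "a \<in> K \<Longrightarrow> a powi n \<in> K"
  by (auto simp: power_int_def K_power K_inverse)

lemma K_of_nat: "of_nat n \<in> K"
  by (induction n) (auto simp: K_zero K_add K_one)

lemma K_of_int: "of_int n \<in> K"
  by (cases n) (auto simp: K_of_nat K_uminus simp del: of_nat_Suc)

definition KX :: "complex poly set" where
  "KX = {p. \<forall>i. coeff p i \<in> K}"

lemma KX_one: "1 \<in> KX"
  by (auto simp: KX_def K_zero K_one coeff_1)

lemma KX_uminus: "f \<in> KX \<Longrightarrow> - f \<in> KX"
  by (auto simp: KX_def K_uminus)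

lemma KX_add: "f \<in> KX \<Longrightarrow> g \<in> KX \<Longrightarrow> f + g \<in> KX"
  by (auto simp: KX_def K_add)

lemma KX_diff: "f \<in> KX \<Longrightarrow> g \<in> KX \<Longrightarrow> f - g \<in> KX"
  by (auto simp: KX_def K_diff)

lemma KX_mult: "f \<in> KX \<Longrightarrow> g \<in> KX \<Longrightarrow> f * g \<in> KX"
  by (auto simp: KX_def coeff_mult intro!: K_sum K_mult)

lemma KX_zero: "0 \<in> KX"
  by (auto simp: KX_def K_zero)

lemma KX_monom: "a \<in> K \<Longrightarrow> monom a n \<in> KX"
  by (auto simp: KX_def K_zero)

lemma KX_const: "a \<in> K \<Longrightarrow> [:a:] \<in> KX"
  using KX_monom[of a 0] by (simp add: monom_0)

lemma KX_power: "f \<in> KX \<Longrightarrow> f ^ n \<in> KX"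
  by (induction n) (auto simp: KX_one KX_mult)

lemma KX_pderiv: "f \<in> KX \<Longrightarrow> pderiv f \<in> KX"
  by (auto simp: KX_def coeff_pderiv simp del: of_nat_Suc intro!: K_mult K_of_nat)

lemma KX_poly: "f \<in> KX \<Longrightarrow> a \<in> K \<Longrightarrow> poly f a \<in> K"
  by (auto simp: KX_def poly_altdef intro!: K_sum K_mult K_power)

lemma KX_lead_coeff: "f \<in> KX \<Longrightarrow> lead_coeff f \<in> K"
  by (auto simp: KX_def)

lemma KX_division:
  assumes "f \<in> KX" "g \<in> KX" "g \<noteq> 0"
  shows "\<exists>q\<in>KX. \<exists>r\<in>KX. f = q * g + r \<and> (r = 0 \<or> degree r < degree g)"
  using assms(1)
\<comment> \<open>The measure separates the zero polynomial from the nonzero constants, which have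
  degree 0 as well.\<close>
proof (induction "if f = 0 then 0 else Suc (degree f)" arbitrary: f rule: less_induct)
  case less
  show ?case
  proof (cases "f = 0 \<or> degree f < degree g")
    case True
    then show ?thesis using less.prems KX_zero by (intro bexI[of _ 0] bexI[of _ f]) auto
  next
    case False
    define m where "m = monom (lead_coeff f / lead_coeff g) (degree f - degree g)"
    have m: "m \<in> KX" unfolding m_def
      by (intro KX_monom K_divide KX_lead_coeff less.prems assms)
    define f' where "f' = f - m * g"
    have f': "f' \<in> KX" unfolding f'_def by (intro KX_diff KX_mult m less.prems assms)
    have dm: "degree (m * g) \<le> degree f"
      using False degree_mult_le[of m g] degree_monom_le[of "lead_coeff f / lead_coeff g" "degree f - degree g"]
      unfolding m_def by linarith
    have "coeff (m * g) (degree f) = coeff f (degree f)"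
    proof -
      have "coeff (m * g) (degree f) = (lead_coeff f / lead_coeff g) * coeff g (degree f - (degree f - degree g))"
        unfolding m_def using False by (simp add: coeff_monom_mult)
      also have "\<dots> = lead_coeff f" using False assms(3) by simp
      finally show ?thesis .
    qed
    then have "f' = 0 \<or> degree f' < degree f"
      unfolding f'_def using dm by (intro eq_zero_or_degree_less degree_diff_le) auto
    then have "(if f' = 0 then 0 else Suc (degree f')) < (if f = 0 then 0 else Suc (degree f))"
      using False by auto
    then obtain q r where qr: "q \<in> KX" "r \<in> KX" "f' = q * g + r" "r = 0 \<or> degree r < degree g"
      using less.hyps f' by blast
    have "f = (q + m) * g + r" using qr(3) unfolding f'_def by (simp add: algebra_simps)
    then show ?thesis using qr KX_add[OF qr(1) m] by blast
  qed
qed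

lemma KX_div: assumes "f \<in> KX" "g \<in> KX" shows "f div g \<in> KX"
proof (cases "g = 0")
  case False
  obtain q r where qr: "q \<in> KX" "r \<in> KX" "f = q * g + r" "r = 0 \<or> degree r < degree g"
    using KX_division[OF assms False] by blast
  then have "f div g = q" using False
    by (auto simp: div_poly_less div_mult_self3 intro: div_poly_less)
  then show ?thesis using qr(1) by simp
qed (simp add: KX_zero)

lemma lead_at_KX: assumes "f \<in> KX" "\<tau> \<in> K" shows "lead_at \<tau> f \<in> K"
proof -
  have "[:- \<tau>, 1:] = monom 1 1 - [:\<tau>:]" by (simp add: monom_altdef)
  then have "[:- \<tau>, 1:] \<in> KX" using assms KX_diff KX_monom[OF K_one] KX_const by metis
  then show ?thesis unfolding lead_at_def
    by (intro KX_poly KX_div KX_power assms)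
qed

text \<open>Monic, so that two of them of equal degree differ by a polynomial of lower
  degree.\<close>

definition K_irreducible :: "complex poly \<Rightarrow> bool" where
  "K_irreducible \<pi> \<longleftrightarrow> \<pi> \<in> KX \<and> lead_coeff \<pi> = 1 \<and> 0 < degree \<pi>
     \<and> (\<forall>f\<in>KX. \<forall>g\<in>KX. \<pi> = f * g \<longrightarrow> degree f = 0 \<or> degree g = 0)"

lemma K_irreducible_nonzero: "K_irreducible \<pi> \<Longrightarrow> \<pi> \<noteq> 0"
  by (auto simp: K_irreducible_def)

lemma K_irreducible_KX: "K_irreducible \<pi> \<Longrightarrow> \<pi> \<in> KX"
  by (auto simp: K_irreducible_def)

text \<open>Up to a constant, \<pi> is the minimal polynomial \<mu> of \<tau> over K: dividing \<pi>
  by \<mu> leaves no remainder, and irreducibility makes the quotient constant.\<close>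

lemma K_irreducible_root_degree:
  assumes "K_irreducible \<pi>" "poly \<pi> \<tau> = 0" "h \<in> KX" "h \<noteq> 0" "degree h < degree \<pi>"
  shows "poly h \<tau> \<noteq> 0"
proof
  assume "poly h \<tau> = 0"
  define S where "S = {f \<in> KX. f \<noteq> 0 \<and> poly f \<tau> = 0}"
  define \<mu> where "\<mu> = arg_min degree (\<lambda>f. f \<in> S)"
  have "h \<in> S" using assms \<open>poly h \<tau> = 0\<close> by (auto simp: S_def)
  then have mu: "\<mu> \<in> S" "\<And>f. f \<in> S \<Longrightarrow> degree \<mu> \<le> degree f"
    unfolding \<mu>_def by (auto intro: arg_min_natI arg_min_nat_le)
  have pK: "\<pi> \<in> KX" and p0: "\<pi> \<noteq> 0" using assms(1) by (auto simp: K_irreducible_def)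
  obtain q r where qr: "q \<in> KX" "r \<in> KX" "\<pi> = q * \<mu> + r" "r = 0 \<or> degree r < degree \<mu>"
    using KX_division[OF pK, of \<mu>] mu(1) by (auto simp: S_def)
  have "poly r \<tau> = 0" using qr(3) mu(1) assms(2) by (auto simp: S_def)
  then have "r = 0" using mu(2)[of r] qr by (force simp: S_def)
  then have f: "\<pi> = q * \<mu>" using qr by simp
  then have "degree q = 0 \<or> degree \<mu> = 0"
    using assms(1) qr(1) mu(1) by (auto simp: K_irreducible_def S_def)
  moreover have "degree \<mu> \<noteq> 0"
  proof
    assume "degree \<mu> = 0"
    then obtain a where "\<mu> = [:a:]" by (rule degree_eq_zeroE)
    then show False using mu(1) by (auto simp: S_def)
  qed
  moreover have "degree \<pi> = degree q + degree \<mu>"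
    using f p0 by (auto intro: degree_mult_eq)
  ultimately have "degree \<pi> = degree \<mu>" by simp
  then show False using mu(2)[OF \<open>h \<in> S\<close>] assms(5) by simp
qed

text \<open>Separability in characteristic 0: the derivative is nonzero of smaller degree, so it
  cannot vanish at \<tau>.\<close>

lemma K_irreducible_order_root:
  assumes "K_irreducible \<pi>" "poly \<pi> \<tau> = 0"
  shows "order \<tau> \<pi> = 1"
proof -
  have "pderiv \<pi> \<noteq> 0" "degree (pderiv \<pi>) < degree \<pi>"
    using assms(1) by (auto simp: K_irreducible_def pderiv_eq_0_iff degree_pderiv)
  then have "poly (pderiv \<pi>) \<tau> \<noteq> 0"
    using K_irreducible_root_degree[OF assms] assms(1) KX_pderiv by (auto simp: K_irreducible_def)
  then show ?thesis using lead_at_simple_root(1)[OF assms(2)] by simp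
qed

text \<open>No full factorization is needed: factors of degree below d already belong to the lower
  step of the filtration.\<close>

lemma KX_split:
  assumes "f \<in> KX" "f \<noteq> 0" "degree f \<le> d" "0 < d"
  obtains g h where "g \<in> KX" "h \<in> KX" "f = g * h" "degree g < d" "degree h < d \<or> K_irreducible h \<and> degree h = d"
proof (cases "degree f < d")
  case True
  then show ?thesis using that[of 1 f] assms KX_one by auto
next
  case False
  then have d: "degree f = d" using assms by simp
  define a where "a = lead_coeff f"
  define h where "h = smult (inverse a) f"
  have a: "a \<in> K" "a \<noteq> 0" using assms KX_lead_coeff by (auto simp: a_def)
  have h: "h \<in> KX" "lead_coeff h = 1" "degree h = d" "f = [:a:] * h"
    using a assms d KX_mult[OF KX_const[OF K_inverse[OF a(1)]] assms(1)] by (auto simp: h_def a_def)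
  show ?thesis
  proof (cases "K_irreducible h")
    case True
    then show ?thesis using that[of "[:a:]" h] h a assms KX_const by auto
  next
    case False
    then obtain p q where pq: "p \<in> KX" "q \<in> KX" "h = p * q" "degree p \<noteq> 0" "degree q \<noteq> 0"
      using h assms by (auto simp: K_irreducible_def)
    have "h \<noteq> 0" using h(2) by auto
    then have "degree p + degree q = d" using pq(3) h(3) by (auto simp: degree_mult_eq)
    then have "degree p < d" "degree q < d" using pq by auto
    then show ?thesis using that[of "[:a:] * p" q] pq h a KX_mult[OF KX_const[OF a(1)] pq(1)]
      by (auto simp: mult_ac)
  qed
qed

end

section \<open>Milnor's filtration of symbols by degree\<close>

locale milnor_symbol = complex_subfield K + steinberg_symbol KX C
  for K :: "complex set" and C :: "complex poly \<Rightarrow> complex poly \<Rightarrow> 'm::ab_group_add"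
begin

definition filt :: "nat \<Rightarrow> 'm set" where
  "filt d = group_closure {C f g | f g. f \<in> KX \<and> g \<in> KX \<and> f \<noteq> 0 \<and> g \<noteq> 0 \<and> degree f \<le> d \<and> degree g \<le> d}"

lemma filt_base: "\<lbrakk>f \<in> KX; g \<in> KX; f \<noteq> 0; g \<noteq> 0; degree f \<le> d; degree g \<le> d\<rbrakk> \<Longrightarrow> C f g \<in> filt d"
  unfolding filt_def by (rule group_closure.base) blast

lemma filt_diff: "x \<in> filt d \<Longrightarrow> y \<in> filt d \<Longrightarrow> x - y \<in> filt d"
  unfolding filt_def by (rule group_closure.diff)

lemma filt_zero: "0 \<in> filt d"
  unfolding filt_def by simp

lemma filt_add: "x \<in> filt d \<Longrightarrow> y \<in> filt d \<Longrightarrow> x + y \<in> filt d"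
  unfolding filt_def by (rule group_closure_add)

lemma filt_mono: assumes "d \<le> e" "x \<in> filt d" shows "x \<in> filt e"
  using assms(2) unfolding filt_def
proof (induction rule: group_closure.induct)
  case (base s)
  then show ?case using assms(1) by (intro group_closure.base) (fastforce intro: order_trans)
next
  case (diff s t)
  then show ?case by (intro group_closure.diff)
qed

text \<open>Reduction modulo an irreducible polynomial changes a symbol only by terms of lower degree.\<close>

lemma reduce_product:
  assumes "K_irreducible \<pi>" "degree \<pi> = Suc d"
    and "h1 \<in> KX" "h1 \<noteq> 0" "degree h1 \<le> d" "h2 \<in> KX" "h2 \<noteq> 0" "degree h2 \<le> d"
  shows "\<exists>h3\<in>KX. h3 \<noteq> 0 \<and> degree h3 \<le> d \<and> C \<pi> h1 + C \<pi> h2 - C \<pi> h3 \<in> filt d"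
proof -
  have pK: "\<pi> \<in> KX" and p0: "\<pi> \<noteq> 0" using assms(1) by (auto simp: K_irreducible_def)
  have hh: "h1 * h2 \<in> KX" using assms KX_mult by blast
  obtain q r where qr: "q \<in> KX" "r \<in> KX" "h1 * h2 = q * \<pi> + r" "r = 0 \<or> degree r < degree \<pi>"
    using KX_division[OF hh pK p0] by blast
  obtain \<tau> where tau: "poly \<pi> \<tau> = 0"
    using fundamental_theorem_of_algebra_alt[of \<pi>] assms(2) by (metis degree_0 degree_pCons_0 nat.distinct(1))
  have "poly h1 \<tau> \<noteq> 0" "poly h2 \<tau> \<noteq> 0"
    using K_irreducible_root_degree[OF assms(1) tau] assms by auto
  then have "poly (h1 * h2) \<tau> \<noteq> 0" by simp
  then have r0: "r \<noteq> 0" using qr(3) tau by auto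
  then have dr: "degree r \<le> d" using qr(4) assms(2) by simp
  have eq: "C \<pi> h1 + C \<pi> h2 = C \<pi> (h1 * h2)" using mult_right[OF pK assms(3,6)] p0 assms by simp
  show ?thesis
  proof (cases "q = 0")
    case True
    then show ?thesis using eq qr r0 dr filt_zero by (intro bexI[of _ r]) auto
  next
    case False
    have "degree (q * \<pi>) \<le> max (degree (h1 * h2)) (degree r)"
      using qr(3) degree_diff_le_max[of "h1 * h2" r] by simp
    also have "\<dots> \<le> 2 * d" using degree_mult_le[of h1 h2] assms dr by (cases "d = 0") auto
    finally have dq: "degree q \<le> d" using False p0 assms(2) by (simp add: degree_mult_eq)
    \<comment> \<open>The relation for q \<pi> + r = h1 h2 exchanges h1 h2 for its residue r; every
      other symbol that it produces has entries of degree at most d.\<close>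
    have "C (q * \<pi>) r + C (h1 * h2) (h1 * h2) = C (q * \<pi>) (h1 * h2) + C (h1 * h2) r"
      using steinberg[of "q * \<pi>" r] qr(1,2) False p0 r0 pK KX_mult assms(4,7)
      unfolding qr(3)[symmetric] by simp
    then have "C q r + C \<pi> r + C (h1 * h2) (h1 * h2) = C q (h1 * h2) + C \<pi> (h1 * h2) + C (h1 * h2) r"
      using mult_left[of q \<pi>] qr(1,2) False p0 r0 pK hh assms(4,7) by simp
    then have "C \<pi> (h1 * h2) - C \<pi> r = C q r + C (h1 * h2) (h1 * h2) - C q (h1 * h2) - C (h1 * h2) r"
      by (simp add: algebra_simps)
    also have "\<dots> = C q r + (C h1 h1 + C h1 h2 + (C h2 h1 + C h2 h2)) - (C q h1 + C q h2) - (C h1 r + C h2 r)"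
      using mult_left[of h1 h2] mult_right[of _ h1 h2] qr(1,2) False r0 hh assms(3,4,6,7) by (simp add: algebra_simps)
    also have "\<dots> \<in> filt d"
      using qr False r0 dr dq assms by (intro filt_diff filt_add filt_base) auto
    finally show ?thesis using eq qr r0 dr by auto
  qed
qed

text \<open>A family of units of the residue rings K[X] / \<pi>, given by reduced representatives.
  The value 1 outside S allows S to be enlarged without changing the sum of symbols.\<close>

definition top_part :: "complex poly set \<Rightarrow> nat \<Rightarrow> (complex poly \<Rightarrow> complex poly) \<Rightarrow> bool" where
  "top_part S d h \<longleftrightarrow> finite S \<and> (\<forall>\<pi>\<in>S. K_irreducible \<pi> \<and> degree \<pi> = Suc d)
     \<and> (\<forall>\<pi>. h \<pi> \<in> KX \<and> h \<pi> \<noteq> 0 \<and> degree (h \<pi>) \<le> d \<and> (\<pi> \<notin> S \<longrightarrow> h \<pi> = 1))"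

lemma top_part_extend: "top_part S d h \<Longrightarrow> top_part S' d h' \<Longrightarrow> top_part (S \<union> S') d h"
  by (auto simp: top_part_def)

lemma top_part_sum_extend:
  assumes "top_part S d h" "top_part S' d h'"
  shows "(\<Sum>\<pi>\<in>S. C \<pi> (h \<pi>)) = (\<Sum>\<pi>\<in>S \<union> S'. C \<pi> (h \<pi>))"
proof (rule sum.mono_neutral_left)
  show "\<forall>\<pi>\<in>S \<union> S' - S. C \<pi> (h \<pi>) = 0"
    using assms one_right by (fastforce simp: top_part_def K_irreducible_def)
qed (use assms in \<open>auto simp: top_part_def\<close>)

lemma top_part_add:
  assumes "top_part S d h" "top_part S d h'"
  obtains h'' where "top_part S d h''"
    "(\<Sum>\<pi>\<in>S. C \<pi> (h \<pi>)) + (\<Sum>\<pi>\<in>S. C \<pi> (h' \<pi>)) - (\<Sum>\<pi>\<in>S. C \<pi> (h'' \<pi>)) \<in> filt d"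
proof -
  have "\<forall>\<pi>\<in>S. \<exists>h3. h3 \<in> KX \<and> h3 \<noteq> 0 \<and> degree h3 \<le> d \<and> C \<pi> (h \<pi>) + C \<pi> (h' \<pi>) - C \<pi> h3 \<in> filt d"
    using reduce_product assms unfolding top_part_def by meson
  then obtain g where g: "\<forall>\<pi>\<in>S. g \<pi> \<in> KX \<and> g \<pi> \<noteq> 0 \<and> degree (g \<pi>) \<le> d
      \<and> C \<pi> (h \<pi>) + C \<pi> (h' \<pi>) - C \<pi> (g \<pi>) \<in> filt d" by metis
  define h'' where "h'' = (\<lambda>\<pi>. if \<pi> \<in> S then g \<pi> else 1)"
  have t: "top_part S d h''" using g assms KX_one by (auto simp: top_part_def h''_def)
  have s: "(\<Sum>\<pi>\<in>S. f \<pi>) \<in> filt d" if "\<forall>\<pi>\<in>S. f \<pi> \<in> filt d" for f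
    using that by (induction S rule: infinite_finite_induct) (auto simp: filt_zero filt_add)
  have "(\<Sum>\<pi>\<in>S. C \<pi> (h \<pi>) + C \<pi> (h' \<pi>) - C \<pi> (h'' \<pi>)) \<in> filt d"
    using g by (intro s) (auto simp: h''_def)
  then show ?thesis using that[OF t] by (simp add: sum.distrib sum_subtractf)
qed

text \<open>A difference of two top parts, so that inverses in K[X] / \<pi> need not be
  formed.\<close>

definition normal_form :: "nat \<Rightarrow> 'm \<Rightarrow> bool" where
  "normal_form d x \<longleftrightarrow> (\<exists>S h h'. top_part S d h \<and> top_part S d h'
     \<and> x - ((\<Sum>\<pi>\<in>S. C \<pi> (h \<pi>)) - (\<Sum>\<pi>\<in>S. C \<pi> (h' \<pi>))) \<in> filt d)"

lemma normal_form_diff: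
  assumes "normal_form d x" "normal_form d y"
  shows "normal_form d (x - y)"
proof -
  obtain S h h' where S: "top_part S d h" "top_part S d h'"
      "x - ((\<Sum>\<pi>\<in>S. C \<pi> (h \<pi>)) - (\<Sum>\<pi>\<in>S. C \<pi> (h' \<pi>))) \<in> filt d"
    using assms(1) unfolding normal_form_def by blast
  obtain T g g' where T: "top_part T d g" "top_part T d g'"
      "y - ((\<Sum>\<pi>\<in>T. C \<pi> (g \<pi>)) - (\<Sum>\<pi>\<in>T. C \<pi> (g' \<pi>))) \<in> filt d"
    using assms(2) unfolding normal_form_def by blast
  define U where "U = S \<union> T"
  let ?s = "\<lambda>h. (\<Sum>\<pi>\<in>U. C \<pi> (h \<pi>))"
  have U: "top_part U d h" "top_part U d h'" "top_part U d g" "top_part U d g'"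
    using S T top_part_extend[of S d _ T] top_part_extend[of T d _ S] by (auto simp: U_def Un_commute)
  have x: "x - (?s h - ?s h') \<in> filt d"
    using S top_part_sum_extend[OF S(1) T(1)] top_part_sum_extend[OF S(2) T(1)] by (simp add: U_def)
  have y: "y - (?s g - ?s g') \<in> filt d"
    using T top_part_sum_extend[OF T(1) S(1)] top_part_sum_extend[OF T(2) S(1)] by (simp add: U_def Un_commute)
  obtain k where k: "top_part U d k" "?s h + ?s g' - ?s k \<in> filt d"
    using top_part_add[OF U(1) U(4)] .
  obtain k' where k': "top_part U d k'" "?s h' + ?s g - ?s k' \<in> filt d"
    using top_part_add[OF U(2) U(3)] .
  have "x - y - (?s k - ?s k') = (x - (?s h - ?s h')) - (y - (?s g - ?s g'))
      + (?s h + ?s g' - ?s k) - (?s h' + ?s g - ?s k')"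
    by (simp add: algebra_simps)
  also have "\<dots> \<in> filt d" by (rule filt_diff[OF filt_add[OF filt_diff[OF x y] k(2)] k'(2)])
  finally show ?thesis using k k' unfolding normal_form_def by blast
qed

lemma normal_form_filt: "x \<in> filt d \<Longrightarrow> normal_form d x"
  unfolding normal_form_def
  by (rule exI[of _ "{}"], rule exI[of _ "\<lambda>_. 1"], rule exI[of _ "\<lambda>_. 1"])
     (auto simp: top_part_def KX_one)

lemma normal_form_uminus: "normal_form d x \<Longrightarrow> normal_form d (- x)"
  using normal_form_diff[OF normal_form_filt[OF filt_zero], of d x] by simp

lemma normal_form_add: "normal_form d x \<Longrightarrow> normal_form d y \<Longrightarrow> normal_form d (x + y)"
  using normal_form_diff[of d x "- y"] normal_form_uminus by simp

lemma normal_form_irreducible: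
  assumes "K_irreducible \<pi>" "degree \<pi> = Suc d" "h \<in> KX" "h \<noteq> 0" "degree h \<le> d"
  shows "normal_form d (C \<pi> h)"
  unfolding normal_form_def
  by (rule exI[of _ "{\<pi>}"], rule exI[of _ "(\<lambda>_. 1)(\<pi> := h)"], rule exI[of _ "\<lambda>_. 1"])
     (use assms one_right[of \<pi>] K_irreducible_KX K_irreducible_nonzero in \<open>auto simp: top_part_def KX_one filt_zero\<close>)

text \<open>Two monic polynomials of equal degree differ by some h of lower degree, and the
  Steinberg relation for \<rho> + h = \<pi> expresses their symbol by symbols with h or - 1.\<close>

lemma normal_form_irreducible2:
  assumes "K_irreducible \<pi>" "degree \<pi> = Suc d" "K_irreducible \<rho>" "degree \<rho> = Suc d"
  shows "normal_form d (C \<rho> \<pi>)"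
proof -
  have m1: "- 1 \<in> KX" using KX_one KX_uminus by blast
  have pK: "\<pi> \<in> KX" and p0: "\<pi> \<noteq> 0" and rK: "\<rho> \<in> KX" and r0: "\<rho> \<noteq> 0"
    using assms by (auto simp: K_irreducible_def)
  have p1: "normal_form d (C \<pi> (- 1))"
    using normal_form_irreducible[OF assms(1,2), of "- 1"] m1 by simp
  show ?thesis
  proof (cases "\<rho> = \<pi>")
    case True
    then show ?thesis using p1 self[OF pK p0] by simp
  next
    case False
    define h where "h = \<pi> - \<rho>"
    have h: "h \<in> KX" "h \<noteq> 0" "\<rho> + h = \<pi>" using False KX_diff[OF pK rK] by (auto simp: h_def)
    have "degree h \<le> Suc d" unfolding h_def using assms by (intro degree_diff_le) auto
    moreover have "coeff h (Suc d) = 0"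
      using assms by (auto simp: h_def K_irreducible_def)
    ultimately have "degree h < Suc d" using eq_zero_or_degree_less h(2) by blast
    then have dh: "degree h \<le> d" by simp
    have "C \<rho> h + C \<pi> \<pi> = C \<rho> \<pi> + C \<pi> h"
      using steinberg[of \<rho> h] h rK r0 p0 by simp
    then have "C \<rho> \<pi> = C \<rho> h + C \<pi> (- 1) - C \<pi> h"
      using self[OF pK p0] by (simp add: algebra_simps)
    then show ?thesis
      using p1 normal_form_irreducible[OF assms(1,2) h(1,2) dh] normal_form_irreducible[OF assms(3,4) h(1,2) dh]
      by (simp add: normal_form_add normal_form_diff)
  qed
qed

lemma normal_form_low_irreducible:
  assumes "K_irreducible \<pi>" "degree \<pi> = Suc d" "h \<in> KX" "h \<noteq> 0" "degree h \<le> d"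
  shows "normal_form d (C h \<pi>)"
  using normal_form_uminus[OF normal_form_irreducible[OF assms]] antisym[of \<pi> h] assms
    K_irreducible_KX K_irreducible_nonzero by auto

lemma filt_normal_form: "x \<in> filt (Suc d) \<Longrightarrow> normal_form d x"
  unfolding filt_def
proof (induction rule: group_closure.induct)
  case (base s)
  show ?case
  proof (cases "s = 0")
    case True
    then show ?thesis by (simp add: normal_form_filt filt_zero)
  next
    case False
    then obtain f g where fg: "f \<in> KX" "g \<in> KX" "f \<noteq> 0" "g \<noteq> 0" "degree f \<le> Suc d" "degree g \<le> Suc d" "s = C f g"
      using base by auto
    obtain f1 f2 where f: "f1 \<in> KX" "f2 \<in> KX" "f = f1 * f2" "degree f1 < Suc d"
        "degree f2 < Suc d \<or> K_irreducible f2 \<and> degree f2 = Suc d"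
      using KX_split[OF fg(1,3,5)] by blast
    obtain g1 g2 where g: "g1 \<in> KX" "g2 \<in> KX" "g = g1 * g2" "degree g1 < Suc d"
        "degree g2 < Suc d \<or> K_irreducible g2 \<and> degree g2 = Suc d"
      using KX_split[OF fg(2,4,6)] by blast
    have nz: "f1 \<noteq> 0" "f2 \<noteq> 0" "g1 \<noteq> 0" "g2 \<noteq> 0" using f g fg by auto
    have atoms: "normal_form d (C a b)" if "a \<in> KX" "b \<in> KX" "a \<noteq> 0" "b \<noteq> 0"
      "degree a < Suc d \<or> K_irreducible a \<and> degree a = Suc d"
      "degree b < Suc d \<or> K_irreducible b \<and> degree b = Suc d" for a b
      using that normal_form_irreducible[of a d b] normal_form_irreducible2[of b d a]
        normal_form_low_irreducible[of b d a] normal_form_filt[OF filt_base[of a b d]] by auto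
    have "s = (C f1 g1 + C f1 g2) + (C f2 g1 + C f2 g2)"
      using mult_left[of f1 f2] mult_right[of _ g1 g2] f g nz fg KX_mult by simp
    also have "normal_form d \<dots>"
      using f g nz by (intro normal_form_add atoms) auto
    finally show ?thesis .
  qed
next
  case (diff s t)
  then show ?case by (simp add: normal_form_diff)
qed

end

lemma group_closure_induct_hom:
  assumes "x \<in> group_closure S" "\<And>s. s \<in> S \<Longrightarrow> h s = (0::'b::ab_group_add)"
    "h 0 = 0" "\<And>a b. h (a - b) = h a - h b"
  shows "h (x :: 'a::ab_group_add) = 0"
  using assms(1) by induction (use assms in auto)

text \<open>The injectivity part of Milnor's theorem, by descent through the degree filtration. At a
  root \<tau> of an irreducible \<pi> of top degree, the tame symbol sees only the term of \<pi> and
  returns the inverse of \<open>poly (h \<pi>) \<tau>\<close>. As \<open>h \<pi>\<close> and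
  \<open>h' \<pi>\<close> have smaller degree than \<pi>, equal values at \<tau> make them equal. So
  the top part vanishes, and in degree 0 only constants remain.\<close>

theorem (in complex_subfield) unramified_symbol_vanishes:
  fixes c :: "complex poly \<Rightarrow> complex poly \<Rightarrow> 'm::ab_group_add"
  assumes c: "steinberg_symbol KX c"
    and const: "\<And>a b. a \<in> K \<Longrightarrow> b \<in> K \<Longrightarrow> a \<noteq> 0 \<Longrightarrow> b \<noteq> 0 \<Longrightarrow> c [:a:] [:b:] = 0"
    and x: "(m, 0) \<in> group_closure {(c f g, \<lambda>\<tau>. tame \<tau> f g) | f g. f \<in> KX \<and> g \<in> KX \<and> f \<noteq> 0 \<and> g \<noteq> 0}"
  shows "m = 0"
proof -
  define C where "C = (\<lambda>f g. (c f g, \<lambda>\<tau>. tame \<tau> f g))"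
  interpret c: steinberg_symbol KX c by fact
  interpret t: steinberg_symbol UNIV "\<lambda>f g \<tau>. tame \<tau> f g" by (rule steinberg_symbol_tame)
  interpret C: milnor_symbol K C
  proof
    fix f g h :: "complex poly"
    assume "f \<in> KX" "g \<in> KX" "h \<in> KX" "f \<noteq> 0" "g \<noteq> 0" "h \<noteq> 0"
    then show "C (f * g) h = C f h + C g h" "C f (g * h) = C f g + C f h"
      unfolding C_def using c.mult_left[of f g h] t.mult_left[of f g h] c.mult_right[of f g h] t.mult_right[of f g h]
      by simp_all
  next
    fix f g :: "complex poly"
    assume "f \<in> KX" "g \<in> KX" "f \<noteq> 0" "g \<noteq> 0" "f + g \<noteq> 0"
    then show "C f g + C (f + g) (f + g) = C f (f + g) + C (f + g) g"
      unfolding C_def using c.steinberg[of f g] t.steinberg[of f g] by simp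
  qed (auto intro: KX_one KX_uminus KX_add KX_mult)
  have tame_low: "snd y \<tau> = 0" if y: "y \<in> C.filt d" and \<pi>: "K_irreducible \<pi>" "degree \<pi> = Suc d" "poly \<pi> \<tau> = 0"
    for y d \<pi> \<tau>
  proof (rule group_closure_induct_hom[OF y[unfolded C.filt_def], of "\<lambda>y. snd y \<tau>"])
    fix s assume "s \<in> {C f g |f g. f \<in> KX \<and> g \<in> KX \<and> f \<noteq> 0 \<and> g \<noteq> 0 \<and> degree f \<le> d \<and> degree g \<le> d}"
    then show "snd s \<tau> = 0"
      using K_irreducible_root_degree[OF \<pi>(1,3)] \<pi>(2) by (auto simp: C_def intro!: tame_nonroots)
  qed auto
  have step: "(m, 0) \<in> C.filt d" if md: "(m, 0) \<in> C.filt (Suc d)" for d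
  proof -
    obtain S h h' where S: "C.top_part S d h" "C.top_part S d h'"
      and nf: "(m, 0) - ((\<Sum>\<pi>\<in>S. C \<pi> (h \<pi>)) - (\<Sum>\<pi>\<in>S. C \<pi> (h' \<pi>))) \<in> C.filt d"
      using C.filt_normal_form[OF md] unfolding C.normal_form_def by blast
    have fin: "finite S" using S by (auto simp: C.top_part_def)
    have "h \<pi> = h' \<pi>" if \<pi>: "\<pi> \<in> S" for \<pi>
    proof -
      have irr: "K_irreducible \<pi>" "degree \<pi> = Suc d" using S \<pi> by (auto simp: C.top_part_def)
      obtain \<tau> where tau: "poly \<pi> \<tau> = 0"
        using fundamental_theorem_of_algebra_alt[of \<pi>] irr(2) by (metis degree_0 degree_pCons_0 nat.distinct(1))
      have nr: "poly (k \<rho>) \<tau> \<noteq> 0" if "C.top_part S d k" for k \<rho>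
        using K_irreducible_root_degree[OF irr(1) tau, of "k \<rho>"] that irr(2) by (auto simp: C.top_part_def less_Suc_eq_le)
      have other: "poly \<rho> \<tau> \<noteq> 0" if "\<rho> \<in> S" "\<rho> \<noteq> \<pi>" for \<rho>
      proof -
        have r: "K_irreducible \<rho>" "degree \<rho> = Suc d" using S that by (auto simp: C.top_part_def)
        have "degree (\<rho> - \<pi>) \<le> Suc d" using r irr by (intro degree_diff_le) auto
        moreover have "coeff (\<rho> - \<pi>) (Suc d) = 0" using r irr by (auto simp: K_irreducible_def)
        ultimately have "degree (\<rho> - \<pi>) < Suc d" using eq_zero_or_degree_less[of "\<rho> - \<pi>" "Suc d"] that by auto
        then have "poly (\<rho> - \<pi>) \<tau> \<noteq> 0"
          using K_irreducible_root_degree[OF irr(1) tau, of "\<rho> - \<pi>"] r irr that KX_diff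
          by (auto simp: K_irreducible_def)
        then show ?thesis using tau by simp
      qed
      have sum: "snd (\<Sum>\<rho>\<in>S. C \<rho> (k \<rho>)) \<tau> = tame \<tau> \<pi> (k \<pi>)" if "C.top_part S d k" for k
      proof -
        have "snd (\<Sum>\<rho>\<in>S. C \<rho> (k \<rho>)) \<tau> = (\<Sum>\<rho>\<in>S. tame \<tau> \<rho> (k \<rho>))"
          using fin by (induction S rule: finite_induct) (auto simp: C_def)
        also have "\<dots> = (\<Sum>\<rho>\<in>{\<pi>}. tame \<tau> \<rho> (k \<rho>))"
          using fin \<pi> other nr[OF that] by (intro sum.mono_neutral_right) (auto intro!: tame_nonroots)
        finally show ?thesis by simp
      qed
      have "tame \<tau> \<pi> (h \<pi>) = tame \<tau> \<pi> (h' \<pi>)"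
        using tame_low[OF nf irr tau] sum[OF S(1)] sum[OF S(2)] by simp
      moreover have "cval (tame \<tau> \<pi> (k \<pi>)) = inverse (poly (k \<pi>) \<tau>)" if "C.top_part S d k" for k
      proof -
        have "\<pi> \<noteq> 0" "k \<pi> \<noteq> 0" using irr(2) nr[OF that, of \<pi>] by auto
        then show ?thesis
          using nr[OF that, of \<pi>] K_irreducible_order_root[OF irr(1) tau]
          by (simp add: cval_tame order_0I lead_at_nonroot field_simps)
      qed
      ultimately have "poly (h \<pi>) \<tau> = poly (h' \<pi>) \<tau>" using S by (metis inverse_eq_iff_eq)
      then have z: "poly (h \<pi> - h' \<pi>) \<tau> = 0" by simp
      have "h \<pi> - h' \<pi> \<in> KX" "degree (h \<pi> - h' \<pi>) < degree \<pi>"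
        using S irr(2) degree_diff_le[of "h \<pi>" d "h' \<pi>"] KX_diff by (auto simp: C.top_part_def less_Suc_eq_le)
      then show ?thesis using K_irreducible_root_degree[OF irr(1) tau, of "h \<pi> - h' \<pi>"] z by auto
    qed
    then have "(\<Sum>\<pi>\<in>S. C \<pi> (h \<pi>)) = (\<Sum>\<pi>\<in>S. C \<pi> (h' \<pi>))" by (intro sum.cong) auto
    then show ?thesis using nf by (simp add: zero_prod_def)
  qed
  have "\<exists>d. x \<in> C.filt d"
    if "x \<in> group_closure {C f g | f g. f \<in> KX \<and> g \<in> KX \<and> f \<noteq> 0 \<and> g \<noteq> 0}" for x
    using that
  proof (induction rule: group_closure.induct)
    case (base s)
    show ?case
    proof (cases "s = 0")
      case False
      then obtain f g where fg: "f \<in> KX" "g \<in> KX" "f \<noteq> 0" "g \<noteq> 0" "s = C f g" using base by auto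
      then show ?thesis using C.filt_base[of f g "max (degree f) (degree g)"] by auto
    qed (auto simp: C.filt_zero)
  next
    case (diff s t)
    then obtain d e where "s \<in> C.filt d" "t \<in> C.filt e" by auto
    then have "s \<in> C.filt (max d e)" "t \<in> C.filt (max d e)"
      using C.filt_mono[of d "max d e"] C.filt_mono[of e "max d e"] by auto
    then show ?case using C.filt_diff by blast
  qed
  then obtain d where "(m, 0) \<in> C.filt d" using x unfolding C_def by blast
  then have "(m, 0) \<in> C.filt 0" by (induction d) (auto intro: step)
  then have "fst (m, 0 :: complex \<Rightarrow> cunit) = 0"
    unfolding C.filt_def
  proof (rule group_closure_induct_hom)
    fix s assume "s \<in> {C f g |f g. f \<in> KX \<and> g \<in> KX \<and> f \<noteq> 0 \<and> g \<noteq> 0 \<and> degree f \<le> 0 \<and> degree g \<le> 0}"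
    then obtain f g where fg: "f \<in> KX" "g \<in> KX" "f \<noteq> 0" "g \<noteq> 0" "degree f = 0" "degree g = 0" "s = C f g" by auto
    obtain a b where "f = [:a:]" "g = [:b:]" using fg degree_eq_zeroE by metis
    then show "fst s = 0" using fg const[of a b] KX_lead_coeff[of f] KX_lead_coeff[of g] by (auto simp: C_def)
  qed auto
  then show ?thesis by simp
qed


section \<open>Galois automorphisms of cyclotomic fields\<close>

definition ipoly :: "int poly \<Rightarrow> complex \<Rightarrow> complex" where
  "ipoly p z = poly (map_poly of_int p) z"

lemma ipoly_pCons [simp]: "ipoly (pCons a p) z = of_int a + z * ipoly p z"
  by (simp add: ipoly_def map_poly_pCons)

lemma ipoly_0 [simp]: "ipoly 0 z = 0" and ipoly_1 [simp]: "ipoly 1 z = 1"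
  by (simp_all add: ipoly_def)

lemma ipoly_add [simp]: "ipoly (p + q) z = ipoly p z + ipoly q z"
proof -
  have "map_poly of_int (p + q) = (map_poly of_int p + map_poly of_int q :: complex poly)"
    by (rule poly_eqI) (simp add: coeff_map_poly)
  then show ?thesis by (simp add: ipoly_def)
qed

lemma ipoly_smult [simp]: "ipoly (smult a p) z = of_int a * ipoly p z"
  by (induction p) (auto simp: algebra_simps)

lemma ipoly_mult [simp]: "ipoly (p * q) z = ipoly p z * ipoly q z"
  by (induction p) (auto simp: algebra_simps)

lemma ipoly_diff [simp]: "ipoly (p - q) z = ipoly p z - ipoly q z"
  using ipoly_add[of "p - q" q z] by (simp del: ipoly_add)

lemma ipoly_power [simp]: "ipoly (p ^ n) z = ipoly p z ^ n"
  by (induction n) auto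

lemma ipoly_monom [simp]: "ipoly (monom a n) z = of_int a * z ^ n"
  by (induction n) (auto simp: monom_0 monom_Suc)

lemma ipoly_pcompose [simp]: "ipoly (pcompose p q) z = ipoly p (ipoly q z)"
  by (induction p) (auto simp: pcompose_pCons)

lemma prime_dvd_add_power:
  fixes a b :: "'a::comm_ring_1"
  assumes "prime q"
  shows "of_nat q dvd (a + b) ^ q - a ^ q - b ^ q"
proof -
  have q: "0 < q" "1 \<le> q" using prime_gt_0_nat[OF assms] by auto
  have "(a + b) ^ q = (\<Sum>k\<le>q. of_nat (q choose k) * a ^ k * b ^ (q - k))"
    by (rule binomial_ring)
  also have "{..q} = insert 0 (insert q {1..<q})" using q by auto
  also have "(\<Sum>k\<in>\<dots>. of_nat (q choose k) * a ^ k * b ^ (q - k))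
      = b ^ q + (a ^ q + (\<Sum>k\<in>{1..<q}. of_nat (q choose k) * a ^ k * b ^ (q - k)))"
    using q by (subst sum.insert) auto
  finally have "(a + b) ^ q - a ^ q - b ^ q = (\<Sum>k\<in>{1..<q}. of_nat (q choose k) * a ^ k * b ^ (q - k))"
    by simp
  moreover have "of_nat q dvd (of_nat (q choose k) :: 'a)" if "k \<in> {1..<q}" for k
  proof -
    have "q dvd q choose k" using that assms by (intro dvd_choose_prime) auto
    then show ?thesis by (metis dvd_def of_nat_mult)
  qed
  ultimately show ?thesis by (auto intro!: dvd_sum dvd_mult2)
qed

lemma prime_dvd_power_diff_self:
  fixes c :: int
  assumes "prime q"
  shows "int q dvd c ^ q - c"
proof (induction c rule: int_induct[where k = 0])
  case base
  then show ?case using prime_gt_0_nat[OF assms] by (simp add: zero_power)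
next
  case (step1 i)
  have "int q dvd (i + 1) ^ q - i ^ q - 1"
    using prime_dvd_add_power[OF assms, of i 1] by simp
  from dvd_add[OF this step1(2)] show ?case by (simp add: algebra_simps)
next
  case (step2 i)
  have "int q dvd i ^ q - (i - 1) ^ q - 1"
    using prime_dvd_add_power[OF assms, of "i - 1" 1] by simp
  from dvd_diff[OF step2(2) this] show ?case by (simp add: algebra_simps)
qed

text \<open>Induction on the coefficients: modulo q, taking q-th powers is additive and fixes
  integers by Fermat's theorem.\<close>

lemma frobenius_lift:
  fixes f :: "int poly"
  assumes "prime q"
  shows "of_nat q dvd pcompose f (monom 1 q) - f ^ q"
proof (induction f)
  case 0
  then show ?case using prime_gt_0_nat[OF assms] by (simp add: zero_power)
next
  case (pCons c p)
  have eq: "pCons c p = [:c:] + monom 1 1 * p"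
    by (simp add: monom_altdef)
  have 1: "of_nat q dvd (pCons c p) ^ q - [:c:] ^ q - (monom 1 1 * p) ^ q"
    unfolding eq by (rule prime_dvd_add_power[OF assms])
  have "[:c:] ^ q = [:c ^ q:]" by (metis poly_const_pow)
  moreover have "(of_nat q :: int poly) dvd [:c ^ q - c:]"
    using prime_dvd_power_diff_self[OF assms, of c] by (simp add: of_nat_poly const_poly_dvd_const_poly_iff)
  ultimately have 2: "of_nat q dvd [:c:] ^ q - [:c:]" by simp
  have 3: "of_nat q dvd monom 1 q * (pcompose p (monom 1 q) - p ^ q)"
    using pCons.IH by (rule dvd_mult)
  have "pcompose (pCons c p) (monom 1 q) - pCons c p ^ q
      = monom 1 q * (pcompose p (monom 1 q) - p ^ q)
        - (pCons c p ^ q - [:c:] ^ q - (monom 1 1 * p) ^ q) - ([:c:] ^ q - [:c:])"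
    by (simp add: pcompose_pCons power_mult_distrib monom_power algebra_simps)
  then show ?case using dvd_diff[OF dvd_diff[OF 3 1] 2] by (simp only:)
qed

text \<open>f has least degree among the divisors of X^N - 1 that vanish at z; dividing a monic
  polynomial, it has leading coefficient 1 or - 1. It is irreducible, hence prime in Z[X], and
  primality removes the integer factors that pseudo-division introduces.\<close>

lemma integral_minimal_polynomial:
  fixes z :: complex
  assumes "z ^ N = 1" "0 < N"
  obtains f h :: "int poly" where "monom 1 N - 1 = f * h" "ipoly f z = 0" "0 < degree f"
    "\<bar>lead_coeff f\<bar> = 1" "\<And>p. ipoly p z = 0 \<Longrightarrow> f dvd p"
proof -
  define A :: "int poly" where "A = monom 1 N - 1"
  have degA: "degree A = N" "lead_coeff A = 1"
  proof -
    have "degree A \<le> N" unfolding A_def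
      by (intro degree_diff_le) (auto simp: degree_monom_le)
    moreover have c: "coeff A N = 1" using assms(2) by (simp add: A_def coeff_1)
    ultimately show "degree A = N" by (metis le_degree le_antisym zero_neq_one)
    with c show "lead_coeff A = 1" by simp
  qed
  have A0: "A \<noteq> 0" using degA by auto
  have zA: "ipoly A z = 0" by (simp add: A_def assms)
  define f where "f = arg_min degree (\<lambda>f. f dvd A \<and> ipoly f z = 0)"
  have f: "f dvd A" "ipoly f z = 0" and fmin: "\<And>g. g dvd A \<Longrightarrow> ipoly g z = 0 \<Longrightarrow> degree f \<le> degree g"
    using arg_min_natI[of "\<lambda>f. f dvd A \<and> ipoly f z = 0" A degree]
      arg_min_nat_le[of "\<lambda>f. f dvd A \<and> ipoly f z = 0" _ degree] zA by (auto simp: f_def)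
  have f0: "f \<noteq> 0" using f A0 by auto
  obtain h where h: "A = f * h" using f by blast
  have "lead_coeff f * lead_coeff h = 1" using h degA(2) by (metis lead_coeff_mult)
  then have "\<bar>lead_coeff f * lead_coeff h\<bar> = 1" by simp
  then have lf: "\<bar>lead_coeff f\<bar> = 1" by (rule abs_zmult_eq_1)
  have df: "0 < degree f"
  proof (rule ccontr)
    assume "\<not> ?thesis"
    then obtain a where "f = [:a:]" using degree_eq_zeroE by blast
    then show False using f f0 by simp
  qed
  have "irreducible f"
  proof (rule irreducibleI)
    show "\<not> is_unit f" using df by (auto simp: is_unit_poly_iff)
    fix a b assume ab: "f = a * b"
    have nz: "a \<noteq> 0" "b \<noteq> 0" using ab f0 by auto
    have key: "is_unit c'" if "f = c * c'" "ipoly c z = 0" for c c'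
    proof -
      have "c dvd A" using that f by (metis dvd_mult_left)
      then have "degree f \<le> degree c" using fmin that by blast
      moreover have "c \<noteq> 0" "c' \<noteq> 0" using that f0 by auto
      ultimately have "degree c' = 0" using that by (simp add: degree_mult_eq)
      then obtain u where u: "c' = [:u:]" using degree_eq_zeroE by blast
      have "lead_coeff f = lead_coeff c * u" using that(1) u by (metis lead_coeff_mult lead_coeff_pCons(2))
      then have "\<bar>u * lead_coeff c\<bar> = 1" using lf by (simp add: mult.commute)
      then have "\<bar>u\<bar> = 1" by (rule abs_zmult_eq_1)
      then show ?thesis using u by (simp add: is_unit_const_poly_iff)
    qed
    have "ipoly a z = 0 \<or> ipoly b z = 0" using f(2) ab by simp
    then show "is_unit a \<or> is_unit b" using key[of a b] key[of b a] ab by (auto simp: mult.commute)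
  qed (use f0 in simp)
  then have pf: "prime_elem f" by (simp add: irreducible_imp_prime_elem)
  \<comment> \<open>The minimum over all polynomials vanishing at z, not only over divisors of X^N -
    1; \<open>f dvd g\<close> shows that f attains it.\<close>
  define g where "g = arg_min degree (\<lambda>g. g \<noteq> 0 \<and> ipoly g z = 0)"
  have g: "g \<noteq> 0" "ipoly g z = 0" and gmin: "\<And>p. p \<noteq> 0 \<Longrightarrow> ipoly p z = 0 \<Longrightarrow> degree g \<le> degree p"
    using arg_min_natI[of "\<lambda>g. g \<noteq> 0 \<and> ipoly g z = 0" f degree]
      arg_min_nat_le[of "\<lambda>g. g \<noteq> 0 \<and> ipoly g z = 0" _ degree] f f0 by (auto simp: g_def)
  have pdiv: "\<exists>a q. a \<noteq> 0 \<and> smult a p = e * q" if "ipoly p z = 0" "e \<noteq> 0" "ipoly e z = 0" "degree e \<le> degree g" for p e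
  proof -
    define r where "r = pseudo_mod p e"
    from pseudo_mod[OF that(2), of p] obtain a q where
      aq: "a \<noteq> 0" "smult a p = e * q + r" "r = 0 \<or> degree r < degree e"
      by (auto simp: r_def)
    have "ipoly (smult a p) z = ipoly (e * q + r) z" using aq(2) by (rule arg_cong)
    then have "ipoly r z = 0" using that by simp
    then have "r = 0" using gmin[of r] aq that by force
    then show ?thesis using aq by auto
  qed
  have notconst: "\<not> f dvd [:a:]" if "a \<noteq> 0" for a
    using dvd_imp_degree_le[of f "[:a:]"] that df by auto
  obtain a q where aq: "a \<noteq> 0" "smult a f = g * q" using pdiv[of f g] f g by auto
  then have "f dvd g * q" by (metis dvd_smult dvd_refl)
  then have "f dvd g"
  proof (rule prime_elem_dvd_multD[OF pf, THEN disjE])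
    assume "f dvd q"
    then obtain q' where "q = f * q'" by blast
    then have "f * [:a:] = f * (g * q')" using aq by (simp add: mult_ac)
    then have ga: "[:a:] = g * q'" using f0 mult_left_cancel by blast
    then have "q' \<noteq> 0" using aq by auto
    then have "degree g = 0" using ga g by (metis add_is_0 degree_mult_eq degree_pCons_0)
    then obtain b where "g = [:b:]" using degree_eq_zeroE by blast
    then show ?thesis using g by simp
  qed
  then have dfg: "degree f \<le> degree g" using g dvd_imp_degree_le by blast
  have "f dvd p" if p: "ipoly p z = 0" for p
  proof -
    obtain a q where "a \<noteq> 0" "smult a p = f * q" using pdiv[OF p f0 f(2) dfg] by blast
    then have "f dvd [:a:] * p" by simp
    then show ?thesis using prime_elem_dvd_multD[OF pf] notconst \<open>a \<noteq> 0\<close> by blast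
  qed
  then show ?thesis using that[of f h] h f df lf by (simp add: A_def)
qed

text \<open>Dedekind's congruence argument with a derivative. If f (z^q) were nonzero, the cofactor
  h would vanish at z^q, and differentiating X^N - 1 = f h there would make N a multiple of f (z^q)
  in Z[z]. Since f vanishes at z, the Frobenius congruence makes f (z^q) a multiple of q, so q would
  divide N, first in Z[z] and then in Z.\<close>

lemma root_of_unity_conjugate_prime:
  fixes z :: complex
  assumes "z ^ N = 1" "0 < N" "prime q" "\<not> q dvd N" "ipoly p z = 0"
  shows "ipoly p (z ^ q) = 0"
proof -
  obtain f h :: "int poly" where fh: "monom 1 N - 1 = f * h" and fz: "ipoly f z = 0" and df: "0 < degree f"
    and lf: "\<bar>lead_coeff f\<bar> = 1" and fdvd: "\<And>p. ipoly p z = 0 \<Longrightarrow> f dvd p"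
    using integral_minimal_polynomial[OF assms(1,2)] by blast
  have f0: "f \<noteq> 0" using df by auto
  have "ipoly f (z ^ q) = 0"
  proof (rule ccontr)
    assume nz: "ipoly f (z ^ q) \<noteq> 0"
    have zq: "(z ^ q) ^ N = 1" by (metis assms(1) mult.commute power_mult power_one)
    have "ipoly (f * h) (z ^ q) = 0" unfolding fh[symmetric] using zq by simp
    then have hz: "ipoly h (z ^ q) = 0" using nz by simp
    have "pderiv (monom 1 N - 1 :: int poly) = monom (int N) (N - 1)"
      by (simp add: pderiv_diff pderiv_monom)
    then have "monom (int N) (N - 1) = f * pderiv h + h * pderiv f"
      unfolding fh by (simp add: pderiv_mult)
    then have "ipoly (monom (int N) (N - 1)) (z ^ q) = ipoly (f * pderiv h + h * pderiv f) (z ^ q)"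
      by (rule arg_cong)
    then have "of_nat N * (z ^ q) ^ (N - 1) = ipoly f (z ^ q) * ipoly (pderiv h) (z ^ q)"
      using hz by simp
    moreover have "(z ^ q) ^ (N - 1) * z ^ q = 1"
      using zq assms(2) by (metis power_minus_mult)
    ultimately have N: "of_nat N = ipoly f (z ^ q) * ipoly (pderiv h) (z ^ q) * z ^ q"
      by (metis mult.assoc mult.right_neutral)
    obtain a where a: "pcompose f (monom 1 q) - f ^ q = of_nat q * a"
      using frobenius_lift[OF assms(3)] by blast
    have "ipoly (pcompose f (monom 1 q) - f ^ q) z = ipoly (of_nat q * a) z" using a by (rule arg_cong)
    then have fq: "ipoly f (z ^ q) = of_nat q * ipoly a z"
      using fz prime_gt_0_nat[OF assms(3)] by (simp add: of_nat_poly zero_power)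
    define w where "w = a * pcompose (pderiv h) (monom 1 q) * monom 1 q"
    have Nw: "of_nat N = of_nat q * ipoly w z" using N fq by (simp add: w_def)
    obtain s r where sr: "pseudo_divmod w f = (s, r)" by fastforce
    \<comment> \<open>A power of 1 or - 1, so the pseudo-division of w by f is a true division up to
      sign.\<close>
    define u where "u = lead_coeff f ^ (Suc (degree w) - degree f)"
    have u: "\<bar>u\<bar> = 1" using lf by (simp add: u_def power_abs)
    have wr: "smult u w = f * s + r" "r = 0 \<or> degree r < degree f"
      using pseudo_divmod[OF f0 sr] by (auto simp: u_def)
    have "ipoly (smult u w) z = ipoly (f * s + r) z" using wr(1) by (rule arg_cong)
    then have "ipoly r z = of_int u * ipoly w z" using fz by simp
    then have "ipoly ([:u * int N:] - smult (int q) r) z = 0"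
      using Nw by (simp add: algebra_simps)
    then have "f dvd [:u * int N:] - smult (int q) r" by (rule fdvd)
    moreover have "degree ([:u * int N:] - smult (int q) r) < degree f"
    proof -
      have "degree (smult (int q) r) \<le> degree r" by (rule degree_smult_le)
      then show ?thesis using wr(2) df degree_diff_le_max[of "[:u * int N:]" "smult (int q) r"] by auto
    qed
    ultimately have "[:u * int N:] - smult (int q) r = 0"
      using dvd_imp_degree_le[of f "[:u * int N:] - smult (int q) r"] by fastforce
    then have "coeff ([:u * int N:] - smult (int q) r) 0 = 0" by simp
    then have "int q dvd u * int N" by simp
    then have "int q dvd int N" using u by (auto simp: abs_if split: if_splits)
    then show False using assms(4) by simp
  qed
  then show ?thesis using fdvd[OF assms(5)] by auto
qed

lemma root_of_unity_conjugate:
  fixes z :: complex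
  assumes "z ^ N = 1" "0 < N" "coprime j N" "ipoly p z = 0" "0 < j"
  shows "ipoly p (z ^ j) = 0"
  using assms(3,5)
proof (induction j rule: prime_divisors_induct)
  case (unit j)
  then show ?case using assms(4) by simp
next
  case (factor q j)
  have cop: "coprime q N" "coprime j N" using factor.prems(1) by (simp_all add: coprime_mult_left_iff)
  have q: "prime q" "\<not> q dvd N"
    using factor.hyps cop(1) by (auto dest: coprime_common_divisor[of q N q])
  have "(z ^ j) ^ N = 1" by (metis assms(1) mult.commute power_mult power_one)
  then have "ipoly p ((z ^ j) ^ q) = 0"
    using root_of_unity_conjugate_prime[OF _ assms(2) q] factor.IH[OF cop(2)] factor.prems(2) by simp
  then show ?case by (simp add: mult.commute flip: power_mult)
qed simp

section \<open>Rational polynomials in \<zeta> and the automorphisms \<sigma>_j\<close>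

abbreviation rpoly :: "rat poly \<Rightarrow> complex \<Rightarrow> complex" where
  "rpoly p z \<equiv> poly (map_poly of_rat p) z"

lemma rpoly_add [simp]: "rpoly (p + q) z = rpoly p z + rpoly q z"
proof -
  have "map_poly of_rat (p + q) = (map_poly of_rat p + map_poly of_rat q :: complex poly)"
    by (rule poly_eqI) (simp add: coeff_map_poly of_rat_add)
  then show ?thesis by simp
qed

lemma rpoly_pCons [simp]: "rpoly (pCons a p) z = of_rat a + z * rpoly p z"
  by (simp add: map_poly_pCons)

lemma rpoly_smult [simp]: "rpoly (smult a p) z = of_rat a * rpoly p z"
  by (induction p) (auto simp: algebra_simps of_rat_mult)

lemma rpoly_mult [simp]: "rpoly (p * q) z = rpoly p z * rpoly q z"
  by (induction p) (auto simp: algebra_simps)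

lemma rpoly_diff [simp]: "rpoly (p - q) z = rpoly p z - rpoly q z"
  using rpoly_add[of "p - q" q z] by (simp del: rpoly_add)

lemma rpoly_uminus [simp]: "rpoly (- q) z = - rpoly q z"
  using rpoly_diff[of 0 q z] by (simp del: rpoly_diff)

lemma rpoly_monom [simp]: "rpoly (monom a n) z = of_rat a * z ^ n"
  by (induction n) (auto simp: monom_0 monom_Suc)

lemma clear_denominators:
  "\<exists>(c :: int) (P :: int poly). c \<noteq> 0 \<and> (\<forall>z. of_int c * rpoly p z = ipoly P z)"
proof (induction p)
  case 0
  then show ?case by (intro exI[of _ 1] exI[of _ 0]) auto
next
  case (pCons a p)
  obtain c P where c: "c \<noteq> 0" "\<And>z. of_int c * rpoly p z = ipoly P z" using pCons by blast
  obtain n d where a: "quotient_of a = (n, d)" by fastforce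
  then have d: "d > 0" "a = of_int n / of_int d"
    using quotient_of_denom_pos quotient_of_div by blast+
  have "of_rat a = (of_int n / of_int d :: complex)" using d by (simp add: of_rat_divide)
  then have "of_int (d * c) * rpoly (pCons a p) z = ipoly (pCons (n * c) (smult d P)) z" for z
    using c(2)[of z, symmetric] d by (simp add: algebra_simps)
  then show ?case using c(1) d(1) by (intro exI[of _ "d * c"] exI[of _ "pCons (n * c) (smult d P)"] conjI allI) simp_all
qed

lemma zeta_power: "0 < N \<Longrightarrow> zeta N ^ N = 1"
  by (simp add: zeta_def Complex.DeMoivre)

lemma zeta_nonzero [simp]: "zeta N \<noteq> 0"
  by (simp add: zeta_def)

lemma zeta_powi_add: "zeta N powi (a + b) = zeta N powi a * zeta N powi b"
  by (simp add: power_int_add)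

lemma zeta_powi_eq_1_iff: assumes "0 < N" shows "zeta N powi a = 1 \<longleftrightarrow> int N dvd a"
proof
  assume "int N dvd a"
  then show "zeta N powi a = 1" using zeta_power[OF assms] by (auto simp: power_int_mult)
next
  assume a: "zeta N powi a = 1"
  define r where "r = nat (a mod int N)"
  have "zeta N powi a = zeta N powi (int N * (a div int N)) * zeta N powi (a mod int N)"
    by (metis mult_div_mod_eq zeta_powi_add)
  also have "zeta N powi (int N * (a div int N)) = 1"
    using zeta_power[OF assms] by (auto simp: power_int_mult)
  also have "zeta N powi (a mod int N) = zeta N ^ r"
    using assms by (simp add: r_def power_int_def)
  finally have "cis (2 * pi * real r / real N) = 1" using a by (simp add: zeta_def Complex.DeMoivre mult_ac)
  then have "cos (2 * pi * real r / real N) = 1" by (metis cis.simps(1) one_complex.simps(1))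
  then obtain k :: int where k: "2 * pi * real r / real N = of_int k * 2 * pi"
    using cos_one_2pi_int by blast
  then have "real r = of_int k * real N" using assms by (simp add: field_simps)
  then have "int r = k * int N" by (metis of_int_eq_iff of_int_mult of_int_of_nat_eq)
  then have "N dvd r" by (metis dvd_triv_right int_dvd_int_iff)
  moreover have "r < N" using assms by (simp add: r_def nat_less_iff)
  ultimately have "r = 0" by (auto dest: dvd_imp_le)
  then have "a mod int N \<le> 0" by (simp add: r_def)
  then have "a mod int N = 0" using assms by (metis antisym of_nat_0_less_iff pos_mod_sign)
  then show "int N dvd a" by auto
qed

lemma zeta_powi_cong: "0 < N \<Longrightarrow> int N dvd a - b \<Longrightarrow> zeta N powi a = zeta N powi b"
  using zeta_powi_eq_1_iff[of N "a - b"] by (simp add: power_int_diff)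

text \<open>The choice in \<open>gal_sigma\<close> is independent of the polynomial because \<zeta>
  and its j-th power satisfy the same integer polynomials.\<close>

lemma gal_sigma_rpoly:
  assumes "0 < N" "coprime j (int N)"
  shows "gal_sigma N j (rpoly p (zeta N)) = rpoly p (zeta N powi j)"
proof -
  define r where "r = nat (j mod int N)"
  have r: "zeta N ^ r = zeta N powi j"
  proof -
    have "zeta N ^ r = zeta N powi (j mod int N)" using assms(1) by (simp add: r_def power_int_def)
    also have "\<dots> = zeta N powi j" by (rule zeta_powi_cong[OF assms(1)]) (simp add: mod_eq_dvd_iff[symmetric])
    finally show ?thesis .
  qed
  have "coprime (j mod int N) (int N)" using assms by (simp add: coprime_mod_left_iff)
  then have cop: "coprime r N" using assms(1) by (metis coprime_int_iff nat_0_le of_nat_0_less_iff pos_mod_sign r_def)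
  \<comment> \<open>r = 0 is coprime to N only for N = 1; then N serves as a positive
    exponent.\<close>
  define s where "s = (if r = 0 then N else r)"
  have s: "coprime s N" "0 < s" "zeta N ^ s = zeta N ^ r"
    using cop assms(1) zeta_power by (auto simp: s_def)
  have wd: "rpoly q (zeta N ^ r) = rpoly p (zeta N ^ r)" if "rpoly p (zeta N) = rpoly q (zeta N)" for q
  proof -
    obtain c P where c: "c \<noteq> 0" "\<And>z. of_int c * rpoly (q - p) z = ipoly P z"
      using clear_denominators[of "q - p"] by blast
    have "ipoly P (zeta N) = 0" using c(2)[of "zeta N", symmetric] that by simp
    then have "ipoly P (zeta N ^ s) = 0"
      using root_of_unity_conjugate[OF zeta_power] assms(1) s by blast
    then show ?thesis using c(1) c(2)[of "zeta N ^ s"] s(3) by simp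
  qed
  have "gal_sigma N j (rpoly p (zeta N)) = rpoly p (zeta N ^ r)"
    unfolding gal_sigma_def r_def[symmetric]
    by (rule some_equality) (use wd in blast)+
  then show ?thesis by (simp add: r)
qed

lemma cyc_fieldE: assumes "x \<in> cyc_field N" obtains p where "x = rpoly p (zeta N)"
  using assms by (auto simp: cyc_field_def)

lemma rpoly_cyc_field: "rpoly p (zeta N) \<in> cyc_field N"
  by (auto simp: cyc_field_def)

text \<open>Division of the minimal polynomial, \<mu> = s p + r, gives - s p = r at z with r of
  smaller degree than p, and r is nonzero at z by minimality. An inverse t of r yields the inverse -
  s t of p.\<close>

lemma rpoly_inverse:
  assumes "0 < N" "rpoly p (zeta N) \<noteq> 0"
  shows "\<exists>q. rpoly p (zeta N) * rpoly q (zeta N) = 1"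
proof -
  define z where "z = zeta N"
  define \<mu> where "\<mu> = arg_min degree (\<lambda>f. f \<noteq> 0 \<and> rpoly f z = 0)"
  define A :: "rat poly" where "A = monom 1 N - 1"
  have "coeff A N = 1" using assms(1) by (simp add: A_def coeff_1)
  then have "A \<noteq> 0" by auto
  moreover have "rpoly A z = 0" using zeta_power[OF assms(1)] by (simp add: A_def z_def)
  ultimately have mu: "\<mu> \<noteq> 0" "rpoly \<mu> z = 0" and
    mumin: "\<And>p. p \<noteq> 0 \<Longrightarrow> rpoly p z = 0 \<Longrightarrow> degree \<mu> \<le> degree p"
    using arg_min_natI[of "\<lambda>f. f \<noteq> 0 \<and> rpoly f z = 0" A degree]
      arg_min_nat_le[of "\<lambda>f. f \<noteq> 0 \<and> rpoly f z = 0" _ degree] by (auto simp: \<mu>_def)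
  have "\<exists>q. rpoly p z * rpoly q z = 1" if "rpoly p z \<noteq> 0" "degree p < degree \<mu>" for p
    using that
  proof (induction "degree p" arbitrary: p rule: less_induct)
    case less
    have p0: "p \<noteq> 0" using less.prems by auto
    show ?case
    proof (cases "degree p = 0")
      case True
      then obtain c where "p = [:c:]" using degree_eq_zeroE by blast
      then show ?thesis using less.prems by (intro exI[of _ "[:inverse c:]"]) (auto simp: of_rat_inverse)
    next
      case False
      define s r where "s = \<mu> div p" and "r = \<mu> mod p"
      have sr: "\<mu> = s * p + r" by (simp add: s_def r_def)
      have dr: "degree r < degree p" using degree_mod_less[of p \<mu>] p0 False by (auto simp: r_def)
      have ev: "rpoly s z * rpoly p z + rpoly r z = 0" using mu(2) sr by (metis rpoly_add rpoly_mult)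
      have "r \<noteq> 0"
      proof
        assume "r = 0"
        then have "rpoly s z = 0" using ev less.prems by simp
        moreover have "s \<noteq> 0" "degree \<mu> = degree s + degree p"
          using sr \<open>r = 0\<close> mu(1) p0 by (auto simp: degree_mult_eq)
        ultimately show False using mumin[of s] False by simp
      qed
      then have "rpoly r z \<noteq> 0" using mumin[of r] dr less.prems by force
      then obtain t where "rpoly r z * rpoly t z = 1" using less.hyps[OF dr] dr less.prems by auto
      then have "rpoly p z * rpoly (- s * t) z = 1"
        using ev by (simp add: eq_neg_iff_add_eq_0[symmetric] add.commute mult_ac)
      then show ?thesis by blast
    qed
  qed note small = this
  have "rpoly p z = rpoly (p mod \<mu>) z"
    using mu(2) by (metis add_0 div_mult_mod_eq mult_zero_right rpoly_add rpoly_mult)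
  moreover have dm: "degree \<mu> \<noteq> 0"
  proof
    assume "degree \<mu> = 0"
    then obtain c where "\<mu> = [:c:]" using degree_eq_zeroE by blast
    then show False using mu by simp
  qed
  moreover have "degree (p mod \<mu>) < degree \<mu>"
    using degree_mod_less[of \<mu> p] mu(1) dm by auto
  ultimately show ?thesis
    using small[of "p mod \<mu>"] assms(2) by (simp add: z_def)
qed

lemma complex_subfield_cyc_field:
  assumes "0 < N"
  shows "complex_subfield (cyc_field N)"
proof
  show "1 \<in> cyc_field N" using rpoly_cyc_field[of 1 N] by simp
  show "- a \<in> cyc_field N" if "a \<in> cyc_field N" for a
    using that by (metis cyc_fieldE rpoly_cyc_field rpoly_uminus)
  show "a + b \<in> cyc_field N" if "a \<in> cyc_field N" "b \<in> cyc_field N" for a b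
    using that by (metis cyc_fieldE rpoly_cyc_field rpoly_add)
  show "a * b \<in> cyc_field N" if "a \<in> cyc_field N" "b \<in> cyc_field N" for a b
    using that by (metis cyc_fieldE rpoly_cyc_field rpoly_mult)
  show "inverse a \<in> cyc_field N" if a: "a \<in> cyc_field N" for a
  proof (cases "a = 0")
    case True
    then show ?thesis using rpoly_cyc_field[of 0 N] by simp
  next
    case False
    obtain p where p: "a = rpoly p (zeta N)" using a by (rule cyc_fieldE)
    then obtain q where "a * rpoly q (zeta N) = 1" using rpoly_inverse[OF assms] False by blast
    then show ?thesis by (metis inverse_unique rpoly_cyc_field)
  qed
qed

lemma zeta_cyc_field: "zeta N \<in> cyc_field N"
  using rpoly_cyc_field[of "monom 1 1" N] by simp

context
  fixes N :: nat and j :: int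
  assumes N: "0 < N" and j: "coprime j (int N)"
begin

lemma gal_sigma_add:
  "a \<in> cyc_field N \<Longrightarrow> b \<in> cyc_field N \<Longrightarrow> gal_sigma N j (a + b) = gal_sigma N j a + gal_sigma N j b"
  by (elim cyc_fieldE) (simp add: gal_sigma_rpoly[OF N j] flip: rpoly_add)

lemma gal_sigma_mult:
  "a \<in> cyc_field N \<Longrightarrow> b \<in> cyc_field N \<Longrightarrow> gal_sigma N j (a * b) = gal_sigma N j a * gal_sigma N j b"
  by (elim cyc_fieldE) (simp add: gal_sigma_rpoly[OF N j] flip: rpoly_mult)

lemma gal_sigma_1: "gal_sigma N j 1 = 1"
  using gal_sigma_rpoly[OF N j, of 1] by simp

lemma gal_sigma_of_int: "gal_sigma N j (of_int n) = of_int n"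
  using gal_sigma_rpoly[OF N j, of "[:of_int n:]"] by simp

lemma gal_sigma_minus: "a \<in> cyc_field N \<Longrightarrow> gal_sigma N j (- a) = - gal_sigma N j a"
  by (elim cyc_fieldE) (simp add: gal_sigma_rpoly[OF N j] flip: rpoly_uminus)

lemma gal_sigma_zeta: "gal_sigma N j (zeta N) = zeta N powi j"
  using gal_sigma_rpoly[OF N j, of "monom 1 1"] by simp

lemma gal_sigma_closed: "a \<in> cyc_field N \<Longrightarrow> gal_sigma N j a \<in> cyc_field N"
proof -
  interpret complex_subfield "cyc_field N" by (rule complex_subfield_cyc_field[OF N])
  assume "a \<in> cyc_field N"
  then obtain p where p: "a = rpoly p (zeta N)" by (rule cyc_fieldE)
  have "rpoly q (zeta N powi j) \<in> cyc_field N" for q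
  proof (induction q)
    case (pCons c q)
    have "of_rat c \<in> cyc_field N" using rpoly_cyc_field[of "[:c:]" N] by simp
    then show ?case using pCons K_add K_mult K_powi[OF zeta_cyc_field] by simp
  qed (simp add: K_zero)
  then show ?thesis by (simp add: p gal_sigma_rpoly[OF N j])
qed

lemma gal_sigma_nonzero: assumes "a \<in> cyc_field N" "a \<noteq> 0" shows "gal_sigma N j a \<noteq> 0"
proof -
  interpret complex_subfield "cyc_field N" by (rule complex_subfield_cyc_field[OF N])
  have "gal_sigma N j a * gal_sigma N j (inverse a) = 1"
    using gal_sigma_mult[OF assms(1) K_inverse[OF assms(1)]] assms(2) gal_sigma_1 by simp
  then show ?thesis by auto
qed

lemma gal_sigma_zeta_powi: "gal_sigma N j (zeta N powi a) = zeta N powi (j * a)"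
proof -
  have pos: "gal_sigma N j (zeta N ^ n) = zeta N powi (j * int n)" for n
    using gal_sigma_rpoly[OF N j, of "monom 1 n"] by (simp add: power_int_mult)
  have "zeta N powi a = zeta N ^ nat (a mod int N)"
  proof -
    have "zeta N powi a = zeta N powi (a mod int N)"
      by (rule zeta_powi_cong[OF N]) (simp add: mod_eq_dvd_iff[symmetric])
    then show ?thesis using N by (simp add: power_int_def)
  qed
  then have "gal_sigma N j (zeta N powi a) = zeta N powi (j * (a mod int N))"
    using pos N by simp
  also have "\<dots> = zeta N powi (j * a)"
    by (rule zeta_powi_cong[OF N]) (simp add: mod_eq_dvd_iff[symmetric] mod_mult_right_eq)
  finally show ?thesis .
qed

lemma gal_sigma_one_minus_zeta_powi:
  "gal_sigma N j (1 - zeta N powi a) = 1 - zeta N powi (j * a)"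
proof -
  interpret complex_subfield "cyc_field N" by (rule complex_subfield_cyc_field[OF N])
  have z: "zeta N powi a \<in> cyc_field N" by (intro K_powi zeta_cyc_field)
  show ?thesis
    using gal_sigma_add[OF K_one K_uminus[OF z]] gal_sigma_minus[OF z]
    by (simp add: gal_sigma_1 gal_sigma_zeta_powi)
qed

end


section \<open>The quotient of the second K-group as a type\<close>

lemma zspan_uminus: "x \<in> zspan R \<Longrightarrow> - x \<in> zspan R"
  using zspan_diff[OF zspan_zero, of x R] by simp

lemma zspan_add: "x \<in> zspan R \<Longrightarrow> y \<in> zspan R \<Longrightarrow> x + y \<in> zspan R"
  using zspan_diff[of x R "- y"] zspan_uminus[of y R] by simp

lemma eqM_refl: "eqM N x x"
  by (simp add: eqM_def zspan_zero)

lemma eqM_sym: "eqM N x y \<Longrightarrow> eqM N y x"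
  unfolding eqM_def using zspan_uminus by fastforce

lemma eqM_trans: "eqM N x y \<Longrightarrow> eqM N y z \<Longrightarrow> eqM N x z"
  unfolding eqM_def using zspan_add[of "x - y" "rels N" "y - z"] by simp

lemma eqM_add: "eqM N x y \<Longrightarrow> eqM N x' y' \<Longrightarrow> eqM N (x + x') (y + y')"
  unfolding eqM_def using zspan_add[of "x - y" "rels N" "x' - y'"] by (simp add: algebra_simps)

lemma eqM_uminus: "eqM N x y \<Longrightarrow> eqM N (- x) (- y)"
  unfolding eqM_def using zspan_uminus[of "x - y" "rels N"] by (simp add: algebra_simps)

text \<open>The relations depend on N, so the type consists of families of classes, one for each N;
  only the component at a fixed N is used.\<close>

quotient_type K2fam = "nat \<Rightarrow> fgrp" / "\<lambda>x y. \<forall>n. eqM n (x n) (y n)"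
  by (rule equivpI) (auto intro!: reflpI sympI transpI intro: eqM_refl eqM_sym eqM_trans)

instantiation K2fam :: ab_group_add
begin
lift_definition zero_K2fam :: K2fam is "\<lambda>n. 0" .
lift_definition plus_K2fam :: "K2fam \<Rightarrow> K2fam \<Rightarrow> K2fam" is "\<lambda>x y n. x n + y n" by (auto intro: eqM_add)
lift_definition uminus_K2fam :: "K2fam \<Rightarrow> K2fam" is "\<lambda>x n. - x n" by (auto intro: eqM_uminus)
definition minus_K2fam :: "K2fam \<Rightarrow> K2fam \<Rightarrow> K2fam" where "minus_K2fam x y = x + - y"
instance
  by standard (unfold minus_K2fam_def, (transfer; simp add: eqM_refl algebra_simps)+)
end

definition cls :: "nat \<Rightarrow> fgrp \<Rightarrow> K2fam" where
  "cls N x = abs_K2fam (\<lambda>n. if n = N then x else 0)"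

lemma cls_eq_iff: "cls N x = cls N y \<longleftrightarrow> eqM N x y"
  by (auto simp: cls_def K2fam.abs_eq_iff eqM_refl)

lemma cls_0: "cls N 0 = 0"
  by (auto simp: cls_def zero_K2fam_def)

lemma cls_add: "cls N (x + y) = cls N x + cls N y"
  by (auto simp: cls_def plus_K2fam.abs_eq intro!: arg_cong[where f = abs_K2fam])

lemma cls_uminus: "cls N (- x) = - cls N x"
  by (auto simp: cls_def uminus_K2fam.abs_eq intro!: arg_cong[where f = abs_K2fam])

lemma cls_diff: "cls N (x - y) = cls N x - cls N y"
  using cls_add[of N x "- y"] by (simp add: cls_uminus)

lemma cls_sum: "cls N (\<Sum>i\<in>I. f i) = (\<Sum>i\<in>I. cls N (f i))"
  by (induction I rule: infinite_finite_induct) (auto simp: cls_0 cls_add)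

lemma cls_eq_0_iff: "cls N x = 0 \<longleftrightarrow> x \<in> zspan (rels N)"
  using cls_eq_iff[of N x 0] by (simp add: cls_0 eqM_def)

lemma zsmult_nat: "cls N (zsmult (int n) x) = (\<Sum>i<n. cls N x)"
proof -
  have "zsmult (int n) x = (\<Sum>i<n. x)"
  proof (induction n)
    case (Suc n)
    have "zsmult (int (Suc n)) x = zsmult (int n) x + x"
      by (rule poly_mapping_eqI) (auto simp: zsmult_def lookup_add map.rep_eq when_def algebra_simps)
    then show ?case using Suc by (simp add: algebra_simps)
  qed (auto intro: poly_mapping_eqI simp: zsmult_def map.rep_eq when_def)
  then show ?thesis by (simp only: cls_sum)
qed

lemma galM_superset:
  assumes "finite S" "Poly_Mapping.keys x \<subseteq> S"
  shows "galM N j x = (\<Sum>p\<in>S. Poly_Mapping.single (gal_sigma N j (fst p), gal_sigma N j (snd p)) (Poly_Mapping.lookup x p))"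
  unfolding galM_def using assms by (intro sum.mono_neutral_left) (auto simp: in_keys_iff)

lemma galM_add: "galM N j (x + y) = galM N j x + galM N j y"
proof -
  define S where "S = Poly_Mapping.keys x \<union> Poly_Mapping.keys y"
  have S: "finite S" "Poly_Mapping.keys x \<subseteq> S" "Poly_Mapping.keys y \<subseteq> S" "Poly_Mapping.keys (x + y) \<subseteq> S"
    using Poly_Mapping.keys_add[of x y] by (auto simp: S_def)
  show ?thesis
    by (simp add: galM_superset[OF S(1,2)] galM_superset[OF S(1,3)] galM_superset[OF S(1,4)]
        lookup_add single_add sum.distrib)
qed

lemma galM_0: "galM N j 0 = 0"
  by (simp add: galM_def)

lemma galM_diff: "galM N j (x - y) = galM N j x - galM N j y"
  using galM_add[of N j "x - y" y] by simp

lemma galM_symb: "galM N j (symb a b) = symb (gal_sigma N j a) (gal_sigma N j b)"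
  by (simp add: galM_def symb_def)

section \<open>Symbols of the cyclotomic field modulo Z_N\<close>

locale cyclotomic =
  fixes N :: nat
  assumes N_ge_2: "2 \<le> N"
begin

lemma N_pos: "0 < N"
  using N_ge_2 by simp

sublocale F: complex_subfield "cyc_field N"
  by (rule complex_subfield_cyc_field[OF N_pos])

definition ksym :: "complex \<Rightarrow> complex \<Rightarrow> K2fam" where
  "ksym a b = cls N (symb a b)"

lemma units_F_iff: "a \<in> units_F N \<longleftrightarrow> a \<in> cyc_field N \<and> a \<noteq> 0"
  by (auto simp: units_F_def)

lemma rels_cls: "r \<in> rels N \<Longrightarrow> cls N r = 0"
  by (simp add: cls_eq_0_iff zspan_gen)

lemma ksym_mult_left:
  assumes "a \<in> cyc_field N" "b \<in> cyc_field N" "c \<in> cyc_field N" "a \<noteq> 0" "b \<noteq> 0" "c \<noteq> 0"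
  shows "ksym (a * b) c = ksym a c + ksym b c"
proof -
  have "symb (a * b) c - symb a c - symb b c \<in> rels N"
    unfolding rels_def using assms units_F_iff by blast
  from rels_cls[OF this] show ?thesis by (simp add: ksym_def cls_diff cls_add algebra_simps)
qed

lemma ksym_mult_right:
  assumes "a \<in> cyc_field N" "b \<in> cyc_field N" "c \<in> cyc_field N" "a \<noteq> 0" "b \<noteq> 0" "c \<noteq> 0"
  shows "ksym a (b * c) = ksym a b + ksym a c"
proof -
  have "symb a (b * c) - symb a b - symb a c \<in> rels N"
    unfolding rels_def using assms units_F_iff by blast
  from rels_cls[OF this] show ?thesis by (simp add: ksym_def cls_diff cls_add algebra_simps)
qed

lemma ksym_steinberg:
  assumes "a \<in> cyc_field N" "a \<noteq> 0" "a \<noteq> 1"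
  shows "ksym a (1 - a) = 0"
proof -
  have "symb a (1 - a) \<in> rels N"
    unfolding rels_def using assms by (auto simp: units_F_iff)
  from rels_cls[OF this] show ?thesis by (simp add: ksym_def)
qed

lemma ksym_torsion: "ksym (- 1) (- zeta N) = 0"
proof -
  have "symb (- 1) (- zeta N) \<in> rels N"
    unfolding rels_def by auto
  from rels_cls[OF this] show ?thesis by (simp add: ksym_def)
qed

sublocale S: steinberg_symbol "cyc_field N" ksym
proof
  fix f g assume fg: "f \<in> cyc_field N" "g \<in> cyc_field N" "f \<noteq> 0" "g \<noteq> 0" "f + g \<noteq> 0"
  define h where "h = f + g"
  have h: "h \<in> cyc_field N" "h \<noteq> 0" using fg F.K_add by (auto simp: h_def)
  define a b where "a = f / h" and "b = g / h"
  have ab: "a \<in> cyc_field N" "b \<in> cyc_field N" "a \<noteq> 0" "b \<noteq> 0" "f = a * h" "g = b * h" "b = 1 - a"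
    using fg h F.K_divide by (auto simp: a_def b_def h_def field_simps)
  then have ab0: "ksym a b = 0" using ksym_steinberg[of a] by auto
  have "ksym f g = ksym f b + ksym f h" using ksym_mult_right[of f b h] ab fg h by simp
  also have "ksym f b = ksym a b + ksym h b" using ksym_mult_left[of a h b] ab fg h by simp
  also have "ksym h b = ksym h g - ksym h h" using ksym_mult_right[of h b h] ab fg h by simp
  finally show "ksym f g + ksym (f + g) (f + g) = ksym f (f + g) + ksym (f + g) g"
    using ab0 by (simp add: h_def)
qed (use ksym_mult_left ksym_mult_right in \<open>auto simp: F.K_one F.K_uminus F.K_add F.K_mult\<close>)

lemma ksym_inverse_right:
  assumes "a \<in> cyc_field N" "b \<in> cyc_field N" "a \<noteq> 0" "b \<noteq> 0"
  shows "ksym a (inverse b) = - ksym a b"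
proof -
  have "ksym a b + ksym a (inverse b) = 0"
    using ksym_mult_right[of a b "inverse b"] S.one_right[of a] assms F.K_inverse[of b] by simp
  then show ?thesis by (simp add: eq_neg_iff_add_eq_0 add.commute)
qed

lemma zeta_in: "zeta N powi a \<in> cyc_field N"
  by (intro F.K_powi zeta_cyc_field)

lemma m1_in: "- 1 \<in> cyc_field N"
  by (intro F.K_uminus F.K_one)

text \<open>The relation {-1, -\<zeta>} = 0 identifies {-1, -1} with this class, and {\<zeta>,
  \<zeta>} = {\<zeta>, -1}; so all symbols in - 1 and powers of \<zeta> are 0 or
  \<open>\<epsilon>\<close>.\<close>

definition \<epsilon> :: K2fam where "\<epsilon> = ksym (- 1) (zeta N)"

lemma eps_twice: "\<epsilon> + \<epsilon> = 0"
  using ksym_mult_left[of "- 1" "- 1" "zeta N"] S.one_left[of "zeta N"] m1_in zeta_cyc_field by (simp add: \<epsilon>_def)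

lemma uminus_eps: "- \<epsilon> = \<epsilon>"
  using eps_twice by (simp add: neg_eq_iff_add_eq_0)

lemma ksym_m1_m1: "ksym (- 1) (- 1) = \<epsilon>"
proof -
  have "ksym (- 1) (- zeta N) = ksym (- 1) (- 1) + \<epsilon>"
    using S.minus_right[of "- 1" "zeta N"] m1_in zeta_cyc_field by (simp add: \<epsilon>_def)
  then have "ksym (- 1) (- 1) = - \<epsilon>" using ksym_torsion by (simp add: eq_neg_iff_add_eq_0)
  then show ?thesis by (simp add: uminus_eps)
qed

lemma ksym_powi_zero:
  assumes "a \<in> cyc_field N" "a \<noteq> 0" "c \<in> cyc_field N" "c \<noteq> 0" "ksym a c = 0"
  shows "ksym a (c powi k) = 0"
proof -
  have nat: "ksym a (c ^ m) = 0" for m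
  proof (induction m)
    case (Suc m)
    then show ?case using ksym_mult_right[of a c "c ^ m"] assms F.K_power[of c m] by simp
  qed (use S.one_right assms in simp)
  then show ?thesis
    using ksym_inverse_right[of a "c ^ nat (- k)"] assms F.K_power[of c]
    by (auto simp: power_int_def power_inverse)
qed

lemma ksym_powi_right:
  assumes "a \<in> cyc_field N" "a \<noteq> 0" "b \<in> cyc_field N" "b \<noteq> 0"
  shows "even n \<Longrightarrow> ksym a b + ksym a b = 0 \<Longrightarrow> ksym a (b powi n) = 0"
    and "odd n \<Longrightarrow> ksym a b + ksym a b = 0 \<Longrightarrow> ksym a (b powi n) = ksym a b"
proof -
  have e: "ksym a (b powi (2 * k)) = 0" if "ksym a b + ksym a b = 0" for k
  proof -
    have "ksym a (b * b) = 0" using ksym_mult_right[of a b b] assms that by simp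
    moreover have "b powi (2 * k) = (b * b) powi k" by (simp add: power_int_mult power2_eq_square)
    ultimately show ?thesis using ksym_powi_zero[of a "b * b" k] assms F.K_mult[of b b] by simp
  qed
  show "ksym a (b powi n) = 0" if "even n" "ksym a b + ksym a b = 0"
    using that e by (auto elim: evenE)
  show "ksym a (b powi n) = ksym a b" if o: "odd n" "ksym a b + ksym a b = 0"
  proof -
    obtain k where k: "n = 2 * k + 1" using o by (auto elim: oddE)
    have "b powi n = b powi (2 * k) * b" using assms by (simp add: k power_int_add)
    then show ?thesis using ksym_mult_right[of a "b powi (2 * k)" b] e[OF o(2)] assms F.K_powi[of b] by simp
  qed
qed

lemma ksym_m1_zeta_powi: "ksym (- 1) (zeta N powi n) = (if even n then 0 else \<epsilon>)"
  using ksym_powi_right[of "- 1" "zeta N" n] m1_in zeta_cyc_field eps_twice by (auto simp: \<epsilon>_def)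

lemma ksym_zeta_powi_m1: "ksym (zeta N powi n) (- 1) = (if even n then 0 else \<epsilon>)"
  using S.antisym[of "- 1" "zeta N powi n"] m1_in zeta_in ksym_m1_zeta_powi[of n] uminus_eps by auto

text \<open>The expanded symbol is (1 + a) (1 + b) times \<open>\<epsilon>\<close>, which has order
  at most 2. It is zero because a and b are not both even.\<close>

lemma ksym_minus_zeta_powi:
  assumes "coprime a b"
  shows "ksym (- (zeta N powi a)) (- (zeta N powi b)) = 0"
proof -
  have zz: "ksym (zeta N) (zeta N) = \<epsilon>"
    using S.self[of "zeta N"] zeta_cyc_field ksym_zeta_powi_m1[of 1] by simp
  have z1: "ksym (zeta N powi a) (zeta N) = (if even a then 0 else \<epsilon>)"
  proof -
    have "ksym (zeta N) (zeta N powi a) = (if even a then 0 else \<epsilon>)"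
      using ksym_powi_right[of "zeta N" "zeta N" a] zeta_cyc_field zz eps_twice by auto
    then show ?thesis using S.antisym[of "zeta N" "zeta N powi a"] zeta_cyc_field zeta_in uminus_eps by auto
  qed
  then have tw: "ksym (zeta N powi a) (zeta N) + ksym (zeta N powi a) (zeta N) = 0" using eps_twice by auto
  have zab: "ksym (zeta N powi a) (zeta N powi b) = (if even a \<or> even b then 0 else \<epsilon>)"
    using ksym_powi_right[of "zeta N powi a" "zeta N" b] zeta_in zeta_cyc_field z1 tw by (cases "even b") auto
  have "ksym (- (zeta N powi a)) (- (zeta N powi b))
      = \<epsilon> + ksym (- 1) (zeta N powi b) + (ksym (zeta N powi a) (- 1) + ksym (zeta N powi a) (zeta N powi b))"
    using S.minus_left[of "zeta N powi a" "- (zeta N powi b)"] S.minus_right[of "- 1" "zeta N powi b"]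
      S.minus_right[of "zeta N powi a" "zeta N powi b"] zeta_in m1_in F.K_uminus[OF zeta_in] ksym_m1_m1
    by (simp add: algebra_simps)
  moreover have "odd a \<or> odd b" using assms coprime_common_divisor[of a b 2] by auto
  ultimately show ?thesis using zab eps_twice by (auto simp: ksym_m1_zeta_powi ksym_zeta_powi_m1 add.assoc[symmetric])
qed

subsection \<open>The Galois action\<close>

text \<open>Galois stability of Z_N. For odd j the value is twice \<open>\<epsilon>\<close>. For
  even j the number N is odd, and then \<open>\<epsilon>\<close> itself vanishes, being the symbol
  of - 1 and \<zeta>^N = 1.\<close>

lemma ksym_m1_minus_zeta_powi:
  assumes "coprime j (int N)"
  shows "ksym (- 1) (- (zeta N powi j)) = 0"
proof -
  have eq: "ksym (- 1) (- (zeta N powi j)) = \<epsilon> + ksym (- 1) (zeta N powi j)"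
    using S.minus_right[of "- 1" "zeta N powi j"] m1_in zeta_in ksym_m1_m1 by simp
  show ?thesis
  proof (cases "even j")
    case True
    then have "odd (int N)" using assms coprime_common_divisor[of j "int N" 2] by auto
    then have "\<epsilon> = 0"
      using ksym_m1_zeta_powi[of "int N"] zeta_power[OF N_pos] S.one_right[of "- 1"] m1_in by simp
    then show ?thesis using eq ksym_m1_zeta_powi[of j] by simp
  next
    case False
    then show ?thesis using eq ksym_m1_zeta_powi[of j] eps_twice by simp
  qed
qed

lemma galM_zspan:
  assumes j: "coprime j (int N)" and x: "x \<in> zspan (rels N)"
  shows "galM N j x \<in> zspan (rels N)"
  using x
proof induction
  case zspan_zero
  then show ?case by (simp add: galM_0 zspan.zspan_zero)
next
  case (zspan_diff x y)
  then show ?case by (simp add: galM_diff zspan.zspan_diff)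
next
  case (zspan_gen r)
  note gal = gal_sigma_mult[OF N_pos j] gal_sigma_closed[OF N_pos j] gal_sigma_nonzero[OF N_pos j]
    gal_sigma_1[OF N_pos j] gal_sigma_add[OF N_pos j] gal_sigma_minus[OF N_pos j]
  consider (l) a b c where "r = symb (a * b) c - symb a c - symb b c" "a \<in> units_F N" "b \<in> units_F N" "c \<in> units_F N"
    | (r) a b c where "r = symb a (b * c) - symb a b - symb a c" "a \<in> units_F N" "b \<in> units_F N" "c \<in> units_F N"
    | (s) a where "r = symb a (1 - a)" "a \<in> units_F N" "a \<noteq> 1"
    | (t) "r = symb (- 1) (- zeta N)"
    using zspan_gen unfolding rels_def by blast
  then have "cls N (galM N j r) = 0"
  proof cases
    case l
    then show ?thesis
      by (simp add: galM_diff galM_symb cls_diff ksym_def[symmetric] units_F_iff gal ksym_mult_left)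
  next
    case r
    then show ?thesis
      by (simp add: galM_diff galM_symb cls_diff ksym_def[symmetric] units_F_iff gal ksym_mult_right)
  next
    case s
    have a: "a \<in> cyc_field N" "a \<noteq> 0" using s by (auto simp: units_F_iff)
    have "gal_sigma N j (1 - a) = 1 - gal_sigma N j a"
      using gal_sigma_add[OF N_pos j F.K_one F.K_uminus[OF a(1)]] gal(4,6) a by simp
    moreover have "gal_sigma N j (1 - a) \<noteq> 0"
      using gal(3)[of "1 - a"] F.K_diff[OF F.K_one a(1)] s by simp
    ultimately show ?thesis
      using ksym_steinberg[of "gal_sigma N j a"] gal(2,3) a s by (simp add: galM_symb ksym_def[symmetric])
  next
    case t
    then show ?thesis
      using ksym_m1_minus_zeta_powi[OF j] gal(4,6) F.K_one zeta_cyc_field gal_sigma_zeta[OF N_pos j]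
      by (simp add: galM_symb ksym_def[symmetric])
  qed
  then show ?case by (simp add: cls_eq_0_iff)
qed

definition gal :: "int \<Rightarrow> K2fam \<Rightarrow> K2fam" where
  "gal j x = cls N (galM N j (rep_K2fam x N))"

lemma rep_cls: "eqM N (rep_K2fam (cls N x) N) x"
proof -
  have "cls N (rep_K2fam (cls N x) N) = cls N x"
  proof -
    have "abs_K2fam (rep_K2fam (cls N x)) = abs_K2fam (\<lambda>n. if n = N then x else 0)"
      by (simp add: cls_def Quotient_abs_rep[OF Quotient_K2fam])
    then have "\<forall>n. eqM n (rep_K2fam (cls N x) n) (if n = N then x else 0)"
      by (simp add: K2fam.abs_eq_iff)
    then show ?thesis unfolding cls_eq_iff by (metis (full_types))
  qed
  then show ?thesis by (simp add: cls_eq_iff)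
qed

lemma rep_add: "eqM N (rep_K2fam (x + y) N) (rep_K2fam x N + rep_K2fam y N)"
proof -
  have "abs_K2fam (rep_K2fam (x + y)) = abs_K2fam (\<lambda>n. rep_K2fam x n + rep_K2fam y n)"
    using plus_K2fam.abs_eq[of "rep_K2fam x" "rep_K2fam y"]
    by (simp add: Quotient_abs_rep[OF Quotient_K2fam])
  then show ?thesis by (simp add: K2fam.abs_eq_iff)
qed

context
  fixes j :: int
  assumes j: "coprime j (int N)"
begin

lemma cls_galM_cong: "eqM N x y \<Longrightarrow> cls N (galM N j x) = cls N (galM N j y)"
  using galM_zspan[OF j, of "x - y"] by (simp add: cls_eq_iff eqM_def galM_diff)

lemma gal_cls: "gal j (cls N x) = cls N (galM N j x)"
  unfolding gal_def by (rule cls_galM_cong[OF rep_cls])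

lemma gal_add: "gal j (x + y) = gal j x + gal j y"
  unfolding gal_def cls_galM_cong[OF rep_add] by (simp add: galM_add cls_add)

lemma gal_0: "gal j 0 = 0"
  using gal_cls[of 0] by (simp add: cls_0 galM_0)

lemma gal_uminus: "gal j (- x) = - gal j x"
  using gal_add[of x "- x"] gal_0 by (simp add: eq_neg_iff_add_eq_0 add.commute)

lemma gal_diff: "gal j (x - y) = gal j x - gal j y"
  using gal_add[of x "- y"] gal_uminus by simp

lemma gal_sum: "gal j (\<Sum>i\<in>I. f i) = (\<Sum>i\<in>I. gal j (f i))"
  by (induction I rule: infinite_finite_induct) (auto simp: gal_0 gal_add)

lemma gal_ksym: "gal j (ksym a b) = ksym (gal_sigma N j a) (gal_sigma N j b)"
  by (simp add: ksym_def gal_cls galM_symb)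

end

text \<open>\<open>fgrp\<close> also contains symbols with entries outside the field;
  \<open>carr\<close> tracks the classes that are admissible in \<open>cohom_eq\<close>.\<close>

definition carr :: "K2fam set" where
  "carr = cls N ` M_carrier N"

lemma carr_diff: "x \<in> carr \<Longrightarrow> y \<in> carr \<Longrightarrow> x - y \<in> carr"
proof -
  assume "x \<in> carr" "y \<in> carr"
  then obtain a b where ab: "a \<in> M_carrier N" "b \<in> M_carrier N" "x = cls N a" "y = cls N b"
    by (auto simp: carr_def)
  have "Poly_Mapping.keys (a - b) \<subseteq> Poly_Mapping.keys a \<union> Poly_Mapping.keys b"
    by (rule Poly_Mapping.keys_diff)
  then have "a - b \<in> M_carrier N" using ab by (auto simp: M_carrier_def)
  then show ?thesis using ab by (metis carr_def cls_diff image_eqI)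
qed

lemma carr_0: "0 \<in> carr"
  using cls_0[of N] by (auto simp: carr_def M_carrier_def intro!: image_eqI[of _ _ 0])

lemma carr_add: "x \<in> carr \<Longrightarrow> y \<in> carr \<Longrightarrow> x + y \<in> carr"
  using carr_diff[of x "0 - y"] carr_diff[OF carr_0, of y] by simp

lemma carr_sum: "(\<And>i. i \<in> I \<Longrightarrow> f i \<in> carr) \<Longrightarrow> (\<Sum>i\<in>I. f i) \<in> carr"
  by (induction I rule: infinite_finite_induct) (auto simp: carr_0 carr_add)

lemma carr_ksym: "a \<in> units_F N \<Longrightarrow> b \<in> units_F N \<Longrightarrow> ksym a b \<in> carr"
  by (auto simp: carr_def ksym_def M_carrier_def symb_def)

lemma carr_gal: assumes "coprime j (int N)" "x \<in> carr" shows "gal j x \<in> carr"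
proof -
  obtain a where a: "a \<in> M_carrier N" "x = cls N a" using assms by (auto simp: carr_def)
  have "Poly_Mapping.keys (galM N j a)
      \<subseteq> (\<Union>p\<in>Poly_Mapping.keys a. Poly_Mapping.keys (Poly_Mapping.single (gal_sigma N j (fst p), gal_sigma N j (snd p)) (Poly_Mapping.lookup a p)))"
    unfolding galM_def by (rule Poly_Mapping.keys_sum)
  also have "\<dots> \<subseteq> units_F N \<times> units_F N"
  proof (intro UN_least subsetI)
    fix p q assume p: "p \<in> Poly_Mapping.keys a"
      and q: "q \<in> Poly_Mapping.keys (Poly_Mapping.single (gal_sigma N j (fst p), gal_sigma N j (snd p)) (Poly_Mapping.lookup a p))"
    have "q = (gal_sigma N j (fst p), gal_sigma N j (snd p))" using q by (auto split: if_splits)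
    moreover have "fst p \<in> units_F N" "snd p \<in> units_F N" using p a(1) by (auto simp: M_carrier_def)
    ultimately show "q \<in> units_F N \<times> units_F N"
      using gal_sigma_closed[OF N_pos assms(1)] gal_sigma_nonzero[OF N_pos assms(1)] by (auto simp: units_F_iff)
  qed
  finally have "galM N j a \<in> M_carrier N" by (simp add: M_carrier_def)
  then show ?thesis using a gal_cls[OF assms(1)] by (auto simp: carr_def)
qed

end


section \<open>The potential of the cocycle on primitive vectors\<close>

definition wedge :: "int \<times> int \<Rightarrow> int \<times> int \<Rightarrow> int" where
  "wedge v w = fst v * snd w - fst w * snd v"

lemma wedge_simps:
  "wedge (u + v) w = wedge u w + wedge v w" "wedge u (v + w) = wedge u v + wedge u w"
  "wedge (u - v) w = wedge u w - wedge v w" "wedge u (v - w) = wedge u v - wedge u w"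
  "wedge (- v) w = - wedge v w" "wedge v (- w) = - wedge v w" "wedge v v = 0"
  by (simp_all add: wedge_def algebra_simps)

lemma wedge_swap: "wedge w v = - wedge v w"
  by (simp add: wedge_def algebra_simps)

definition prim :: "int \<times> int \<Rightarrow> bool" where
  "prim v \<longleftrightarrow> coprime (fst v) (snd v)"

lemma wedge_1_prim: assumes "wedge v w = 1" shows "prim v" "prim w"
proof -
  have "c dvd 1" if "c dvd fst v" "c dvd snd v" for c
    using that assms by (metis dvd_diff dvd_mult dvd_mult2 wedge_def)
  then show "prim v" unfolding prim_def by (intro coprimeI)
  have "c dvd 1" if "c dvd fst w" "c dvd snd w" for c
    using that assms by (metis dvd_diff dvd_mult dvd_mult2 wedge_def)
  then show "prim w" unfolding prim_def by (intro coprimeI)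
qed

lemma prim_uminus [simp]: "prim (- v) = prim v"
  by (simp add: prim_def)

lemma prim_partner: assumes "prim v" shows "\<exists>w. wedge v w = 1"
proof -
  obtain x y where "x * fst v + y * snd v = 1"
    using assms bezout_int[of "fst v" "snd v"] by (auto simp: prim_def)
  then show ?thesis by (intro exI[of _ "(- y, x)"]) (simp add: wedge_def algebra_simps)
qed

lemma wedge_basis_snd:
  assumes "wedge u w = 1"
  shows "snd p = wedge p w * snd u + wedge u p * snd w"
proof -
  have "snd p * wedge u w = wedge p w * snd u + wedge u p * snd w"
    by (simp add: wedge_def algebra_simps)
  then show ?thesis using assms by simp
qed

text \<open>A Farey parent of v. For first coordinate 1 it is (0, - 1).\<close>

definition par :: "int \<times> int \<Rightarrow> int \<times> int" where
  "par v = (SOME p. 0 \<le> fst p \<and> fst p < fst v \<and> wedge p v = 1)"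

lemma par_props: assumes "prim v" "0 < fst v"
  shows "0 \<le> fst (par v)" "fst (par v) < fst v" "wedge (par v) v = 1"
proof -
  obtain w where w: "wedge v w = 1" using prim_partner[OF assms(1)] by blast
  define k where "k = (- fst w) div fst v"
  define p where "p = (- fst w - k * fst v, - snd w - k * snd v)"
  have "fst p = (- fst w) mod fst v" by (simp add: p_def k_def minus_div_mult_eq_mod)
  then have "0 \<le> fst p" "fst p < fst v" using assms(2) by simp_all
  moreover have "wedge p v = wedge v w" by (simp add: p_def wedge_def algebra_simps)
  ultimately have "\<exists>p. 0 \<le> fst p \<and> fst p < fst v \<and> wedge p v = 1" using w by metis
  from someI_ex[OF this] show "0 \<le> fst (par v)" "fst (par v) < fst v" "wedge (par v) v = 1"
    by (simp_all add: par_def)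
qed

lemma par_unique:
  assumes "0 \<le> fst p" "fst p < fst v" "wedge p v = 1"
  shows "p = par v"
proof -
  have v: "prim v" "0 < fst v" using assms wedge_1_prim by auto
  note q = par_props[OF v]
  have e: "fst p * snd v - fst v * snd p = fst (par v) * snd v - fst v * snd (par v)"
    using assms(3) q(3) by (simp add: wedge_def)
  then have "(fst p - fst (par v)) * snd v = fst v * (snd p - snd (par v))" by (simp add: algebra_simps)
  then have "fst v dvd fst p - fst (par v)"
    using v(1) by (metis coprime_dvd_mult_left_iff dvd_triv_left prim_def)
  then have "fst p - fst (par v) = 0"
    using dvd_imp_le_int[of "fst p - fst (par v)" "fst v"] assms q by linarith
  then have f: "fst p = fst (par v)" by simp
  then have "snd p = snd (par v)" using e v(2) by simp
  with f show ?thesis by (simp add: prod_eq_iff)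
qed

context cyclotomic
begin

definition good :: "int \<times> int \<Rightarrow> bool" where
  "good v \<longleftrightarrow> \<not> int N dvd snd v"

definition odd_weight :: "(int \<times> int \<Rightarrow> int) \<Rightarrow> bool" where
  "odd_weight \<beta> \<longleftrightarrow> (\<forall>v. prim v \<longrightarrow> \<not> good v \<longrightarrow> \<beta> v \<noteq> 0 \<and> \<beta> (- v) = - \<beta> v)"

text \<open>For good v this is the value of 1 - z1^b z2^d at (1, \<zeta>), where v = (b, d). At bad v the function
  vanishes, and any nonzero number that is odd in v serves as a substitute: the choice cancels along
  paths with good end points.\<close>

definition phi :: "(int \<times> int \<Rightarrow> int) \<Rightarrow> int \<times> int \<Rightarrow> complex" where
  "phi \<beta> v = (if good v then 1 - zeta N powi snd v else of_int (\<beta> v))"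

definition P :: "(int \<times> int \<Rightarrow> int) \<Rightarrow> int \<times> int \<Rightarrow> int \<times> int \<Rightarrow> K2fam" where
  "P \<beta> v w = ksym (phi \<beta> w) (phi \<beta> (- v))"

lemma odd_weight_nonzero: "odd_weight \<beta> \<Longrightarrow> prim v \<Longrightarrow> \<not> good v \<Longrightarrow> \<beta> v \<noteq> 0"
  by (simp only: odd_weight_def) blast

lemma odd_weight_uminus: "odd_weight \<beta> \<Longrightarrow> prim v \<Longrightarrow> \<not> good v \<Longrightarrow> \<beta> (- v) = - \<beta> v"
  by (simp only: odd_weight_def) blast

lemma good_iff: "good v \<longleftrightarrow> zeta N powi snd v \<noteq> 1"
  by (simp add: good_def zeta_powi_eq_1_iff[OF N_pos])

lemma good_uminus [simp]: "good (- v) = good v"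
  by (simp add: good_def)

lemma bad_fst_nonzero: assumes "prim u" "\<not> good u" shows "fst u \<noteq> 0"
proof
  assume "fst u = 0"
  then have "snd u = 1 \<or> snd u = - 1" using assms by (auto simp: prim_def)
  then show False using assms N_ge_2 by (auto simp: good_def)
qed

lemma good_neighbour: "wedge v w = 1 \<Longrightarrow> \<not> good v \<Longrightarrow> good w"
proof (rule ccontr)
  assume w: "wedge v w = 1" "\<not> good v" "\<not> good w"
  then have "int N dvd 1" by (metis dvd_diff dvd_mult good_def wedge_def)
  then show False using N_ge_2 by simp
qed

lemma one_minus_in: "a \<in> cyc_field N \<Longrightarrow> 1 - a \<in> cyc_field N"
  by (intro F.K_diff F.K_one)

lemma ksym_one_minus_inverse:
  assumes "a \<in> cyc_field N" "a \<noteq> 0" "y \<in> cyc_field N" "y \<noteq> 0" "y \<noteq> 1"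
  shows "ksym a (1 - inverse y) = ksym a (1 - y) + ksym a (- 1) - ksym a y"
proof -
  have "1 - inverse y = (1 - y) * ((- 1) * inverse y)" using assms by (simp add: field_simps)
  then have "ksym a (1 - inverse y) = ksym a (1 - y) + ksym a ((- 1) * inverse y)"
    using ksym_mult_right[of a "1 - y" "(- 1) * inverse y"] assms one_minus_in[of y]
      F.K_uminus[OF F.K_inverse[of y]] by simp
  also have "ksym a ((- 1) * inverse y) = ksym a (- 1) - ksym a y"
    using ksym_mult_right[of a "- 1" "inverse y"] ksym_inverse_right[of a y] assms m1_in F.K_inverse[of y] by simp
  finally show ?thesis by simp
qed

lemma ksym_one_minus: "\<lbrakk>x \<in> cyc_field N; x \<noteq> 0; x \<noteq> 1\<rbrakk> \<Longrightarrow> ksym (1 - x) x = 0"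
  using ksym_steinberg[of "1 - x"] one_minus_in[of x] by simp

lemma ksym_one_minus_self:
  assumes "x \<in> cyc_field N" "x \<noteq> 0" "x \<noteq> 1"
  shows "ksym (1 - x) (1 - inverse x) = 0"
  using ksym_one_minus_inverse[of "1 - x" x] ksym_one_minus[of x] S.self[of "1 - x"]
    S.minus_one_right_twice[of "1 - x"] one_minus_in[of x] assms by simp

text \<open>The Steinberg relation for (1 - x) + x (1 - y) = 1 - x y. Passing to inverses in the
  second entries adds only terms in - 1, y and x y, which cancel.\<close>

lemma ksym_three_term:
  assumes x: "x \<in> cyc_field N" "x \<noteq> 0" "x \<noteq> 1" and y: "y \<in> cyc_field N" "y \<noteq> 0" "y \<noteq> 1" and xy: "x * y \<noteq> 1"
  shows "ksym (1 - x) (1 - inverse y) = ksym (1 - x * y) (1 - inverse y) + ksym (1 - x) (1 - inverse (x * y))"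
proof -
  have m: "x * y \<in> cyc_field N" using x y F.K_mult by blast
  define f h where "f = 1 - x" and "h = 1 - x * y"
  have fh: "f \<in> cyc_field N" "h \<in> cyc_field N" "f \<noteq> 0" "h \<noteq> 0"
    using x y xy m one_minus_in by (auto simp: f_def h_def)
  have y1: "1 - y \<in> cyc_field N" "1 - y \<noteq> 0" using y one_minus_in by auto
  have "f + x * (1 - y) = h" by (simp add: f_def h_def algebra_simps)
  then have "ksym f (x * (1 - y)) + ksym h h = ksym f h + ksym h (x * (1 - y))"
    using S.steinberg[of f "x * (1 - y)"] fh x y1 F.K_mult by simp
  then have A: "ksym f (1 - y) + ksym h (- 1) = ksym f h + ksym h x + ksym h (1 - y)"
    using ksym_mult_right[of f x "1 - y"] ksym_mult_right[of h x "1 - y"] S.self[of h] ksym_one_minus[OF x]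
      fh x y1 by (simp add: f_def algebra_simps)
  have B: "ksym h x + ksym h y = 0"
    using ksym_mult_right[of h x y] ksym_one_minus[of "x * y"] fh x y m xy by (simp add: h_def)
  have D: "ksym h (- 1) + ksym h (- 1) = 0" using S.minus_one_right_twice fh by blast
  have E: "ksym f (x * y) = ksym f y"
    using ksym_mult_right[of f x y] ksym_one_minus[OF x] fh x y by (simp add: f_def)
  have g1: "ksym f (1 - inverse y) = ksym f (1 - y) + ksym f (- 1) - ksym f y"
    using ksym_one_minus_inverse fh y by blast
  have g2: "ksym h (1 - inverse y) = ksym h (1 - y) + ksym h (- 1) - ksym h y"
    using ksym_one_minus_inverse fh y by blast
  have g3: "ksym f (1 - inverse (x * y)) = ksym f h + ksym f (- 1) - ksym f y"
    using ksym_one_minus_inverse[of f "x * y"] fh m x y xy E by (simp add: h_def)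
  have g4: "ksym f (1 - y) = ksym f h - ksym h y + ksym h (1 - y) + ksym h (- 1)"
  proof -
    have "ksym f (1 - y) = ksym f h + ksym h x + ksym h (1 - y) + - ksym h (- 1)"
      using A by (simp add: eq_diff_eq)
    also have "- ksym h (- 1) = ksym h (- 1)" using D by (simp add: neg_eq_iff_add_eq_0)
    also have "ksym h x = - ksym h y" using B by (simp add: eq_neg_iff_add_eq_0)
    finally show ?thesis by simp
  qed
  show ?thesis unfolding f_def[symmetric] h_def[symmetric] g1 g2 g3 g4 by simp
qed

context
  fixes \<beta> :: "int \<times> int \<Rightarrow> int"
  assumes \<beta>: "odd_weight \<beta>"
begin

lemma phi_in: "prim v \<Longrightarrow> phi \<beta> v \<in> cyc_field N"
  unfolding phi_def using zeta_in one_minus_in F.K_of_int by auto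

lemma phi_nonzero: "prim v \<Longrightarrow> phi \<beta> v \<noteq> 0"
  using odd_weight_nonzero[OF \<beta>] by (auto simp: phi_def good_iff)

text \<open>Oddness of the weight extends the formula from good to bad v, where the power of \<zeta>
  is 1.\<close>

lemma phi_uminus: assumes "prim v" shows "phi \<beta> (- v) = phi \<beta> v * - (zeta N powi (- snd v))"
proof (cases "good v")
  case True
  then show ?thesis by (simp add: phi_def power_int_minus field_simps)
next
  case False
  then show ?thesis using odd_weight_uminus[OF \<beta> assms] by (simp add: phi_def good_iff power_int_minus)
qed

text \<open>At most one of v, w, v + w is bad, since any two of them form a basis. If none is, this
  is \<open>ksym_three_term\<close>; otherwise the weight cancels, by {1 - x, 1 - 1/x} = 0 or {a, a}
  = {a, - 1}.\<close>

lemma P_three_term: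
  assumes "wedge v w = 1"
  shows "P \<beta> v w = P \<beta> v (v + w) + P \<beta> (v + w) w"
proof -
  define x y where "x = zeta N powi snd w" and "y = zeta N powi snd v"
  have xy: "x \<in> cyc_field N" "y \<in> cyc_field N" "x \<noteq> 0" "y \<noteq> 0" using zeta_in by (auto simp: x_def y_def)
  have z: "zeta N powi snd (v + w) = x * y" by (simp add: x_def y_def zeta_powi_add)
  have iv: "zeta N powi (- snd v) = inverse y" "zeta N powi (- snd (v + w)) = inverse (x * y)"
    unfolding z[symmetric] by (simp_all only: y_def power_int_minus)
  have pr: "prim v" "prim w" using wedge_1_prim[OF assms] by auto
  have "wedge v (v + w) = 1" using assms by (simp add: wedge_simps)
  then have prs: "prim (v + w)" using wedge_1_prim by blast
  have gv: "good v \<longleftrightarrow> y \<noteq> 1" and gw: "good w \<longleftrightarrow> x \<noteq> 1" and gvw: "good (v + w) \<longleftrightarrow> x * y \<noteq> 1"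
    by (simp_all only: good_iff x_def y_def z)
  consider "\<not> good v" | "\<not> good w" | "\<not> good (v + w)" "good v" "good w" | "good v" "good w" "good (v + w)" by blast
  then show ?thesis
  proof cases
    case 1
    then have y1: "y = 1" "x \<noteq> 1" using good_neighbour[OF assms] gv gw by auto
    then have "good w" "good (v + w)" using gw gvw by auto
    then have "P \<beta> v w = ksym (1 - x) (phi \<beta> (- v))" "P \<beta> v (v + w) = ksym (1 - x) (phi \<beta> (- v))"
      "P \<beta> (v + w) w = ksym (1 - x) (1 - inverse x)"
      using y1 z iv by (simp_all add: P_def phi_def x_def[symmetric] good_uminus[of "v + w", simplified])
    then show ?thesis using ksym_one_minus_self[of x] xy y1 by simp
  next
    case 2
    have "wedge w (- v) = 1" using assms wedge_swap[of w v] by (simp add: wedge_simps)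
    then have x1: "x = 1" "y \<noteq> 1" using 2 good_neighbour[of w "- v"] gv gw by auto
    then have "good v" "good (v + w)" using gv gvw by auto
    then have "P \<beta> v w = ksym (phi \<beta> w) (1 - inverse y)" "P \<beta> v (v + w) = ksym (1 - y) (1 - inverse y)"
      "P \<beta> (v + w) w = ksym (phi \<beta> w) (1 - inverse y)"
      using x1 z iv by (simp_all add: P_def phi_def y_def[symmetric] good_uminus[of "v + w", simplified])
    then show ?thesis using ksym_one_minus_self[of y] xy x1 by simp
  next
    case 3
    then have x1: "x \<noteq> 1" "inverse y = x" using gw gvw xy by (auto simp: field_simps)
    define b where "b = phi \<beta> (v + w)"
    have b: "b \<in> cyc_field N" "b \<noteq> 0" using phi_in[OF prs] phi_nonzero[OF prs] by (auto simp: b_def)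
    have mb: "phi \<beta> (- (v + w)) = - b"
      using odd_weight_uminus[OF \<beta> prs] 3 by (simp add: phi_def b_def del: minus_add_distrib)
    have "P \<beta> v w = ksym (1 - x) (1 - x)" "P \<beta> v (v + w) = ksym b (1 - x)"
      "P \<beta> (v + w) w = ksym (1 - x) (- b)"
      using 3 x1 iv mb by (simp_all add: P_def phi_def x_def[symmetric] b_def)
    then show ?thesis using S.self[of "1 - x"] S.minus_right[of "1 - x" b] S.antisym[of b "1 - x"]
      xy x1 b one_minus_in[of x] by simp
  next
    case 4
    then have g: "x \<noteq> 1" "y \<noteq> 1" "x * y \<noteq> 1" using gv gw gvw by auto
    have "P \<beta> v w = ksym (1 - x) (1 - inverse y)" "P \<beta> v (v + w) = ksym (1 - x * y) (1 - inverse y)"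
      "P \<beta> (v + w) w = ksym (1 - x) (1 - inverse (x * y))"
      unfolding P_def phi_def good_uminus using 4 z iv by (simp_all add: x_def[symmetric])
    then show ?thesis using ksym_three_term[of x y] xy g by simp
  qed
qed

text \<open>The change of the potential along a half turn u, w, - u, as \<open>half_P\<close>
  shows.\<close>

definition half :: "int \<times> int \<Rightarrow> K2fam" where
  "half u = ksym (phi \<beta> (- u)) (- (zeta N powi (- snd (SOME w. wedge u w = 1))))"

text \<open>Another w changes the second entry by a power of the \<zeta>-value of - u. If u is good
  this is killed by {1 - a, a} = 0, and if u is bad the value is 1.\<close>

lemma half_eq:
  assumes "wedge u w = 1"
  shows "half u = ksym (phi \<beta> (- u)) (- (zeta N powi (- snd w)))"
proof -
  define w' where "w' = (SOME w. wedge u w = 1)"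
  have w': "wedge u w' = 1" using someI[of "\<lambda>w. wedge u w = 1", OF assms] by (simp add: w'_def)
  have pu: "prim (- u)" using wedge_1_prim[OF assms] by simp
  define n where "n = wedge w' w"
  have "snd w' = n * snd u + snd w"
    using wedge_basis_snd[OF assms, of w'] w' by (simp add: n_def)
  then have "- (zeta N powi (- snd w')) = - (zeta N powi (- snd w)) * (zeta N powi (- snd u)) powi n"
    by (simp only: power_int_mult[symmetric]) (simp add: zeta_powi_add[symmetric] algebra_simps)
  moreover have "ksym (phi \<beta> (- u)) ((zeta N powi (- snd u)) powi n) = 0"
  proof (cases "good u")
    case True
    then have "zeta N powi (- snd u) \<noteq> 1" by (simp add: good_iff power_int_minus)
    then have "ksym (phi \<beta> (- u)) (zeta N powi (- snd u)) = 0"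
      using True ksym_one_minus[OF zeta_in[of "- snd u"]] by (simp add: phi_def)
    then show ?thesis using ksym_powi_zero[of "phi \<beta> (- u)" "zeta N powi (- snd u)" n] phi_in[OF pu] phi_nonzero[OF pu] zeta_in
      by simp
  next
    case False
    then have "(zeta N powi (- snd u)) powi n = 1" by (simp add: good_iff power_int_minus)
    then show ?thesis using S.one_right phi_in[OF pu] phi_nonzero[OF pu] by simp
  qed
  ultimately show ?thesis unfolding half_def w'_def[symmetric]
    using ksym_mult_right[of "phi \<beta> (- u)" "- (zeta N powi (- snd w))" "(zeta N powi (- snd u)) powi n"]
      phi_in[OF pu] phi_nonzero[OF pu] F.K_uminus[OF zeta_in] F.K_powi[OF zeta_in] by simp
qed

lemma half_P:
  assumes "wedge u w = 1"
  shows "P \<beta> u w + P \<beta> w (- u) = half u"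
proof -
  have pr: "prim (- u)" "prim w" using wedge_1_prim[OF assms] by auto
  note ph = phi_in[OF pr(1)] phi_in[OF pr(2)] phi_nonzero[OF pr(1)] phi_nonzero[OF pr(2)]
  have "P \<beta> w (- u) = ksym (phi \<beta> (- u)) (phi \<beta> w) + ksym (phi \<beta> (- u)) (- (zeta N powi (- snd w)))"
    unfolding P_def phi_uminus[OF pr(2)] by (rule ksym_mult_right) (use ph F.K_uminus[OF zeta_in] in simp_all)
  moreover have "P \<beta> u w = - ksym (phi \<beta> (- u)) (phi \<beta> w)"
    unfolding P_def using S.antisym ph by blast
  ultimately show ?thesis by (simp add: half_eq[OF assms])
qed

text \<open>Trivial monodromy of a full turn: the two halves add up to {-\<zeta>^(-a),
  -\<zeta>^(-b)} for the second coordinates a, b of a basis. These are coprime, so the class lies in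
  Z_N.\<close>

lemma half_uminus:
  assumes "prim u"
  shows "half (- u) = - half u"
proof -
  obtain w where w: "wedge u w = 1" using prim_partner[OF assms] by blast
  have w': "wedge (- u) (- w) = 1" using w by (simp add: wedge_simps)
  note ph = phi_in[OF assms] phi_nonzero[OF assms]
  have u': "phi \<beta> (- u) = phi \<beta> u * - (zeta N powi (- snd u))" by (rule phi_uminus[OF assms])
  define t where "t = - (zeta N powi (- snd w))"
  have t: "t \<in> cyc_field N" "t \<noteq> 0" using F.K_uminus[OF zeta_in] by (auto simp: t_def)
  have "half u = ksym (phi \<beta> u) t + ksym (- (zeta N powi (- snd u))) t"
    unfolding half_eq[OF w] u' t_def[symmetric]
    by (rule ksym_mult_left) (use ph t F.K_uminus[OF zeta_in] in simp_all)
  also have "ksym (- (zeta N powi (- snd u))) t = 0"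
    unfolding t_def
  proof (rule ksym_minus_zeta_powi)
    have "c dvd 1" if "c dvd snd u" "c dvd snd w" for c
      using that w by (metis dvd_diff dvd_mult wedge_def)
    then show "coprime (- snd u) (- snd w)" by (auto intro!: coprimeI)
  qed
  finally have h: "half u = ksym (phi \<beta> u) t" by simp
  have "half (- u) = ksym (phi \<beta> u) (- (zeta N powi (snd w)))"
    using half_eq[OF w'] by simp
  also have "- (zeta N powi (snd w)) = inverse t" by (simp add: t_def power_int_minus)
  finally show ?thesis using ksym_inverse_right[of "phi \<beta> u" t] ph t h by simp
qed

text \<open>Sums \<open>P\<close> along the chain of parents, which descends to (0, - 1), where the
  value is 0.\<close>

function pot_pos :: "int \<times> int \<Rightarrow> K2fam" where
  "pot_pos v = (if 0 < fst v \<and> prim v then pot_pos (par v) + P \<beta> (par v) v else 0)"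
  by auto
termination
  by (relation "Wellfounded.measure (\<lambda>v. nat (fst v))") (use par_props in auto)

declare pot_pos.simps [simp del]

text \<open>Contains exactly one of v and - v for primitive v. The boundary vector is (0, - 1)
  because this is the last parent in the recursion of \<open>pot_pos\<close>.\<close>

definition posv :: "int \<times> int \<Rightarrow> bool" where
  "posv v \<longleftrightarrow> 0 < fst v \<or> v = (0, - 1)"

definition pot :: "int \<times> int \<Rightarrow> K2fam" where
  "pot v = (if posv v then pot_pos v else pot_pos (- v) + half (- v))"

lemma posv_cases: assumes "prim v" shows "posv v \<and> \<not> posv (- v) \<or> posv (- v) \<and> \<not> posv v"
proof (cases "fst v = 0")
  case True
  then have "snd v = 1 \<or> snd v = - 1" using assms by (auto simp: prim_def)
  then show ?thesis using True by (auto simp: posv_def prod_eq_iff)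
next
  case False
  then show ?thesis by (auto simp: posv_def prod_eq_iff)
qed

lemma pot_uminus: assumes "prim u" shows "pot (- u) = pot u + half u"
  using posv_cases[OF assms] half_uminus[OF assms] by (auto simp: pot_def)

lemma pot_edge_rotate:
  assumes "wedge v w = 1" "pot w - pot v = P \<beta> v w"
  shows "pot (- v) - pot w = P \<beta> w (- v)"
proof -
  have "pot (- v) = pot v + half v" using pot_uminus wedge_1_prim[OF assms(1)] by blast
  moreover have "half v = P \<beta> v w + P \<beta> w (- v)" using half_P[OF assms(1)] by simp
  ultimately show ?thesis using assms(2) by (simp add: algebra_simps)
qed

text \<open>If w has the larger first coordinate, then v is its parent and the recursion applies.
  Otherwise u = v - w is the parent of v, and the Farey triangle u, v, w reduces the claim to the
  smaller edge from u to w.\<close>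

lemma pot_edge_pos:
  assumes "wedge v w = 1" "posv v" "posv w"
  shows "pot w - pot v = P \<beta> v w"
  using assms
proof (induction "nat (fst v + fst w)" arbitrary: v w rule: less_induct)
  case less
  have pr: "prim v" "prim w" using wedge_1_prim[OF less.prems(1)] by auto
  have par_edge: "pot b - pot a = P \<beta> a b" if "posv a" "posv b" "fst a < fst b" "wedge a b = 1" for a b
  proof -
    have "0 \<le> fst a" using that(1) by (auto simp: posv_def)
    then have a: "a = par b" using par_unique that by blast
    have "0 < fst b" "prim b" using that \<open>0 \<le> fst a\<close> wedge_1_prim by auto
    then have "pot_pos b = pot_pos a + P \<beta> a b" using a by (subst pot_pos.simps) simp
    then show ?thesis using that by (simp add: pot_def)
  qed
  have fw: "0 < fst w"
  proof (rule ccontr)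
    assume "\<not> 0 < fst w"
    then have "w = (0, - 1)" using less.prems by (auto simp: posv_def)
    then have "fst v = - 1" using less.prems(1) by (simp add: wedge_def)
    then show False using less.prems(2) by (auto simp: posv_def)
  qed
  show ?case
  proof (cases "fst v < fst w")
    case True
    then show ?thesis using par_edge less.prems by blast
  next
    case False
    define u where "u = v - w"
    have uw: "wedge u w = 1" and uv: "wedge u v = 1"
      using less.prems(1) wedge_swap[of w v] by (simp_all add: u_def wedge_simps)
    have v: "u + w = v" by (simp add: u_def)
    have pu: "posv u"
    proof (cases "fst v = fst w")
      case True
      then have "fst u = 0" by (simp add: u_def)
      then have "fst w * - snd u = 1" using uw by (simp add: wedge_def)
      then have "snd u = - 1" using fw by (metis minus_equation_iff pos_zmult_eq_1_iff)
      then show ?thesis using \<open>fst u = 0\<close> by (auto simp: posv_def prod_eq_iff)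
    next
      case F: False
      then show ?thesis using False by (simp add: posv_def u_def)
    qed
    have fu: "0 \<le> fst u" "fst u < fst v" using False fw by (auto simp: u_def)
    have e1: "pot v - pot u = P \<beta> u v" using par_edge[OF pu less.prems(2) fu(2) uv] .
    have "nat (fst u + fst w) < nat (fst v + fst w)" using fu fw by simp
    then have e2: "pot w - pot u = P \<beta> u w" using less.hyps[OF _ uw pu less.prems(3)] by simp
    have "P \<beta> u w = P \<beta> u v + P \<beta> v w" using P_three_term[OF uw] v by simp
    then show ?thesis using e1 e2 by (simp add: algebra_simps)
  qed
qed

text \<open>One of the quarter turns (v, w), (w, - v), (- v, - w), (- w, v) of the edge has both
  ends in the half plane, and \<open>pot_edge_rotate\<close> carries the formula on from
  there.\<close>

lemma pot_edge:
  assumes "wedge v w = 1"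
  shows "pot w - pot v = P \<beta> v w"
proof -
  have r1: "wedge w (- v) = 1" using assms wedge_swap[of w v] by (simp add: wedge_simps)
  have r2: "wedge (- v) (- w) = 1" using assms by (simp add: wedge_simps)
  have r3: "wedge (- w) v = 1" using assms wedge_swap[of w v] by (simp add: wedge_simps)
  have pr: "prim v" "prim w" using wedge_1_prim[OF assms] by auto
  have e3: "pot w - pot v = P \<beta> v w" if "pot v - pot (- w) = P \<beta> (- w) v"
    using pot_edge_rotate[OF r3 that] by simp
  have e2: "pot v - pot (- w) = P \<beta> (- w) v" if "pot (- w) - pot (- v) = P \<beta> (- v) (- w)"
    using pot_edge_rotate[OF r2 that] by simp
  have e1: "pot (- w) - pot (- v) = P \<beta> (- v) (- w)" if "pot (- v) - pot w = P \<beta> w (- v)"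
    using pot_edge_rotate[OF r1 that] by simp
  consider "posv v" "posv w" | "posv v" "posv (- w)" | "posv (- v)" "posv w" | "posv (- v)" "posv (- w)"
    using posv_cases[OF pr(1)] posv_cases[OF pr(2)] by blast
  then show ?thesis
  proof cases
    case 1
    then show ?thesis by (rule pot_edge_pos[OF assms])
  next
    case 2
    then show ?thesis by (intro e3 pot_edge_pos[OF r3])
  next
    case 3
    then show ?thesis by (intro e3 e2 e1 pot_edge_pos[OF r1])
  next
    case 4
    then show ?thesis by (intro e3 e2 pot_edge_pos[OF r2])
  qed
qed

end

subsection \<open>Paths through good vectors\<close>

text \<open>The paths of \<open>theta_seq\<close>, with the last vector good as well.\<close>

inductive reach :: "int \<times> int \<Rightarrow> bool" where
  start: "reach (0, 1)"
| step: "reach v \<Longrightarrow> wedge v w = 1 \<Longrightarrow> good w \<Longrightarrow> reach w"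

lemma reach_good: "reach v \<Longrightarrow> good v"
  by (erule reach.cases) (use N_ge_2 in \<open>auto simp: good_def\<close>)

lemma reach_prim: "reach v \<Longrightarrow> prim v"
  by (erule reach.cases) (auto dest: wedge_1_prim simp: prim_def)

lemma reach_uminus: assumes "reach v" shows "reach (- v)"
proof -
  obtain w where w: "wedge v w = 1" using prim_partner reach_prim[OF assms] by blast
  have "\<exists>w. wedge v w = 1 \<and> good w"
  proof (cases "good w")
    case False
    then have "good (v + w)" using reach_good[OF assms] by (simp add: good_def dvd_add_left_iff)
    moreover have "wedge v (v + w) = 1" using w by (simp add: wedge_simps)
    ultimately show ?thesis by blast
  qed (use w in blast)
  then obtain w where w: "wedge v w = 1" "good w" by blast
  have "wedge w (- v) = 1" using w wedge_swap[of w v] by (simp add: wedge_simps)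
  then show ?thesis using reach.step[OF reach.step[OF assms w]] reach_good[OF assms] by simp
qed

lemma reach_back: assumes "reach v" "wedge w v = 1" "good w" shows "reach w"
proof -
  have "wedge v (- w) = 1" using assms(2) wedge_swap[of v w] by (simp add: wedge_simps)
  then have "reach (- w)" using reach.step[OF assms(1)] assms(3) by simp
  then show ?thesis using reach_uminus by fastforce
qed

text \<open>Induction on the size of the first coordinate: if the parent of v is bad, then the
  difference q of v and this parent is good, and v is a neighbour of both.\<close>

lemma reach_all: assumes "prim v" "good v" shows "reach v"
  using assms
proof (induction "nat \<bar>fst v\<bar>" arbitrary: v rule: less_induct)
  case less
  have pos: "reach v" if v: "prim v" "good v" "0 < fst v" "nat \<bar>fst v\<bar> = m"
      and IH: "\<And>u. nat \<bar>fst u\<bar> < m \<Longrightarrow> prim u \<Longrightarrow> good u \<Longrightarrow> reach u" for v m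
  proof -
    note p = par_props[OF v(1,3)]
    define q where "q = v - par v"
    have q: "wedge v q = 1" "prim q" using p(3) wedge_swap[of v "par v"] wedge_1_prim(2)[of v q]
      by (auto simp: q_def wedge_simps)
    have pp: "prim (par v)" using p(3) wedge_1_prim by blast
    show ?thesis
    proof (cases "good (par v)")
      case True
      then have "reach (par v)" using IH[of "par v"] p pp v(4) by auto
      then show ?thesis using reach.step p(3) v(2) by blast
    next
      case False
      then have gq: "good q" using v(2) by (auto simp: q_def good_def dvd_diff_left_iff)
      \<comment> \<open>A bad primitive vector never has first coordinate 0, so q is strictly
        smaller than v.\<close>
      have "fst (par v) \<noteq> 0" using bad_fst_nonzero pp False by blast
      then have "nat \<bar>fst q\<bar> < m" using p v by (auto simp: q_def)
      then have "reach q" using IH q gq by blast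
      then show ?thesis using reach_back q v(2) by blast
    qed
  qed
  consider "0 < fst v" | "fst v < 0" | "fst v = 0" by linarith
  then show ?case
  proof cases
    case 1
    then show ?thesis using pos[OF less.prems _ refl less.hyps] by simp
  next
    case 2
    then have "reach (- v)" using pos[of "- v", OF _ _ _ _ less.hyps] less.prems by simp
    then show ?thesis using reach_uminus by fastforce
  next
    case 3
    then have "v = (0, 1) \<or> v = - (0, 1)" using less.prems by (auto simp: prim_def prod_eq_iff)
    then show ?thesis using reach.start reach_uminus by blast
  qed
qed

lemma P_good: "good v \<Longrightarrow> good w \<Longrightarrow> P \<beta> v w = ksym (1 - zeta N powi snd w) (1 - zeta N powi (- snd v))"
  by (simp add: P_def phi_def)

lemma pot_weight_independent:
  assumes "odd_weight \<beta>" "odd_weight \<beta>'" "reach v"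
  shows "pot \<beta> v - pot \<beta> (0, 1) = pot \<beta>' v - pot \<beta>' (0, 1)"
  using assms(3)
proof induction
  case start
  then show ?case by simp
next
  case (step v w)
  have "pot \<beta> w - pot \<beta> v = pot \<beta>' w - pot \<beta>' v"
    using pot_edge[OF assms(1) step(2)] pot_edge[OF assms(2) step(2)] P_good step reach_good by simp
  then have "(pot \<beta> w - pot \<beta> v) + (pot \<beta> v - pot \<beta> (0, 1)) = (pot \<beta>' w - pot \<beta>' v) + (pot \<beta>' v - pot \<beta>' (0, 1))"
    using step.IH by simp
  then show ?case by simp
qed

end


section \<open>The Hecke relation for a single edge\<close>

text \<open>As l is prime, \<tau> generates all l-th roots of unity; X^l - 1 is factored and
  evaluated at \<open>inverse a\<close>.\<close>

lemma prod_one_minus_roots_of_unity: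
  fixes a \<tau> :: complex
  assumes "prime l" "\<tau> ^ l = 1" "\<tau> \<noteq> 1" "a \<noteq> 0"
  shows "(\<Prod>n<l. 1 - a * \<tau> ^ n) = 1 - a ^ l"
proof -
  have l: "0 < l" using prime_gt_0_nat[OF assms(1)] .
  define p :: "complex poly" where "p = monom 1 l - 1"
  have ev: "poly p z = z ^ l - 1" for z by (simp add: p_def poly_monom)
  have dp: "poly (pderiv p) z = of_nat l * z ^ (l - 1)" for z
    by (simp add: p_def pderiv_diff pderiv_monom poly_monom)
  have deg: "degree p = l" "lead_coeff p = 1"
  proof -
    have "degree p \<le> l" unfolding p_def by (intro degree_diff_le) (auto simp: degree_monom_le)
    moreover have c: "coeff p l = 1" using l by (simp add: p_def coeff_1)
    ultimately show "degree p = l" by (metis le_degree le_antisym zero_neq_one)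
    with c show "lead_coeff p = 1" by simp
  qed
  have ord: "order z p = 1" if "poly p z = 0" for z
  proof -
    have "z \<noteq> 0" using that l by (auto simp: ev power_0_left)
    then show ?thesis using lead_at_simple_root(1)[OF that] dp l by simp
  qed
  have "p = (\<Prod>z|poly p z = 0. [:-z, 1:] ^ order z p)"
    using complex_poly_decompose[of p] deg by simp
  also have "\<dots> = (\<Prod>z|poly p z = 0. [:-z, 1:])"
    by (rule prod.cong) (auto simp: ord)
  finally have pp: "p = (\<Prod>z|z ^ l = 1. [:-z, 1:])" by (simp add: ev)
  have bij: "bij_betw (\<lambda>n. \<tau> ^ n) {..<l} {z. z ^ l = 1}"
  proof -
    have t0: "\<tau> \<noteq> 0" using assms(2) l by (auto simp: power_0_left)
    have inj0: False if "i < j" "j < l" "\<tau> ^ i = \<tau> ^ j" for i j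
    proof -
      have "\<tau> ^ (j - i) = 1" using that t0 by (simp add: power_diff)
      moreover have cop: "coprime (j - i) l"
      proof (rule coprime_commute[THEN iffD1, OF prime_imp_coprime[OF assms(1)]])
        show "\<not> l dvd j - i" using that by (auto dest: dvd_imp_le)
      qed
      have "gcd (int (j - i)) (int l) = 1" using cop coprime_int_iff coprime_imp_gcd_eq_1 by blast
      then obtain x y where xy: "x * int (j - i) + y * int l = 1"
        using bezout_int[of "int (j - i)" "int l"] by auto
      have "\<tau> powi (int (j - i) * x + int l * y) = (\<tau> ^ (j - i)) powi x * (\<tau> ^ l) powi y"
        by (simp only: power_int_add[OF disjI1[OF t0]] power_int_mult power_int_of_nat)
      then have "\<tau> = (\<tau> ^ (j - i)) powi x * (\<tau> ^ l) powi y"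
        using xy by (simp add: mult.commute)
      ultimately show False using assms(2,3) by simp
    qed
    have inj: "inj_on (\<lambda>n. \<tau> ^ n) {..<l}"
      by (rule inj_onI) (metis inj0 lessThan_iff linorder_neqE_nat)
    have "(\<tau> ^ n) ^ l = 1" for n by (metis assms(2) mult.commute power_mult power_one)
    then have sub: "(\<lambda>n. \<tau> ^ n) ` {..<l} \<subseteq> {z. z ^ l = 1}" by auto
    have "card {z::complex. z ^ l = 1} = l" using l by (intro card_roots_unity_eq) auto
    then have "(\<lambda>n. \<tau> ^ n) ` {..<l} = {z. z ^ l = 1}"
      using card_image[OF inj] finite_roots_unity[of l] l by (intro card_subset_eq[OF _ sub]) auto
    then show ?thesis using inj by (simp add: bij_betw_def)
  qed
  have "inverse a ^ l - 1 = (\<Prod>z|z ^ l = 1. inverse a - z)"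
  proof -
    have "poly p (inverse a) = poly (\<Prod>z|z ^ l = 1. [:-z, 1:]) (inverse a)" using pp by simp
    then show ?thesis by (simp add: ev poly_prod)
  qed
  also have "\<dots> = (\<Prod>n<l. inverse a - \<tau> ^ n)"
    by (rule prod.reindex_bij_betw[OF bij, symmetric])
  finally have "a ^ l * (inverse a ^ l - 1) = (\<Prod>n<l. a) * (\<Prod>n<l. inverse a - \<tau> ^ n)" by simp
  also have "\<dots> = (\<Prod>n<l. 1 - a * \<tau> ^ n)"
    unfolding prod.distrib[symmetric] using assms(4) by (simp add: algebra_simps)
  finally show ?thesis using assms(4) by (simp add: algebra_simps flip: power_mult_distrib)
qed

lemma tame_value_one: assumes "poly f \<tau> = 1" "g \<noteq> 0" shows "tame \<tau> f g = 0"
proof -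
  have "poly f \<tau> \<noteq> 0" "f \<noteq> 0" using assms by auto
  then have "cval (tame \<tau> f g) = 1"
    using assms lead_at_nonroot[of f \<tau>] by (simp add: cval_tame order_0I)
  then show ?thesis by (auto intro: cunit_eqI)
qed

context cyclotomic
begin

text \<open>The leading coefficient with respect to the uniformizer (X - \<tau>) / s.\<close>

definition spec :: "complex \<Rightarrow> complex \<Rightarrow> complex poly \<Rightarrow> complex" where
  "spec \<tau> s f = lead_at \<tau> f * s ^ order \<tau> f"

lemma spec_in:
  assumes "f \<in> F.KX" "\<tau> \<in> cyc_field N" "s \<in> cyc_field N" "s \<noteq> 0" "f \<noteq> 0"
  shows "spec \<tau> s f \<in> cyc_field N" "spec \<tau> s f \<noteq> 0"
  using assms F.lead_at_KX[of f \<tau>] F.K_mult F.K_power[of s] lead_at_nonzero by (auto simp: spec_def)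

lemma spec_nonroot: "poly f \<tau> \<noteq> 0 \<Longrightarrow> spec \<tau> s f = poly f \<tau>"
  by (simp add: spec_def lead_at_nonroot order_0I)

text \<open>If the leading terms do not cancel, the relation is trivial or one of M. If they do,
  then b = - a, and both sides become {c, - 1}, whatever c is.\<close>

lemma steinberg_symbol_spec:
  assumes \<tau>: "\<tau> \<in> cyc_field N" and s: "s \<in> cyc_field N" "s \<noteq> 0"
  shows "steinberg_symbol F.KX (\<lambda>f g. ksym (spec \<tau> s f) (spec \<tau> s g))"
proof
  note sp = spec_in[OF _ \<tau> s]
  have mult: "spec \<tau> s (f * g) = spec \<tau> s f * spec \<tau> s g" if "f \<noteq> 0" "g \<noteq> 0" for f g
    using that by (simp add: spec_def lead_at_mult order_mult power_add)
  fix f g h assume A: "f \<in> F.KX" "g \<in> F.KX" "h \<in> F.KX" "f \<noteq> 0" "g \<noteq> 0" "h \<noteq> 0"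
  show "ksym (spec \<tau> s (f * g)) (spec \<tau> s h) = ksym (spec \<tau> s f) (spec \<tau> s h) + ksym (spec \<tau> s g) (spec \<tau> s h)"
    unfolding mult[OF A(4,5)] by (intro ksym_mult_left sp A)
  show "ksym (spec \<tau> s f) (spec \<tau> s (g * h)) = ksym (spec \<tau> s f) (spec \<tau> s g) + ksym (spec \<tau> s f) (spec \<tau> s h)"
    unfolding mult[OF A(5,6)] by (intro ksym_mult_right sp A)
next
  note sp = spec_in[OF _ \<tau> s]
  fix f g assume A: "f \<in> F.KX" "g \<in> F.KX" "f \<noteq> 0" "g \<noteq> 0" "f + g \<noteq> 0"
  define a b c where "a = spec \<tau> s f" and "b = spec \<tau> s g" and "c = spec \<tau> s (f + g)"
  have abc: "a \<in> cyc_field N" "b \<in> cyc_field N" "c \<in> cyc_field N" "a \<noteq> 0" "b \<noteq> 0" "c \<noteq> 0"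
    using sp A F.KX_add by (auto simp: a_def b_def c_def)
  consider "c = a + b" | "b = - a" | "c = a" | "c = b"
    by (rule lead_at_add_cases[OF A(3,4,5), of \<tau>])
      (auto simp: a_def b_def c_def spec_def algebra_simps)
  then have "ksym a b + ksym c c = ksym a c + ksym c b"
  proof cases
    case 1
    then show ?thesis using S.steinberg[of a b] abc by simp
  next
    case 2
    have "ksym a b = 0" using 2 S.neg abc by simp
    moreover have "ksym c b = ksym c (- 1) + ksym c a" using 2 S.minus_right abc by simp
    moreover have "ksym a c = - ksym c a" using S.antisym abc by blast
    ultimately show ?thesis using S.self[of c] abc by simp
  qed (simp_all add: add.commute)
  then show "ksym (spec \<tau> s f) (spec \<tau> s g) + ksym (spec \<tau> s (f + g)) (spec \<tau> s (f + g))
      = ksym (spec \<tau> s f) (spec \<tau> s (f + g)) + ksym (spec \<tau> s (f + g)) (spec \<tau> s g)"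
    by (simp add: a_def b_def c_def)
qed (auto intro: F.KX_one F.KX_uminus F.KX_add F.KX_mult)

end

section \<open>The l + 1 sublattices of index l\<close>

locale hecke_prime = cyclotomic +
  fixes l :: nat
  assumes prime_l: "prime l" and l_not_dvd: "\<not> l dvd N"
begin

lemma l_pos: "0 < l"
  using prime_gt_0_nat[OF prime_l] .

lemma coprime_l_N: "coprime (int l) (int N)"
  using prime_imp_coprime[OF prime_l l_not_dvd] by simp

text \<open>The action of the coset representative hg l k, a linear form that vanishes modulo l exactly on
  its image lattice, and the primitive vector u with gv k u a positive multiple of v.\<close>

definition gv :: "nat \<Rightarrow> int \<times> int \<Rightarrow> int \<times> int" where
  "gv k u = (if k < l then (int l * fst u + int k * snd u, snd u) else (fst u, int l * snd u))"

definition lam :: "nat \<Rightarrow> int \<times> int \<Rightarrow> int" where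
  "lam k v = (if k < l then fst v - int k * snd v else snd v)"

definition red :: "nat \<Rightarrow> int \<times> int \<Rightarrow> int \<times> int" where
  "red k v = (if k < l
     then (if int l dvd lam k v then (lam k v div int l, snd v) else (lam k v, int l * snd v))
     else (if int l dvd lam k v then (fst v, lam k v div int l) else (int l * fst v, snd v)))"

definition mul :: "nat \<Rightarrow> int \<times> int \<Rightarrow> int" where
  "mul k v = (if int l dvd lam k v then 1 else int l)"

text \<open>Lower right entry of \<open>hg l k\<close>, which determines its action on M.\<close>

definition del :: "nat \<Rightarrow> int" where
  "del k = (if k < l then 1 else int l)"

lemma coprime_del: "coprime (del k) (int N)"
  using coprime_l_N by (simp add: del_def)

lemma mul_pos: "0 < mul k v"
  using l_pos by (simp add: mul_def)

lemma gv_red: "gv k (red k v) = (mul k v * fst v, mul k v * snd v)"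
  using l_pos by (auto simp: gv_def red_def mul_def lam_def algebra_simps)

lemma wedge_gv: "wedge (gv k u) (gv k u') = int l * wedge u u'"
  by (simp add: gv_def wedge_def algebra_simps)

lemma snd_gv: "snd (gv k u) = del k * snd u"
  by (simp add: gv_def del_def)

lemma lam_gv: "int l dvd lam k (gv k u)"
  by (simp add: gv_def lam_def)

lemma prim_red: assumes "prim v" shows "prim (red k v)"
proof -
  have l: "prime (int l)" using prime_l by simp
  have c1: "coprime (fst v - int k * snd v) (snd v)"
    using assms by (simp add: prim_def coprime_iff_gcd_eq_1 gcd_diff1 gcd.commute[of _ "snd v"])
      (metis gcd_add_mult gcd.commute add.commute diff_add_cancel mult.commute)
  have dv: "coprime (a div int l) b" if "coprime a b" "int l dvd a" for a b :: int
    using that l_pos by (auto elim!: dvdE)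
  have ml: "coprime a (int l * b)" if "coprime a b" "\<not> int l dvd a" for a b :: int
    using that prime_imp_coprime[OF l that(2)] by (simp add: coprime_commute)
  show ?thesis
    using assms c1 dv[of "lam k v" "snd v"] ml[of "lam k v" "snd v"] dv[of "snd v" "fst v"] ml[of "snd v" "fst v"]
    by (auto simp: red_def lam_def prim_def coprime_commute)
qed

lemma good_red: assumes "good v" shows "good (red k v)"
proof -
  have "snd (gv k (red k v)) = mul k v * snd v" by (simp add: gv_red)
  then have e: "del k * snd (red k v) = mul k v * snd v" by (simp add: snd_gv)
  have "coprime (int N) (mul k v)" using coprime_l_N by (simp add: mul_def coprime_commute)
  then have "\<not> int N dvd mul k v * snd v"
    using assms by (simp add: good_def coprime_dvd_mult_right_iff)
  then show ?thesis unfolding good_def using e by (metis dvd_mult)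
qed

text \<open>The \<open>lam k\<close> represent the l + 1 linear forms on F_l^2 up to scalars; their
  kernels are the distinct lines, and a primitive vector is nonzero modulo l.\<close>

lemma lam_unique:
  assumes "prim p" "int l dvd lam k p" "int l dvd lam k' p" "k \<le> l" "k' \<le> l"
  shows "k = k'"
proof -
  have l: "prime (int l)" using prime_l by simp
  have ndvd: "\<not> (int l dvd fst p \<and> int l dvd snd p)"
    using assms(1) l by (auto simp: prim_def dest: coprime_common_divisor)
  have main: "a = b" if "int l dvd lam a p" "int l dvd lam b p" "a \<le> b" "b \<le> l" for a b
  proof (rule ccontr)
    assume ab: "a \<noteq> b"
    then have a: "int l dvd fst p - int a * snd p" using that by (auto simp: lam_def)
    show False
    proof (cases "b < l")
      case True
      then have "int l dvd fst p - int b * snd p" using that by (auto simp: lam_def)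
      from dvd_diff[OF a this] have "int l dvd (int b - int a) * snd p" by (simp add: algebra_simps)
      moreover have "\<not> int l dvd int b - int a"
        using zdvd_not_zless[of "int b - int a" "int l"] ab that True by simp
      ultimately have "int l dvd snd p" using l by (simp add: prime_dvd_mult_iff)
      then show False using a ndvd by (metis dvd_diff_commute dvd_diff_left_iff dvd_mult)
    next
      case False
      then have "int l dvd snd p" using that by (auto simp: lam_def)
      then show False using a ndvd by (metis dvd_diff_commute dvd_diff_left_iff dvd_mult)
    qed
  qed
  show ?thesis using main[of k k'] main[of k' k] assms by (metis linorder_le_cases)
qed

lemma lam_exists: "\<exists>k\<le>l. int l dvd lam k p"
proof (cases "int l dvd snd p")
  case True
  then show ?thesis by (intro exI[of _ l]) (simp add: lam_def)
next
  case False
  have l: "prime (int l)" using prime_l by simp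
  have "coprime (snd p) (int l)" using prime_imp_coprime[OF l False] by (simp add: coprime_commute)
  then have "gcd (snd p) (int l) = 1" by (rule coprime_imp_gcd_eq_1)
  then obtain x y where "x * snd p + y * int l = 1"
    using bezout_int[of "snd p" "int l"] by auto
  then have xy: "snd p * x + int l * y = 1" by (simp add: mult.commute)
  define k where "k = nat ((fst p * x) mod int l)"
  have k: "int k = (fst p * x) mod int l" using l_pos by (simp add: k_def)
  have kl: "k < l" using l_pos by (simp add: k_def nat_less_iff)
  have "(fst p - int k * snd p) mod int l = (fst p - fst p * x * snd p) mod int l"
    unfolding k by (metis mod_diff_right_eq mod_mult_left_eq)
  also have "fst p - fst p * x * snd p = int l * (fst p * y)"
  proof -
    have "fst p * (snd p * x + int l * y) = fst p" using xy by simp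
    then show ?thesis by (simp add: algebra_simps)
  qed
  finally have "int l dvd lam k p" using kl by (simp add: lam_def mod_eq_0_iff_dvd)
  then show ?thesis using kl less_imp_le by blast
qed

end

section \<open>Symbols in the variable t for a single edge\<close>

locale hecke_edge = hecke_prime +
  fixes v w :: "int \<times> int"
  assumes vw: "wedge v w = 1" and good_v: "good v" and good_w: "good w"
begin

definition x :: complex where "x = zeta N powi snd v"
definition y :: complex where "y = zeta N powi snd w"

lemma x_in: "x \<in> cyc_field N" "x powi m \<in> cyc_field N" and y_in: "y \<in> cyc_field N" "y powi m \<in> cyc_field N"
  by (auto simp: x_def y_def zeta_in F.K_powi)

lemma xy_nonzero [simp]: "x \<noteq> 0" "y \<noteq> 0"
  by (simp_all add: x_def y_def)

lemma x_mul: "x powi (mul k u) \<noteq> 1" and x_l: "x ^ l \<noteq> 1" and y_l: "y ^ l \<noteq> 1"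
  and x_1: "x \<noteq> 1" and y_1: "y \<noteq> 1"
proof -
  have c: "coprime (int N) (int l)" using coprime_l_N by (simp add: coprime_commute)
  have xl: "x powi int l \<noteq> 1" and yl: "y powi int l \<noteq> 1"
    using good_v good_w
    by (simp_all only: x_def y_def power_int_mult[symmetric] zeta_powi_eq_1_iff[OF N_pos] good_def
        coprime_dvd_mult_left_iff[OF c] not_False_eq_True)
  then show "x ^ l \<noteq> 1" "y ^ l \<noteq> 1" by simp_all
  show x1: "x \<noteq> 1" and y1: "y \<noteq> 1" using good_v good_w by (simp_all add: x_def y_def good_iff)
  show "x powi (mul k u) \<noteq> 1" using xl x1 by (simp add: mul_def)
qed

definition fp :: "int \<Rightarrow> int \<Rightarrow> complex poly" where
  "fp m n = 1 - monom (x powi m) (nat n)"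

definition zc :: "complex \<Rightarrow> int \<Rightarrow> int \<Rightarrow> complex" where
  "zc \<tau> m n = x powi m * \<tau> powi n"

text \<open>The range in which \<open>fp m n\<close> is the intended function 1 - x^m t^n and is
  nonzero. The case n = 0 occurs at the start of each path, in the direction of v.\<close>

definition ok :: "int \<Rightarrow> int \<Rightarrow> bool" where
  "ok m n \<longleftrightarrow> 0 < n \<or> n = 0 \<and> x powi m \<noteq> 1"

lemma fp_in: "fp m n \<in> F.KX"
  unfolding fp_def by (intro F.KX_diff F.KX_one F.KX_monom x_in)

lemma poly_fp: "0 \<le> n \<Longrightarrow> poly (fp m n) \<tau> = 1 - zc \<tau> m n"
  by (simp add: fp_def zc_def poly_monom power_int_def)

lemma poly_fp_0: "0 < n \<Longrightarrow> poly (fp m n) 0 = 1"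
  by (simp add: fp_def poly_monom power_0_left)

lemma fp_nonzero: assumes "ok m n" shows "fp m n \<noteq> 0"
proof (cases "n = 0")
  case True
  then have "poly (fp m n) 1 \<noteq> 0" using assms by (simp add: poly_fp zc_def ok_def)
  then show ?thesis by auto
next
  case False
  then have "poly (fp m n) 0 = 1" using assms by (intro poly_fp_0) (auto simp: ok_def)
  then show ?thesis by auto
qed

lemma fp_root:
  assumes "0 < n" "\<tau> \<noteq> 0" "zc \<tau> m n = 1"
  shows "order \<tau> (fp m n) = 1" "lead_at \<tau> (fp m n) = - of_int n / \<tau>"
proof -
  have "poly (pderiv (fp m n)) \<tau> = - (of_nat (nat n) * x powi m * \<tau> ^ (nat n - 1))"
    by (simp add: fp_def pderiv_diff pderiv_monom poly_monom)
  moreover have "\<tau> ^ (nat n - 1) = \<tau> powi n / \<tau>"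
  proof -
    have "\<tau> powi n = \<tau> ^ (nat n - 1) * \<tau>"
      using assms(1) by (simp add: power_int_def) (metis One_nat_def power_minus_mult zero_less_nat_eq)
    then show ?thesis using assms(2) by simp
  qed
  ultimately have "poly (pderiv (fp m n)) \<tau> = - of_int n * zc \<tau> m n / \<tau>"
    using assms(1) by (simp add: zc_def)
  then have d: "poly (pderiv (fp m n)) \<tau> = - of_int n / \<tau>" using assms(3) by simp
  have r: "poly (fp m n) \<tau> = 0" using poly_fp assms by simp
  show "order \<tau> (fp m n) = 1" "lead_at \<tau> (fp m n) = - of_int n / \<tau>"
    using lead_at_simple_root[OF r] d assms by simp_all
qed

text \<open>Subtracting the specialization at 0 makes the symbol vanish on constants, as Milnor's theorem
  requires, and changes nothing on the symbols below, whose first entry has value 1 at 0.\<close>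

definition cs :: "complex poly \<Rightarrow> complex poly \<Rightarrow> K2fam" where
  "cs f g = ksym (spec y (- y) f) (spec y (- y) g) - ksym (spec 0 1 f) (spec 0 1 g)"

lemma steinberg_symbol_cs: "steinberg_symbol F.KX cs"
proof -
  interpret A: steinberg_symbol F.KX "\<lambda>f g. ksym (spec y (- y) f) (spec y (- y) g)"
    by (rule steinberg_symbol_spec) (use y_in F.K_uminus in auto)
  interpret B: steinberg_symbol F.KX "\<lambda>f g. ksym (spec 0 1 f) (spec 0 1 g)"
    by (rule steinberg_symbol_spec) (use F.K_zero F.K_one in auto)
  show ?thesis
  proof
    fix f g h assume A: "f \<in> F.KX" "g \<in> F.KX" "h \<in> F.KX" "f \<noteq> 0" "g \<noteq> 0" "h \<noteq> 0"
    show "cs (f * g) h = cs f h + cs g h" "cs f (g * h) = cs f g + cs f h"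
      unfolding cs_def A.mult_left[OF A] B.mult_left[OF A] A.mult_right[OF A] B.mult_right[OF A] by simp_all
  next
    fix f g assume A: "f \<in> F.KX" "g \<in> F.KX" "f \<noteq> 0" "g \<noteq> 0" "f + g \<noteq> 0"
    have "(a1 - b1) + (a2 - b2) = (a3 - b3) + (a4 - b4)" if "a1 + a2 = a3 + a4" "b1 + b2 = b3 + b4"
      for a1 a2 a3 a4 b1 b2 b3 b4 :: K2fam
    proof -
      have "(a1 - b1) + (a2 - b2) = (a1 + a2) - (b1 + b2)" by simp
      also have "\<dots> = (a3 - b3) + (a4 - b4)" unfolding that by simp
      finally show ?thesis .
    qed
    from this[OF A.steinberg[OF A] B.steinberg[OF A]]
    show "cs f g + cs (f + g) (f + g) = cs f (f + g) + cs (f + g) g" unfolding cs_def .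
  qed (auto intro: F.KX_one F.KX_uminus F.KX_add F.KX_mult)
qed

lemma cs_const:
  assumes "a \<in> cyc_field N" "b \<in> cyc_field N" "a \<noteq> 0" "b \<noteq> 0"
  shows "cs [:a:] [:b:] = 0"
  using assms by (simp add: cs_def spec_nonroot)

definition C :: "complex poly \<Rightarrow> complex poly \<Rightarrow> K2fam \<times> (complex \<Rightarrow> cunit)" where
  "C f g = (cs f g, \<lambda>\<tau>. tame \<tau> f g)"

definition GC :: "(K2fam \<times> (complex \<Rightarrow> cunit)) set" where
  "GC = group_closure {(cs f g, \<lambda>\<tau>. tame \<tau> f g) | f g. f \<in> F.KX \<and> g \<in> F.KX \<and> f \<noteq> 0 \<and> g \<noteq> 0}"

lemma C_in_GC: "\<lbrakk>f \<in> F.KX; g \<in> F.KX; f \<noteq> 0; g \<noteq> 0\<rbrakk> \<Longrightarrow> C f g \<in> GC"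
  unfolding GC_def C_def by (rule group_closure.base) blast

lemma GC_vanish: "(m, 0) \<in> GC \<Longrightarrow> m = 0"
  using F.unramified_symbol_vanishes[OF steinberg_symbol_cs cs_const] unfolding GC_def by blast

text \<open>The symbol {1 - x^m' t^n', 1 - x^(-m) t^(-n)}, with 1 - 1/z written as (1 - z) (- 1) / z
  to keep all entries polynomial.\<close>

definition Q :: "int \<Rightarrow> int \<Rightarrow> int \<Rightarrow> int \<Rightarrow> K2fam \<times> (complex \<Rightarrow> cunit)" where
  "Q m n m' n' = C (fp m' n') (fp m n) + C (fp m' n') (- 1) - C (fp m' n') (monom (x powi m) (nat n))"

lemma Q_in_GC: assumes "ok m n" "0 < n'" shows "Q m n m' n' \<in> GC"
proof -
  have "fp m' n' \<noteq> 0" "fp m n \<noteq> 0" using fp_nonzero assms by (auto simp: ok_def)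
  then have "C (fp m' n') (fp m n) \<in> GC" "C (fp m' n') (- 1) \<in> GC" "C (fp m' n') (monom (x powi m) (nat n)) \<in> GC"
    using C_in_GC fp_in F.KX_uminus[OF F.KX_one] F.KX_monom[OF x_in(2)] by auto
  then show ?thesis unfolding Q_def GC_def by (intro group_closure.diff group_closure_add)
qed

definition ph :: "int \<Rightarrow> int \<Rightarrow> complex" where
  "ph m n = (if zc y m n = 1 then of_int n else 1 - zc y m n)"

lemma spec_fp: assumes "ok m n" shows "spec y (- y) (fp m n) = ph m n"
proof (cases "zc y m n = 1")
  case True
  have "n \<noteq> 0" using True assms by (auto simp: zc_def ok_def)
  then have "0 < n" using assms by (auto simp: ok_def)
  from fp_root[OF this _ True] show ?thesis using True by (simp add: spec_def ph_def)
next
  case False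
  have "0 \<le> n" using assms by (auto simp: ok_def)
  then show ?thesis using False poly_fp by (simp add: spec_nonroot ph_def)
qed

lemma fst_Q:
  assumes "ok m n" "0 < n'"
  shows "fst (Q m n m' n') = ksym (ph m' n') (ph m n) + ksym (ph m' n') (- 1) - ksym (ph m' n') (zc y m n)"
proof -
  have ok': "ok m' n'" using assms by (simp add: ok_def)
  have s0: "spec 0 1 (fp m' n') = 1" using poly_fp_0[OF assms(2)] by (simp add: spec_nonroot)
  have mz: "monom (x powi m) (nat n) \<noteq> 0" by simp
  have "spec y (- y) (monom (x powi m) (nat n)) = poly (monom (x powi m) (nat n)) y"
    by (rule spec_nonroot) (simp add: poly_monom)
  also have "\<dots> = zc y m n" using assms by (auto simp: poly_monom zc_def power_int_def ok_def)
  finally have sm: "spec y (- y) (monom (x powi m) (nat n)) = zc y m n" .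
  have s1: "spec y (- y) (- 1) = - 1" by (subst spec_nonroot) simp_all
  have z: "ksym 1 (spec 0 1 g) = 0" if "g \<in> F.KX" "g \<noteq> 0" for g
    using S.one_left spec_in[OF that(1) F.K_zero F.K_one _ that(2)] by simp
  show ?thesis
    unfolding Q_def C_def cs_def using z[OF fp_in fp_nonzero[OF assms(1)]] z[of "- 1"] z[OF F.KX_monom[OF x_in(2)] mz]
      F.KX_uminus[OF F.KX_one]
    by (simp add: s0 spec_fp[OF assms(1)] spec_fp[OF ok'] sm s1)
qed

lemma snd_Q_0: assumes "ok m n" "0 < n'" shows "snd (Q m n m' n') 0 = 0"
  unfolding Q_def C_def using tame_value_one[OF poly_fp_0[OF assms(2)]] fp_nonzero[OF assms(1)] by simp

lemma snd_Q:
  assumes "ok m n" "0 < n'" "\<tau> \<noteq> 0" "\<not> (zc \<tau> m n = 1 \<and> zc \<tau> m' n' = 1)"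
  shows "snd (Q m n m' n') \<tau> = (if zc \<tau> m' n' = 1 then - cunit_of (1 - inverse (zc \<tau> m n))
      else if zc \<tau> m n = 1 then cunit_of (1 - zc \<tau> m' n') else 0)"
proof -
  have ok': "ok m' n'" using assms by (simp add: ok_def)
  have n: "0 \<le> n" "0 \<le> n'" using assms by (auto simp: ok_def)
  define f' f g where "f' = fp m' n'" and "f = fp m n" and "g = monom (x powi m) (nat n)"
  have nz: "f' \<noteq> 0" "f \<noteq> 0" "g \<noteq> 0" using fp_nonzero assms(1) ok' by (auto simp: f'_def f_def g_def)
  have ev: "poly f' \<tau> = 1 - zc \<tau> m' n'" "poly f \<tau> = 1 - zc \<tau> m n" "poly g \<tau> = zc \<tau> m n"
    using n poly_fp by (auto simp: f'_def f_def g_def poly_monom zc_def power_int_def)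
  have zn: "zc \<tau> m n \<noteq> 0" using assms(3) by (simp add: zc_def)
  have Q: "snd (Q m n m' n') \<tau> = tame \<tau> f' f + tame \<tau> f' (- 1) - tame \<tau> f' g"
    by (simp add: Q_def C_def f'_def f_def g_def)
  consider (a) "zc \<tau> m' n' = 1" "zc \<tau> m n \<noteq> 1" | (b) "zc \<tau> m' n' \<noteq> 1" "zc \<tau> m n = 1"
    | (c) "zc \<tau> m' n' \<noteq> 1" "zc \<tau> m n \<noteq> 1" using assms(4) by blast
  then show ?thesis
  proof cases
    case a
    have o: "order \<tau> f' = 1" using fp_root[OF assms(2,3) a(1)] by (simp add: f'_def)
    have t: "cval (tame \<tau> f' h) = inverse (poly h \<tau>)" if "poly h \<tau> \<noteq> 0" for h
    proof -
      have "h \<noteq> 0" using that by auto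
      then show ?thesis using that nz o by (simp add: cval_tame order_0I lead_at_nonroot field_simps)
    qed
    have "cval (tame \<tau> f' f + tame \<tau> f' (- 1) - tame \<tau> f' g) = cval (- cunit_of (1 - inverse (zc \<tau> m n)))"
      using t[of f] t[of "- 1"] t[of g] ev a zn by (simp add: divide_simps) (simp add: algebra_simps)
    then show ?thesis unfolding Q using a by (auto intro: cunit_eqI)
  next
    case b
    then have "0 < n" using assms(1) by (auto simp: ok_def zc_def)
    then have o: "order \<tau> f = 1" using fp_root[OF _ assms(3) b(2)] by (simp add: f_def)
    have "cval (tame \<tau> f' f) = 1 - zc \<tau> m' n'"
      using nz o ev b by (simp add: cval_tame order_0I lead_at_nonroot)
    moreover have "tame \<tau> f' (- 1) = 0" "tame \<tau> f' g = 0"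
      using ev b zn by (auto intro!: tame_nonroots)
    ultimately have "cval (tame \<tau> f' f + tame \<tau> f' (- 1) - tame \<tau> f' g) = cval (cunit_of (1 - zc \<tau> m' n'))"
      using b by simp
    then show ?thesis unfolding Q using b by (auto intro: cunit_eqI)
  next
    case c
    then have "tame \<tau> f' f = 0" "tame \<tau> f' (- 1) = 0" "tame \<tau> f' g = 0"
      using ev zn by (auto intro!: tame_nonroots)
    then show ?thesis unfolding Q using c by simp
  qed
qed

text \<open>With \<open>nn\<close>, the coordinates of \<open>gv k u\<close> in the basis v, w: the
  exponents of x and of t in the function attached to u.\<close>

definition mm :: "nat \<Rightarrow> int \<times> int \<Rightarrow> int" where "mm k u = wedge (gv k u) w"
definition nn :: "nat \<Rightarrow> int \<times> int \<Rightarrow> int" where "nn k u = wedge v (gv k u)"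

lemma mm_basis: "mm k p * wedge u u' = wedge p u' * mm k u + wedge u p * mm k u'"
  and nn_basis: "nn k p * wedge u u' = wedge p u' * nn k u + wedge u p * nn k u'"
  by (simp_all add: mm_def nn_def gv_def wedge_def algebra_simps)

lemma mm_uminus: "mm k (- u) = - mm k u" and nn_uminus: "nn k (- u) = - nn k u"
  by (simp_all add: mm_def nn_def gv_def wedge_def algebra_simps)

lemma mn_red_v: "mm k (red k v) = mul k v" "nn k (red k v) = 0"
  and mn_red_w: "mm k (red k w) = 0" "nn k (red k w) = mul k w"
proof -
  have "wedge (c * fst v, c * snd v) w = c" "wedge v (c * fst w, c * snd w) = c" for c
    using vw by (simp_all add: wedge_def algebra_simps flip: right_diff_distrib)
  moreover have "wedge v (c * fst v, c * snd v) = 0" "wedge (c * fst w, c * snd w) w = 0" for c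
    by (simp_all add: wedge_def)
  ultimately show "mm k (red k v) = mul k v" "nn k (red k v) = 0" "mm k (red k w) = 0" "nn k (red k w) = mul k w"
    by (simp_all add: mm_def nn_def gv_red)
qed

abbreviation zz :: "nat \<Rightarrow> complex \<Rightarrow> int \<times> int \<Rightarrow> complex" where
  "zz k \<tau> u \<equiv> zc \<tau> (mm k u) (nn k u)"

lemma zz_basis:
  assumes "wedge u u' = 1" "\<tau> \<noteq> 0"
  shows "zz k \<tau> p = zz k \<tau> u powi wedge p u' * zz k \<tau> u' powi wedge u p"
proof -
  have "mm k p = mm k u * wedge p u' + mm k u' * wedge u p" "nn k p = nn k u * wedge p u' + nn k u' * wedge u p"
    using mm_basis[of k p u u'] nn_basis[of k p u u'] assms(1) by (simp_all add: mult.commute)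
  then show ?thesis
    using assms(2) by (simp add: zc_def power_int_add power_int_mult power_int_mult_distrib)
qed

lemma zz_uminus: "\<tau> \<noteq> 0 \<Longrightarrow> zz k \<tau> (- u) = inverse (zz k \<tau> u)"
  by (simp add: zc_def mm_uminus nn_uminus power_int_minus)

lemma zz_y: "zz k y u = zeta N powi (del k * snd u)"
proof -
  have "snd (gv k u) = wedge (gv k u) w * snd v + wedge v (gv k u) * snd w"
    by (rule wedge_basis_snd[OF vw])
  then show ?thesis
    by (simp add: zc_def x_def y_def mm_def nn_def snd_gv power_int_mult[symmetric] mult.commute flip: zeta_powi_add)
qed

text \<open>Otherwise the character would be trivial on the whole lattice, in particular at
  \<open>red k v\<close>, where its value x^(mul k v) is not 1.\<close>

lemma zz_not_both:
  assumes "wedge u u' = 1" "\<tau> \<noteq> 0"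
  shows "\<not> (zz k \<tau> u = 1 \<and> zz k \<tau> u' = 1)"
proof
  assume "zz k \<tau> u = 1 \<and> zz k \<tau> u' = 1"
  then have "zz k \<tau> (red k v) = 1" using zz_basis[OF assms, of k "red k v"] by simp
  then show False using x_mul[of k v] by (simp add: zc_def mn_red_v)
qed

text \<open>The potential of the tame symbols. It is well defined since s is unique modulo u.\<close>

definition Rs :: "nat \<Rightarrow> int \<times> int \<Rightarrow> complex \<Rightarrow> cunit" where
  "Rs k u \<tau> = (if \<tau> \<noteq> 0 \<and> zz k \<tau> u = 1 then - cunit_of (1 - inverse (zz k \<tau> (SOME s. wedge s u = 1))) else 0)"

lemma Rs_eq:
  assumes "wedge s u = 1" "\<tau> \<noteq> 0" "zz k \<tau> u = 1"
  shows "Rs k u \<tau> = - cunit_of (1 - inverse (zz k \<tau> s))"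
proof -
  define s' where "s' = (SOME s. wedge s u = 1)"
  have s': "wedge s' u = 1" using someI[of "\<lambda>s. wedge s u = 1", OF assms(1)] by (simp add: s'_def)
  have "zz k \<tau> s' = zz k \<tau> s" using zz_basis[OF assms(1,2), of k s'] s' assms(3) by simp
  then show ?thesis using assms by (simp add: Rs_def s'_def)
qed

lemma Rs_trivial: "zz k \<tau> u \<noteq> 1 \<or> \<tau> = 0 \<Longrightarrow> Rs k u \<tau> = 0"
  by (auto simp: Rs_def)

text \<open>A tame symbol at \<tau> arises only where one of the two functions vanishes, and is
  given by the value at the other vertex. For zeros at u' the complement s is u, for zeros at u it
  is - u'; so the contributions of an interior vertex cancel.\<close>

lemma snd_Q_edge:
  assumes "wedge u u' = 1" "ok (mm k u) (nn k u)" "0 < nn k u'"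
  shows "snd (Q (mm k u) (nn k u) (mm k u') (nn k u')) = Rs k u' - Rs k u"
proof
  fix \<tau>
  show "snd (Q (mm k u) (nn k u) (mm k u') (nn k u')) \<tau> = (Rs k u' - Rs k u) \<tau>"
  proof (cases "\<tau> = 0")
    case True
    then show ?thesis using snd_Q_0[OF assms(2,3)] by (simp add: Rs_trivial)
  next
    case False
    note nb = zz_not_both[OF assms(1) False, of k]
    note q = snd_Q[OF assms(2,3) False nb]
    have u: "wedge (- u') u = 1" using assms(1) wedge_swap[of u' u] by (simp add: wedge_simps)
    consider (a) "zz k \<tau> u' = 1" "zz k \<tau> u \<noteq> 1" | (b) "zz k \<tau> u' \<noteq> 1" "zz k \<tau> u = 1"
      | (c) "zz k \<tau> u' \<noteq> 1" "zz k \<tau> u \<noteq> 1" using nb by blast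
    then show ?thesis
    proof cases
      case a
      then show ?thesis using q Rs_eq[OF assms(1) False a(1)] by (simp add: Rs_trivial)
    next
      case b
      then show ?thesis using q Rs_eq[OF u False b(2)] zz_uminus[OF False, of k u'] by (simp add: Rs_trivial)
    next
      case c
      then show ?thesis using q by (simp add: Rs_trivial)
    qed
  qed
qed

text \<open>At a bad u the specialization at t = y returns the exponent of t, by
  \<open>fp_root\<close>. Where this exponent is 0, \<open>fst u\<close> is a default value, which
  is nonzero at bad primitive vectors.\<close>

definition bw :: "nat \<Rightarrow> int \<times> int \<Rightarrow> int" where
  "bw k u = (if nn k u = 0 then fst u else nn k u)"

lemma odd_weight_bw: "odd_weight (bw k)"
  unfolding odd_weight_def
proof (intro allI impI)
  fix u assume "prim u" "\<not> good u"
  then have "fst u \<noteq> 0" by (rule bad_fst_nonzero)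
  then show "bw k u \<noteq> 0 \<and> bw k (- u) = - bw k u" by (auto simp: bw_def nn_uminus)
qed

lemma gal_phi:
  assumes "prim u" "ok (mm k u) (nn k u)"
  shows "gal_sigma N (del k) (phi (bw k) u) = ph (mm k u) (nn k u)"
proof (cases "good u")
  case True
  have "coprime (int N) (del k)" using coprime_del by (simp add: coprime_commute)
  then have "zz k y u \<noteq> 1"
    using True by (simp add: zz_y zeta_powi_eq_1_iff[OF N_pos] good_def coprime_dvd_mult_right_iff)
  then show ?thesis using True gal_sigma_one_minus_zeta_powi[OF N_pos coprime_del] by (simp add: phi_def ph_def zz_y)
next
  case False
  then have z: "zz k y u = 1" by (simp add: zz_y zeta_powi_eq_1_iff[OF N_pos] good_def)
  then have "nn k u \<noteq> 0" using assms(2) by (auto simp: ok_def zc_def)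
  then show ?thesis using False z gal_sigma_of_int[OF N_pos coprime_del] by (simp add: phi_def ph_def bw_def)
qed

lemma fst_Q_edge:
  assumes "wedge u u' = 1" "ok (mm k u) (nn k u)" "0 < nn k u'"
  shows "fst (Q (mm k u) (nn k u) (mm k u') (nn k u')) = gal (del k) (pot (bw k) u' - pot (bw k) u)"
proof -
  have pr: "prim u" "prim u'" using wedge_1_prim[OF assms(1)] by auto
  have ok': "ok (mm k u') (nn k u')" using assms by (simp add: ok_def)
  note bo = odd_weight_bw[of k]
  note ph1 = phi_in[OF bo pr(1)] phi_nonzero[OF bo pr(1)]
  note gp = gal_phi[OF pr(1) assms(2)] gal_phi[OF pr(2) ok']
  have pin: "ph (mm k u) (nn k u) \<in> cyc_field N" "ph (mm k u) (nn k u) \<noteq> 0"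
    "ph (mm k u') (nn k u') \<in> cyc_field N" "ph (mm k u') (nn k u') \<noteq> 0"
    using gal_sigma_closed[OF N_pos coprime_del[of k]] gal_sigma_nonzero[OF N_pos coprime_del[of k]]
      phi_in[OF bo] phi_nonzero[OF bo] pr unfolding gp[symmetric] by auto
  have zi: "zz k y u \<in> cyc_field N" "zz k y u \<noteq> 0" by (simp_all add: zz_y zeta_in)
  have "pot (bw k) u' - pot (bw k) u = P (bw k) u u'" by (rule pot_edge[OF bo assms(1)])
  then have "gal (del k) (pot (bw k) u' - pot (bw k) u)
      = ksym (ph (mm k u') (nn k u')) (gal_sigma N (del k) (phi (bw k) (- u)))"
    using gal_ksym[OF coprime_del] by (simp add: P_def gp)
  also have "gal_sigma N (del k) (phi (bw k) (- u)) = ph (mm k u) (nn k u) * ((- 1) * inverse (zz k y u))"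
  proof -
    have i: "zeta N powi (- snd u) \<in> cyc_field N" by (rule zeta_in)
    show ?thesis
      unfolding phi_uminus[OF bo pr(1)] gal_sigma_mult[OF N_pos coprime_del ph1(1) F.K_uminus[OF i]]
        gal_sigma_minus[OF N_pos coprime_del i] gp gal_sigma_zeta_powi[OF N_pos coprime_del]
      by (simp add: zz_y power_int_minus)
  qed
  also have "ksym (ph (mm k u') (nn k u')) \<dots>
      = ksym (ph (mm k u') (nn k u')) (ph (mm k u) (nn k u)) + ksym (ph (mm k u') (nn k u')) ((- 1) * inverse (zz k y u))"
    by (rule ksym_mult_right) (use pin zi F.K_uminus[OF F.K_inverse[OF zi(1)]] in simp_all)
  also have "ksym (ph (mm k u') (nn k u')) ((- 1) * inverse (zz k y u))
      = ksym (ph (mm k u') (nn k u')) (- 1) + ksym (ph (mm k u') (nn k u')) (inverse (zz k y u))"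
    by (rule ksym_mult_right) (use pin zi m1_in F.K_inverse[OF zi(1)] in simp_all)
  also have "ksym (ph (mm k u') (nn k u')) (inverse (zz k y u)) = - ksym (ph (mm k u') (nn k u')) (zz k y u)"
    by (rule ksym_inverse_right) (use pin zi in simp_all)
  finally show ?thesis unfolding fst_Q[OF assms(2,3)] by (simp add: add.assoc)
qed

text \<open>A common potential for both components of \<open>Q\<close>, so that a path contributes
  only its end points.\<close>

definition G :: "nat \<Rightarrow> int \<times> int \<Rightarrow> K2fam \<times> (complex \<Rightarrow> cunit)" where
  "G k u = (gal (del k) (pot (bw k) u), Rs k u)"

lemma G_edge:
  assumes "wedge u u' = 1" "ok (mm k u) (nn k u)" "0 < nn k u'"
  shows "G k u' - G k u \<in> GC"
proof -
  have "G k u' - G k u = Q (mm k u) (nn k u) (mm k u') (nn k u')"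
    using fst_Q_edge[OF assms] snd_Q_edge[OF assms] by (simp add: G_def prod_eq_iff gal_diff[OF coprime_del])
  then show ?thesis using Q_in_GC assms by simp
qed

text \<open>Subdivision of the cone of u and u' into cones of bases, as in a continued fraction: q
  completes u to a basis and satisfies 0 < wedge q u' < wedge u u'. Lying inside the cone, q has a
  positive exponent of t, so all functions on the way are polynomials.\<close>

lemma G_cone:
  assumes "0 < wedge u u'" "prim u" "prim u'" "ok (mm k u) (nn k u)" "0 < nn k u'"
  shows "G k u' - G k u \<in> GC"
  using assms
proof (induction "nat (wedge u u')" arbitrary: u rule: less_induct)
  case less
  define D where "D = wedge u u'"
  show ?case
  proof (cases "D = 1")
    case True
    then show ?thesis using G_edge[OF _ less.prems(4,5)] by (simp add: D_def)
  next
    case False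
    then have D: "1 < D" using less.prems by (simp add: D_def)
    obtain q0 where q0: "wedge u q0 = 1" using prim_partner less.prems by blast
    \<comment> \<open>Adding n u to q0 replaces its wedge with u' by the residue modulo D.\<close>
    define n where "n = - (wedge q0 u' div D)"
    define q where "q = (fst q0 + n * fst u, snd q0 + n * snd u)"
    have uq: "wedge u q = 1" using q0 by (simp add: q_def wedge_def algebra_simps)
    have "wedge q u' = wedge q0 u' + n * D" by (simp add: q_def D_def wedge_def algebra_simps)
    then have qm: "wedge q u' = wedge q0 u' mod D" by (simp add: n_def minus_div_mult_eq_mod)
    then have q1: "0 \<le> wedge q u'" "wedge q u' < D" using D by simp_all
    have "wedge q u' \<noteq> 0"
    proof
      assume z: "wedge q u' = 0"
      have b: "fst p * wedge u q = wedge p q * fst u + wedge u p * fst q"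
        "snd p * wedge u q = wedge p q * snd u + wedge u p * snd q" for p
        by (simp_all add: wedge_def algebra_simps)
      have "wedge u' q = 0" using z wedge_swap[of u' q] by simp
      then have "fst u' = D * fst q" "snd u' = D * snd q"
        using b[of u'] uq by (simp_all add: D_def)
      then have "D dvd 1" using less.prems(3) coprime_common_divisor[of "fst u'" "snd u'" D]
        by (simp add: prim_def)
      then show False using D by simp
    qed
    then have q2: "0 < wedge q u'" using q1 by simp
    have "nn k q * D = wedge q u' * nn k u + nn k u'"
      using nn_basis[of k q u u'] uq by (simp add: D_def)
    moreover have "0 \<le> wedge q u' * nn k u" using q2 less.prems(4) by (auto simp: ok_def)
    ultimately have "0 < nn k q * D" using less.prems(5) by linarith
    then have nq: "0 < nn k q" using D by (simp add: zero_less_mult_iff)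
    then have "ok (mm k q) (nn k q)" by (simp add: ok_def)
    moreover have "nat (wedge q u') < nat (wedge u u')" using q1 D by (simp add: D_def)
    ultimately have "G k u' - G k q \<in> GC"
      using less.hyps[of q] q2 wedge_1_prim[OF uq] less.prems(3,5) by blast
    moreover have "G k q - G k u \<in> GC" using G_edge[OF uq less.prems(4) nq] .
    ultimately have "(G k u' - G k q) + (G k q - G k u) \<in> GC"
      unfolding GC_def by (rule group_closure_add)
    then show ?thesis by simp
  qed
qed

lemma prim_vw: "prim v" "prim w"
  using wedge_1_prim[OF vw] by auto

lemma G_red: "G k (red k w) - G k (red k v) \<in> GC"
proof (rule G_cone)
  have "wedge (gv k (red k v)) (gv k (red k w)) = mul k v * mul k w * wedge v w"
    unfolding gv_red by (simp add: wedge_def algebra_simps)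
  then have "int l * wedge (red k v) (red k w) = mul k v * mul k w * wedge v w"
    unfolding wedge_gv .
  then have "0 < int l * wedge (red k v) (red k w)" using mul_pos vw by simp
  then show "0 < wedge (red k v) (red k w)" using l_pos by (simp add: zero_less_mult_iff)
  show "ok (mm k (red k v)) (nn k (red k v))" using x_mul by (simp add: ok_def mn_red_v)
  show "0 < nn k (red k w)" using mul_pos by (simp add: mn_red_w)
qed (use prim_red prim_vw in auto)

text \<open>At the start of a path the function is constant in t and nonzero.\<close>

lemma Rs_red_v: "Rs k (red k v) = 0"
proof
  fix \<tau>
  show "Rs k (red k v) \<tau> = 0 \<tau>"
    using x_mul[of k v] by (auto intro!: Rs_trivial simp: zc_def mn_red_v)
qed

text \<open>In the lattice that contains w the last function is 1 - t, and a complement s of w has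
  x-exponent l, the index of the lattice.\<close>

lemma Rs_red_w_1:
  assumes "int l dvd lam k w"
  shows "Rs k (red k w) \<tau> = (if \<tau> = 1 then - cunit_of (1 - inverse (x ^ l)) else 0)"
proof (cases "\<tau> = 1")
  case True
  obtain s where s: "wedge s (red k w) = 1"
    using prim_partner[OF prim_red[OF prim_vw(2)], of k] wedge_swap by (metis minus_minus wedge_simps(5))
  have "mul k w = 1" using assms by (simp add: mul_def)
  then have "gv k (red k w) = w" by (simp add: gv_red)
  then have "mm k s = int l" using wedge_gv[of k s "red k w"] s by (simp add: mm_def)
  then have "zz k \<tau> s = x ^ l" using True by (simp add: zc_def)
  moreover have "zz k \<tau> (red k w) = 1" using True by (simp add: zc_def mn_red_w)
  ultimately show ?thesis using Rs_eq[OF s, of \<tau> k] True by simp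
next
  case False
  have "mul k w = 1" using assms by (simp add: mul_def)
  then have "zz k \<tau> (red k w) \<noteq> 1" using False by (simp add: zc_def mn_red_w)
  then show ?thesis using False by (simp add: Rs_trivial)
qed

text \<open>For a lattice that does not contain w: the residue n modulo l for which v + n w lies in
  the lattice. It is read off from a complement of the last vector of the path.\<close>

definition slope :: "nat \<Rightarrow> nat" where
  "slope k = nat (nn k (SOME s. wedge s (red k w) = 1) mod int l)"

lemma slope_props:
  assumes "\<not> int l dvd lam k w"
  shows "slope k < l" "int l dvd lam k (fst v + int (slope k) * fst w, snd v + int (slope k) * snd w)"
    and "\<tau> \<noteq> 0 \<Longrightarrow> Rs k (red k w) \<tau> = (if \<tau> ^ l = 1 then - cunit_of (1 - inverse (x * \<tau> ^ slope k)) else 0)"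
proof -
  define s where "s = (SOME s. wedge s (red k w) = 1)"
  have "\<exists>s. wedge s (red k w) = 1"
    using prim_partner[OF prim_red[OF prim_vw(2)], of k] wedge_swap by (metis minus_minus wedge_simps(5))
  then have s: "wedge s (red k w) = 1" unfolding s_def by (rule someI_ex)
  have m: "mul k w = int l" using assms by (simp add: mul_def)
  have sl: "slope k = nat (nn k s mod int l)" by (simp add: slope_def s_def)
  show "slope k < l" using l_pos by (simp add: sl nat_less_iff)
  define q where "q = nn k s div int l"
  have nq: "nn k s = int (slope k) + int l * q" using l_pos by (simp add: sl q_def)
  have "wedge (gv k s) (gv k (red k w)) = int l" using wedge_gv s by simp
  then have "int l * wedge (gv k s) w = int l" unfolding gv_red m by (simp add: wedge_def algebra_simps)
  then have mm1: "mm k s = 1" using l_pos by (simp add: mm_def)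
  have gs: "gv k s = (fst v + nn k s * fst w, snd v + nn k s * snd w)"
  proof -
    have "fst p * wedge v w = wedge p w * fst v + wedge v p * fst w"
      "snd p * wedge v w = wedge p w * snd v + wedge v p * snd w" for p
      by (simp_all add: wedge_def algebra_simps)
    from this[of "gv k s"] show ?thesis using mm1 vw by (simp add: mm_def nn_def prod_eq_iff)
  qed
  have lin: "lam k (a + c * p, b + c * r) = lam k (a, b) + c * lam k (p, r)" for a b c p r
    by (simp add: lam_def algebra_simps)
  have "int l dvd lam k v + nn k s * lam k w"
    using lam_gv[of k s] unfolding gs lin by simp
  then have "int l dvd lam k v + int (slope k) * lam k w + int l * (q * lam k w)"
    unfolding nq by (simp add: algebra_simps)
  then have "int l dvd lam k v + int (slope k) * lam k w"
    by (metis dvd_add_left_iff dvd_triv_left)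
  then show "int l dvd lam k (fst v + int (slope k) * fst w, snd v + int (slope k) * snd w)"
    unfolding lin by simp
  show "Rs k (red k w) \<tau> = (if \<tau> ^ l = 1 then - cunit_of (1 - inverse (x * \<tau> ^ slope k)) else 0)" if t: "\<tau> \<noteq> 0"
  proof (cases "\<tau> ^ l = 1")
    case True
    have "zz k \<tau> (red k w) = 1" using True m by (simp add: zc_def mn_red_w)
    moreover have "zz k \<tau> s = x * \<tau> ^ slope k"
      using t True by (simp add: zc_def mm1 nq power_int_add power_int_mult)
    ultimately show ?thesis using Rs_eq[OF s t, of k] True by simp
  next
    case False
    have "zz k \<tau> (red k w) \<noteq> 1" using False m by (simp add: zc_def mn_red_w)
    then show ?thesis using False by (simp add: Rs_trivial)
  qed
qed

text \<open>Modulo l the lines of F_l^2 are spanned by w and by v + n w for the residues n, so the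
  lattices other than that of w are counted by their slopes.\<close>

lemma slope_bij:
  obtains k0 where "k0 \<le> l" "int l dvd lam k0 w" "\<And>k. k \<le> l \<Longrightarrow> k \<noteq> k0 \<Longrightarrow> \<not> int l dvd lam k w"
    "bij_betw slope ({..l} - {k0}) {..<l}"
proof -
  obtain k0 where k0: "k0 \<le> l" "int l dvd lam k0 w" using lam_exists by blast
  have nd: "\<not> int l dvd lam k w" if "k \<le> l" "k \<noteq> k0" for k
    using lam_unique[OF prim_vw(2) _ k0(2) that(1) k0(1)] that by blast
  have inj: "inj_on slope ({..l} - {k0})"
  proof (rule inj_onI)
    fix a b assume ab: "a \<in> {..l} - {k0}" "b \<in> {..l} - {k0}" "slope a = slope b"
    define p where "p = (fst v + int (slope a) * fst w, snd v + int (slope a) * snd w)"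
    have "wedge p w = wedge v w" by (simp add: p_def wedge_def algebra_simps)
    then have "prim p" using vw wedge_1_prim by simp
    moreover have "int l dvd lam a p" "int l dvd lam b p"
      using slope_props(2)[OF nd, of a] slope_props(2)[OF nd, of b] ab by (auto simp: p_def)
    ultimately show "a = b" using lam_unique ab by auto
  qed
  have "slope ` ({..l} - {k0}) = {..<l}"
  proof (rule card_subset_eq)
    show "slope ` ({..l} - {k0}) \<subseteq> {..<l}" using slope_props(1)[OF nd] by auto
    show "card (slope ` ({..l} - {k0})) = card {..<l}" using card_image[OF inj] k0 by simp
  qed simp
  then show ?thesis using that[of k0] k0 nd inj by (simp add: bij_betw_def)
qed

text \<open>The tame symbols at the ends of all paths. At \<tau> = 1 the l slopes give l copies of 1
  - 1/x, and the lattice of w gives 1 - x^(-l). At every other l-th root of unity the slopes give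
  the factors of 1 - x^(-l).\<close>

lemma sum_Rs_red_w:
  assumes "\<tau> \<noteq> 0"
  shows "(\<Sum>k\<le>l. Rs k (red k w) \<tau>) = (\<Sum>i<l. snd (Q 1 0 0 1) \<tau>) + snd (Q (int l) 0 0 (int l)) \<tau>"
proof -
  obtain k0 where k0: "k0 \<le> l" "int l dvd lam k0 w" and nd: "\<And>k. k \<le> l \<Longrightarrow> k \<noteq> k0 \<Longrightarrow> \<not> int l dvd lam k w"
    and bij: "bij_betw slope ({..l} - {k0}) {..<l}" using slope_bij by metis
  have nz: "1 - inverse x \<noteq> 0" "1 - inverse (x ^ l) \<noteq> 0" using x_1 x_l by auto
  have Q1: "snd (Q 1 0 0 1) \<tau> = (if \<tau> = 1 then - cunit_of (1 - inverse x) else 0)"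
    by (subst snd_Q) (use assms x_1 in \<open>auto simp: ok_def zc_def\<close>)
  have Ql: "snd (Q (int l) 0 0 (int l)) \<tau> = (if \<tau> ^ l = 1 then - cunit_of (1 - inverse (x ^ l)) else 0)"
    by (subst snd_Q) (use assms x_l l_pos in \<open>auto simp: ok_def zc_def\<close>)
  have "(\<Sum>k\<le>l. Rs k (red k w) \<tau>) = Rs k0 (red k0 w) \<tau> + (\<Sum>k\<in>{..l} - {k0}. Rs k (red k w) \<tau>)"
    using k0 by (simp add: sum.remove)
  also have "(\<Sum>k\<in>{..l} - {k0}. Rs k (red k w) \<tau>)
      = (\<Sum>k\<in>{..l} - {k0}. if \<tau> ^ l = 1 then - cunit_of (1 - inverse (x * \<tau> ^ slope k)) else 0)"
    using slope_props(3)[OF nd assms] by (intro sum.cong) auto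
  also have "\<dots> = (\<Sum>n<l. if \<tau> ^ l = 1 then - cunit_of (1 - inverse (x * \<tau> ^ n)) else 0)"
    by (rule sum.reindex_bij_betw[OF bij])
  finally have S: "(\<Sum>k\<le>l. Rs k (red k w) \<tau>)
      = Rs k0 (red k0 w) \<tau> + (\<Sum>n<l. if \<tau> ^ l = 1 then - cunit_of (1 - inverse (x * \<tau> ^ n)) else 0)" .
  consider "\<tau> = 1" | "\<tau> \<noteq> 1" "\<tau> ^ l = 1" | "\<tau> ^ l \<noteq> 1" "\<tau> \<noteq> 1" by fastforce
  then show ?thesis
  proof cases
    case 1
    then show ?thesis unfolding S Q1 Ql using Rs_red_w_1[OF k0(2), of \<tau>] by (simp add: add.commute)
  next
    case 2
    have nzn: "1 - inverse (x * \<tau> ^ n) \<noteq> 0" for n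
    proof
      assume "1 - inverse (x * \<tau> ^ n) = 0"
      then have "x * \<tau> ^ n = 1" by (metis eq_iff_diff_eq_0 inverse_eq_1_iff)
      then have "x ^ l * (\<tau> ^ l) ^ n = 1" by (metis power_commutes power_mult power_mult_distrib power_one mult.commute)
      then show False using 2 x_l by simp
    qed
    have "(\<Prod>n<l. 1 - inverse (x * \<tau> ^ n)) = (\<Prod>n<l. 1 - inverse x * inverse \<tau> ^ n)"
      by (simp add: power_inverse)
    also have "\<dots> = 1 - inverse x ^ l"
      using 2 by (intro prod_one_minus_roots_of_unity prime_l) (simp_all add: power_inverse)
    finally have pr: "(\<Prod>n<l. 1 - inverse (x * \<tau> ^ n)) = 1 - inverse (x ^ l)" by (simp add: power_inverse)
    have "cval (\<Sum>n<l. - cunit_of (1 - inverse (x * \<tau> ^ n))) = inverse (\<Prod>n<l. 1 - inverse (x * \<tau> ^ n))"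
      unfolding cval_sum using nzn by (simp add: prod_inversef[symmetric])
    also have "\<dots> = cval (- cunit_of (1 - inverse (x ^ l)))" unfolding pr using nz by simp
    finally have "(\<Sum>n<l. - cunit_of (1 - inverse (x * \<tau> ^ n))) = - cunit_of (1 - inverse (x ^ l))"
      by (rule cunit_eqI)
    then show ?thesis unfolding S Q1 Ql using 2 Rs_red_w_1[OF k0(2), of \<tau>] by simp
  next
    case 3
    then show ?thesis unfolding S Q1 Ql using Rs_red_w_1[OF k0(2), of \<tau>] by simp
  qed
qed

lemma fst_Q_axis:
  assumes "x ^ e \<noteq> 1" "y ^ e \<noteq> 1" "0 < e"
  shows "fst (Q (int e) 0 0 (int e)) = ksym (1 - y ^ e) (1 - inverse (x ^ e))"
proof -
  have ok: "ok (int e) 0" using assms by (simp add: ok_def)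
  have "ph 0 (int e) = 1 - y ^ e" "ph (int e) 0 = 1 - x ^ e" "zc y (int e) 0 = x ^ e"
    using assms by (simp_all add: ph_def zc_def)
  then show ?thesis
    using fst_Q[OF ok, of "int e" 0] ksym_one_minus_inverse[of "1 - y ^ e" "x ^ e"] assms
      one_minus_in F.K_power[OF x_in(1)] F.K_power[OF y_in(1)] by simp
qed

theorem hecke_edge_identity:
  "(\<Sum>k\<le>l. gal (del k) (pot (bw k) (red k w) - pot (bw k) (red k v)))
     = (\<Sum>i<l. ksym (1 - y) (1 - inverse x)) + ksym (1 - y ^ l) (1 - inverse (x ^ l))"
proof -
  \<comment> \<open>Before the specialization t = y, \<open>Q 1 0 0 1\<close> is the edge symbol {1
    - t, 1 - 1/x}, and \<open>Q (int l) 0 0 (int l)\<close> is {1 - t^l, 1 - x^(-l)}.\<close>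
  define X where "X = (\<Sum>k\<le>l. G k (red k w) - G k (red k v)) - (\<Sum>i<l. Q 1 0 0 1) - Q (int l) 0 0 (int l)"
  have sumGC: "(\<Sum>i\<in>I. f i) \<in> GC" if "\<And>i. i \<in> I \<Longrightarrow> f i \<in> GC" for f :: "nat \<Rightarrow> _" and I
    using that by (induction I rule: infinite_finite_induct) (auto simp: GC_def intro: group_closure_add)
  have Q1: "Q 1 0 0 1 \<in> GC" "Q (int l) 0 0 (int l) \<in> GC"
    using Q_in_GC x_1 x_l l_pos by (auto simp: ok_def)
  have fstsum: "fst (\<Sum>i\<in>I. f i) = (\<Sum>i\<in>I. fst (f i))" "snd (\<Sum>i\<in>I. f i) \<tau> = (\<Sum>i\<in>I. snd (f i) \<tau>)"
    for f :: "nat \<Rightarrow> K2fam \<times> (complex \<Rightarrow> cunit)" and I \<tau>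
    by (induction I rule: infinite_finite_induct) auto
  have "X \<in> GC" unfolding X_def using sumGC[of "{..l}"] sumGC[of "{..<l}"] G_red Q1 unfolding GC_def
    by (intro group_closure.diff) auto
  moreover have "snd X = 0"
  proof
    fix \<tau>
    show "snd X \<tau> = 0 \<tau>"
    proof (cases "\<tau> = 0")
      case True
      have "snd (Q 1 0 0 1) 0 = 0" "snd (Q (int l) 0 0 (int l)) 0 = 0"
        using snd_Q_0 x_1 x_l l_pos by (auto simp: ok_def)
      then show ?thesis using True by (simp add: X_def fstsum G_def Rs_trivial)
    next
      case False
      then show ?thesis using sum_Rs_red_w[OF False] by (simp add: X_def fstsum G_def Rs_red_v)
    qed
  qed
  ultimately have "fst X = 0" using GC_vanish[of "fst X"] by (metis prod.collapse)
  then have "(\<Sum>k\<le>l. gal (del k) (pot (bw k) (red k w)) - gal (del k) (pot (bw k) (red k v)))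
      = (\<Sum>i<l. fst (Q 1 0 0 1)) + fst (Q (int l) 0 0 (int l))"
    by (simp add: X_def fstsum G_def algebra_simps)
  then show ?thesis
    using fst_Q_axis[of 1] fst_Q_axis[of l] x_1 y_1 x_l y_l l_pos by (simp add: gal_diff[OF coprime_del])
qed

end


section \<open>The cocycle and its Hecke translates\<close>

text \<open>The factor det makes the potential equivariant also under matrices of determinant -1, which
  reverse the orientation of edges.\<close>

fun star :: "imat \<Rightarrow> int \<times> int \<Rightarrow> int \<times> int" where
  "star (a, b, c, d) v = ((a * d - b * c) * (a * fst v + b * snd v), (a * d - b * c) * (c * fst v + d * snd v))"

lemma Gamma0tE:
  assumes "\<gamma> \<in> Gamma0t N"
  obtains a b c d where "\<gamma> = (a, b, c, d)" "int N dvd c" "a * d - b * c = 1 \<or> a * d - b * c = - 1"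
  using assms by (auto simp: Gamma0t_def abs_if split: if_splits)

lemma mdet_mmul: "mdet (mmul g h) = mdet g * mdet h"
  by (cases g; cases h) (simp add: algebra_simps)

lemma Gamma0t_mdet: "\<gamma> \<in> Gamma0t N \<Longrightarrow> mdet \<gamma> = 1 \<or> mdet \<gamma> = - 1"
  by (erule Gamma0tE) auto

lemma Gamma0t_lower_right_coprime: assumes "\<gamma> \<in> Gamma0t N" shows "coprime (lower_right \<gamma>) (int N)"
proof -
  obtain a b c d where g: "\<gamma> = (a, b, c, d)" "int N dvd c" "a * d - b * c = 1 \<or> a * d - b * c = - 1"
    using assms by (rule Gamma0tE)
  have "coprime d (int N)"
  proof (rule coprimeI)
    fix e assume e: "e dvd d" "e dvd int N"
    then have "e dvd a * d - b * c" using g(2) by (meson dvd_diff dvd_mult dvd_trans)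
    then show "is_unit e" using g(3) by auto
  qed
  then show ?thesis by (simp add: g)
qed

lemma star_wedge: assumes "\<gamma> \<in> Gamma0t N" shows "wedge (star \<gamma> v) (star \<gamma> w) = mdet \<gamma> * wedge v w"
proof -
  obtain a b c d where g: "\<gamma> = (a, b, c, d)" "a * d - b * c = 1 \<or> a * d - b * c = - 1"
    using assms by (rule Gamma0tE)
  have "wedge (star \<gamma> v) (star \<gamma> w) = (a * d - b * c) * (a * d - b * c) * ((a * d - b * c) * wedge v w)"
    unfolding g star.simps by (simp add: wedge_def algebra_simps)
  also have "(a * d - b * c) * (a * d - b * c) = 1" using g(2) by auto
  finally show ?thesis by (simp add: g)
qed

lemma star_prim: assumes "\<gamma> \<in> Gamma0t N" "prim v" shows "prim (star \<gamma> v)"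
proof -
  obtain w where "wedge v w = 1" using prim_partner[OF assms(2)] by blast
  then have "wedge (star \<gamma> v) (star \<gamma> w) = 1 \<or> wedge (star \<gamma> w) (star \<gamma> v) = 1"
    using star_wedge[OF assms(1)] wedge_swap Gamma0t_mdet[OF assms(1)] by (metis minus_minus mult.right_neutral)
  then show ?thesis using wedge_1_prim by blast
qed

lemma star_inverse:
  assumes "\<gamma> \<in> Gamma0t N"
  obtains h where "\<And>v. star \<gamma> (h v) = v" "\<And>v. h (star \<gamma> v) = v"
proof -
  obtain a b c d where g: "\<gamma> = (a, b, c, d)" "a * d - b * c = 1 \<or> a * d - b * c = - 1"
    using assms by (rule Gamma0tE)
  define D where "D = a * d - b * c"
  have DD: "D * D = 1" using g(2) by (auto simp: D_def)
  \<comment> \<open>\<open>star \<gamma>\<close> acts as D \<gamma>, whose inverse is the plain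
    adjugate because D * D = 1.\<close>
  define h where "h = (\<lambda>v::int \<times> int. (d * fst v - b * snd v, - c * fst v + a * snd v))"
  have e: "D * (a * (d * p - b * q) + b * (- c * p + a * q)) = (D * D) * p"
    "D * (c * (d * p - b * q) + d * (- c * p + a * q)) = (D * D) * q"
    "d * (D * (a * p + b * q)) - b * (D * (c * p + d * q)) = (D * D) * p"
    "- c * (D * (a * p + b * q)) + a * (D * (c * p + d * q)) = (D * D) * q" for p q
    by (simp_all add: D_def algebra_simps)
  have "star \<gamma> (h v) = v" "h (star \<gamma> v) = v" for v
    unfolding g star.simps h_def D_def[symmetric] using e[of "fst v" "snd v"] DD by simp_all
  then show ?thesis using that by blast
qed

context cyclotomic
begin

lemma odd_weight_fst: "odd_weight fst"
  unfolding odd_weight_def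
proof (intro allI impI)
  fix u assume "prim u" "\<not> good u"
  then have "fst u \<noteq> 0" by (rule bad_fst_nonzero)
  then show "fst u \<noteq> 0 \<and> fst (- u) = - fst u" by simp
qed

text \<open>The potential normalized at the base point of all paths, so that \<Theta> at \<gamma>
  becomes its value at \<open>star \<gamma> (0, 1)\<close>.\<close>

definition Pt :: "int \<times> int \<Rightarrow> K2fam" where
  "Pt v = pot fst v - pot fst (0, 1)"

lemma Pt_start [simp]: "Pt (0, 1) = 0"
  by (simp add: Pt_def)

lemma Pt_edge:
  assumes "wedge v w = 1" "good v" "good w"
  shows "Pt w - Pt v = ksym (1 - zeta N powi snd w) (1 - zeta N powi (- snd v))"
  using pot_edge[OF odd_weight_fst assms(1)] P_good[OF assms(2,3)] by (simp add: Pt_def)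

lemma Pt_weight:
  assumes "odd_weight \<beta>" "reach v" "reach w"
  shows "pot \<beta> w - pot \<beta> v = Pt w - Pt v"
proof -
  have "pot \<beta> v - pot \<beta> (0, 1) = Pt v" "pot \<beta> w - pot \<beta> (0, 1) = Pt w"
    using pot_weight_independent[OF assms(1) odd_weight_fst] assms(2,3) by (simp_all add: Pt_def)
  then show ?thesis by (metis diff_diff_eq2 diff_add_cancel add_diff_cancel_right diff_add_eq)
qed

lemma good_one_minus: "good v \<Longrightarrow> 1 - zeta N powi snd v \<in> units_F N \<and> 1 - zeta N powi (- snd v) \<in> units_F N"
  using one_minus_in[OF zeta_in[of "snd v"]] one_minus_in[OF zeta_in[of "- snd v"]]
  by (simp add: units_F_iff good_iff) (simp add: power_int_minus)

lemma Pt_carr: "reach v \<Longrightarrow> Pt v \<in> carr"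
proof (induction rule: reach.induct)
  case (step v w)
  have "Pt w - Pt v \<in> carr"
    unfolding Pt_edge[OF step(2) reach_good[OF step(1)] step(3)]
    using carr_ksym good_one_minus reach_good[OF step(1)] step(3) by blast
  from carr_add[OF this step.IH] show ?case by simp
qed (simp add: carr_0)

lemma gal_Pt_edge:
  assumes "wedge v w = 1" "good v" "good w" "coprime j (int N)"
  shows "gal j (Pt w - Pt v) = ksym (1 - zeta N powi (j * snd w)) (1 - zeta N powi (j * - snd v))"
  unfolding Pt_edge[OF assms(1-3)] gal_ksym[OF assms(4)]
  by (simp add: gal_sigma_one_minus_zeta_powi[OF N_pos assms(4)])

text \<open>On the symbol of an edge the automorphisms multiply the exponents of \<zeta>, which
  matter only modulo N; so the composition law is compared edge by edge.\<close>

lemma gal_gal_Pt: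
  assumes "reach v" "coprime i (int N)" "coprime j (int N)" "coprime i' (int N)" "coprime j' (int N)"
    "int N dvd i * j - i' * j'"
  shows "gal i (gal j (Pt v)) = gal i' (gal j' (Pt v))"
  using assms(1)
proof (induction rule: reach.induct)
  case start
  then show ?case using assms gal_0 by simp
next
  case (step v w)
  have e: "gal i (gal j (Pt w - Pt v)) = ksym (1 - zeta N powi (i * (j * snd w))) (1 - zeta N powi (i * (j * - snd v)))"
    if "coprime i (int N)" "coprime j (int N)" for i j
    unfolding gal_Pt_edge[OF step(2) reach_good[OF step(1)] step(3) that(2)] gal_ksym[OF that(1)]
    by (simp add: gal_sigma_one_minus_zeta_powi[OF N_pos that(1)])
  have c: "zeta N powi (i * (j * a)) = zeta N powi (i' * (j' * a))" for a
  proof (rule zeta_powi_cong[OF N_pos])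
    have "i * (j * a) - i' * (j' * a) = (i * j - i' * j') * a" by (simp add: algebra_simps)
    then show "int N dvd i * (j * a) - i' * (j' * a)" using assms(6) by simp
  qed
  have "gal i (gal j (Pt w - Pt v)) = gal i' (gal j' (Pt w - Pt v))"
    unfolding e[OF assms(2,3)] e[OF assms(4,5)] c ..
  then have "gal i (gal j (Pt w - Pt v)) + gal i (gal j (Pt v)) = gal i' (gal j' (Pt w - Pt v)) + gal i' (gal j' (Pt v))"
    using step.IH by simp
  then show ?case
    by (simp add: gal_add[OF assms(2), symmetric] gal_add[OF assms(3), symmetric]
        gal_add[OF assms(4), symmetric] gal_add[OF assms(5), symmetric])
qed

lemma star_good: assumes "\<gamma> \<in> Gamma0t N" "good v" shows "good (star \<gamma> v)"
proof -
  obtain a b c d where g: "\<gamma> = (a, b, c, d)" "int N dvd c" "a * d - b * c = 1 \<or> a * d - b * c = - 1"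
    using assms(1) by (rule Gamma0tE)
  have "coprime (int N) d" using Gamma0t_lower_right_coprime[OF assms(1)] by (simp add: g coprime_commute)
  then have "\<not> int N dvd d * snd v" using assms(2) by (simp add: good_def coprime_dvd_mult_right_iff)
  then have "\<not> int N dvd c * fst v + d * snd v" using g(2) by (simp add: dvd_add_right_iff)
  moreover have "snd (star \<gamma> v) = c * fst v + d * snd v \<or> snd (star \<gamma> v) = - (c * fst v + d * snd v)"
    using g(3) by (auto simp: g(1) simp del: minus_add_distrib)
  ultimately show ?thesis unfolding good_def by (metis dvd_minus_iff)
qed

text \<open>The cocycle relation in terms of the potential. Modulo N, \<open>star \<gamma>\<close>
  multiplies second coordinates by the determinant times d. For determinant - 1 edges are reversed
  and exponents change sign, and antisymmetry of the symbol compensates both.\<close>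

lemma star_equivariant:
  assumes \<gamma>: "\<gamma> \<in> Gamma0t N" and v: "reach v"
  shows "Pt (star \<gamma> v) - Pt (star \<gamma> (0, 1)) = gal (lower_right \<gamma>) (Pt v)"
  using v
proof (induction rule: reach.induct)
  case start
  then show ?case using gal_0[OF Gamma0t_lower_right_coprime[OF \<gamma>]] by simp
next
  case (step v w)
  obtain a b c d where g: "\<gamma> = (a, b, c, d)" "int N dvd c" "a * d - b * c = 1 \<or> a * d - b * c = - 1"
    using \<gamma> by (rule Gamma0tE)
  note cop = Gamma0t_lower_right_coprime[OF \<gamma>]
  note gd = reach_good[OF step(1)] step(3)
  have dd: "coprime d (int N)" using cop by (simp add: g)
  have sg: "good (star \<gamma> v)" "good (star \<gamma> w)" using star_good[OF \<gamma>] gd by auto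
  have un: "1 - zeta N powi (d * snd w) \<in> cyc_field N" "1 - zeta N powi (d * snd w) \<noteq> 0"
    "1 - zeta N powi (d * - snd v) \<in> cyc_field N" "1 - zeta N powi (d * - snd v) \<noteq> 0"
  proof -
    have "gal_sigma N d (1 - zeta N powi snd w) \<in> cyc_field N" "gal_sigma N d (1 - zeta N powi snd w) \<noteq> 0"
      "gal_sigma N d (1 - zeta N powi (- snd v)) \<in> cyc_field N" "gal_sigma N d (1 - zeta N powi (- snd v)) \<noteq> 0"
      using gal_sigma_closed[OF N_pos dd] gal_sigma_nonzero[OF N_pos dd] good_one_minus gd
      by (auto simp: units_F_iff)
    then show "1 - zeta N powi (d * snd w) \<in> cyc_field N" "1 - zeta N powi (d * snd w) \<noteq> 0"
      "1 - zeta N powi (d * - snd v) \<in> cyc_field N" "1 - zeta N powi (d * - snd v) \<noteq> 0"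
      unfolding gal_sigma_one_minus_zeta_powi[OF N_pos dd] .
  qed
  have zs: "zeta N powi (e * snd (star \<gamma> u)) = zeta N powi (e * (mdet \<gamma> * (d * snd u)))" for e u
  proof (rule zeta_powi_cong[OF N_pos])
    have "e * snd (star \<gamma> u) - e * (mdet \<gamma> * (d * snd u)) = c * (e * mdet \<gamma> * fst u)"
      by (simp add: g algebra_simps)
    then show "int N dvd e * snd (star \<gamma> u) - e * (mdet \<gamma> * (d * snd u))" using g(2) by simp
  qed
  have "Pt (star \<gamma> w) - Pt (star \<gamma> v) = gal d (Pt w - Pt v)"
  proof (cases "mdet \<gamma> = 1")
    case True
    have "wedge (star \<gamma> v) (star \<gamma> w) = 1" using star_wedge[OF \<gamma>] step(2) True by simp
    from Pt_edge[OF this sg] show ?thesis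
      unfolding gal_Pt_edge[OF step(2) gd dd] using zs[of 1 w] zs[of "- 1" v] True by simp
  next
    case False
    then have m: "mdet \<gamma> = - 1" using Gamma0t_mdet[OF \<gamma>] by blast
    have "wedge (star \<gamma> w) (star \<gamma> v) = 1"
      using star_wedge[OF \<gamma>, of v w] wedge_swap[of "star \<gamma> w"] step(2) m by simp
    from Pt_edge[OF this sg(2,1)]
    have "Pt (star \<gamma> v) - Pt (star \<gamma> w) = ksym (1 - zeta N powi (d * - snd v)) (1 - zeta N powi (d * snd w))"
      using zs[of 1 v] zs[of "- 1" w] m by simp
    also have "\<dots> = - ksym (1 - zeta N powi (d * snd w)) (1 - zeta N powi (d * - snd v))"
      using S.antisym un by blast
    also have "\<dots> = - gal d (Pt w - Pt v)" unfolding gal_Pt_edge[OF step(2) gd dd] ..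
    finally show ?thesis by (metis minus_diff_eq minus_equation_iff)
  qed
  then have "(Pt (star \<gamma> w) - Pt (star \<gamma> v)) + (Pt (star \<gamma> v) - Pt (star \<gamma> (0, 1))) = gal d (Pt w - Pt v) + gal d (Pt v)"
    using step.IH by (simp add: g)
  then show ?case unfolding gal_add[OF dd, symmetric] by (simp add: g)
qed

lemma reach_star: "\<gamma> \<in> Gamma0t N \<Longrightarrow> reach v \<Longrightarrow> reach (star \<gamma> v)"
  using reach_all star_prim star_good reach_prim reach_good by blast

lemma reach_sequence:
  assumes "reach v"
  shows "\<exists>(k::nat) bs ds. bs 0 = 0 \<and> ds 0 = 1 \<and> bs k = fst v \<and> ds k = snd v
    \<and> (\<forall>i\<in>{1..k}. bs (i - 1) * ds i - bs i * ds (i - 1) = 1) \<and> (\<forall>i<k. \<not> int N dvd ds i)"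
  using assms
proof (induction rule: reach.induct)
  case start
  show ?case by (rule exI[of _ "0::nat"], rule exI[of _ "\<lambda>_. 0"], rule exI[of _ "\<lambda>_. 1"]) auto
next
  case (step v w)
  then obtain k :: nat and bs ds :: "nat \<Rightarrow> int" where s: "bs 0 = 0" "ds 0 = 1" "bs k = fst v" "ds k = snd v"
    "\<forall>i\<in>{1..k}. bs (i - 1) * ds i - bs i * ds (i - 1) = 1" "\<forall>i<k. \<not> int N dvd ds i" by blast
  have v: "\<not> int N dvd snd v" using reach_good[OF step(1)] by (simp add: good_def)
  have w: "fst v * snd w - fst w * snd v = 1" using step(2) by (simp add: wedge_def)
  show ?case
    by (intro exI[of _ "Suc k"] exI[of _ "bs(Suc k := fst w)"] exI[of _ "ds(Suc k := snd w)"] conjI ballI allI impI)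
      (use s v w in \<open>auto simp: le_Suc_eq less_Suc_eq\<close>)
qed

text \<open>The sum telescopes in the potential. \<open>theta_seq\<close> leaves the last vector
  unrestricted, but it equals \<open>star \<gamma> (0, 1)\<close> and is therefore good.\<close>

lemma theta_seq_value:
  assumes \<gamma>: "\<gamma> \<in> Gamma0t N" and s: "theta_seq N \<gamma> k bs ds"
  shows "cls N (theta_val N k ds) = Pt (star \<gamma> (0, 1))"
proof -
  obtain a b c d where g: "\<gamma> = (a, b, c, d)" using prod_cases4 by blast
  have s': "bs 0 = 0" "ds 0 = 1" "(bs k, ds k) = star \<gamma> (0, 1)"
    "\<And>i. i \<in> {1..k} \<Longrightarrow> bs (i - 1) * ds i - bs i * ds (i - 1) = 1" "\<And>i. i < k \<Longrightarrow> \<not> int N dvd ds i"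
    using s by (auto simp: theta_seq_def g)
  have gl: "good (bs i, ds i)" if "i \<le> k" for i
  proof (cases "i = k")
    case True
    have "good (0, 1)" by (rule reach_good[OF reach.start])
    from star_good[OF \<gamma> this] show ?thesis using s'(3) True by simp
  next
    case False
    then show ?thesis using s'(5)[of i] that by (simp add: good_def)
  qed
  have "(\<Sum>i\<in>{1..j}. ksym (1 - zeta N powi ds i) (1 - zeta N powi (- ds (i - 1)))) = Pt (bs j, ds j)" if "j \<le> k" for j
    using that
  proof (induction j)
    case 0
    then show ?case using s' by simp
  next
    case (Suc j)
    have "wedge (bs j, ds j) (bs (Suc j), ds (Suc j)) = 1"
      using s'(4)[of "Suc j"] Suc.prems by (simp add: wedge_def)
    from Pt_edge[OF this gl gl] Suc show ?case by (simp add: algebra_simps)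
  qed
  from this[of k] show ?thesis using s'(3) by (simp add: theta_val_def cls_sum ksym_def)
qed

lemma cls_Theta:
  assumes "\<gamma> \<in> Gamma0t N"
  shows "cls N (Theta N \<gamma>) = Pt (star \<gamma> (0, 1))"
proof -
  have "reach (star \<gamma> (0, 1))" using reach_star[OF assms reach.start] .
  from reach_sequence[OF this] obtain k :: nat and bs ds :: "nat \<Rightarrow> int" where s: "bs 0 = 0" "ds 0 = 1"
    "bs k = fst (star \<gamma> (0, 1))" "ds k = snd (star \<gamma> (0, 1))"
    "\<forall>i\<in>{1..k}. bs (i - 1) * ds i - bs i * ds (i - 1) = 1" "\<forall>i<k. \<not> int N dvd ds i" by blast
  have "theta_seq N \<gamma> k bs ds"
    using s by (cases \<gamma>) (simp add: theta_seq_def)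
  then have "\<exists>x. \<exists>k bs ds. theta_seq N \<gamma> k bs ds \<and> x = theta_val N k ds" by blast
  from someI_ex[OF this] obtain k bs ds where "theta_seq N \<gamma> k bs ds" "Theta N \<gamma> = theta_val N k ds"
    unfolding Theta_def by blast
  then show ?thesis using theta_seq_value[OF assms] by simp
qed

end

section \<open>The Hecke operator on the potential\<close>

context hecke_prime
begin

text \<open>\<open>red k v\<close> and \<open>red k w\<close> are good, hence joined to the base
  point through good vectors, and the weights \<open>bw k\<close> drop out.\<close>

lemma hecke_edge_Pt:
  assumes "wedge v w = 1" "good v" "good w"
  shows "(\<Sum>k\<le>l. gal (del k) (Pt (red k w) - Pt (red k v))) = (\<Sum>i<l. Pt w - Pt v) + gal (int l) (Pt w - Pt v)"
proof -
  interpret E: hecke_edge N l v w by unfold_locales (use assms in auto)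
  have r: "reach (red k v)" "reach (red k w)" for k
    using reach_all prim_red good_red wedge_1_prim[OF assms(1)] assms by auto
  have p: "ksym (1 - E.y) (1 - inverse E.x) = Pt w - Pt v"
    unfolding Pt_edge[OF assms] by (simp add: E.x_def E.y_def power_int_minus)
  have yl: "E.y ^ l = zeta N powi (int l * snd w)" "inverse (E.x ^ l) = zeta N powi (int l * - snd v)"
    by (simp_all add: E.x_def E.y_def power_int_mult[of _ "snd w" "int l", simplified, symmetric]
        power_int_mult[of _ "snd v" "int l", simplified, symmetric] mult.commute power_int_minus)
  have q: "ksym (1 - E.y ^ l) (1 - inverse (E.x ^ l)) = gal (int l) (Pt w - Pt v)"
    unfolding gal_Pt_edge[OF assms coprime_l_N] yl ..
  show ?thesis
    using E.hecke_edge_identity unfolding p q Pt_weight[OF E.odd_weight_bw r] .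
qed

lemma hecke_Pt:
  assumes "reach v"
  shows "(\<Sum>k\<le>l. gal (del k) (Pt (red k v) - Pt (red k (0, 1)))) = (\<Sum>i<l. Pt v) + gal (int l) (Pt v)"
  using assms
proof (induction rule: reach.induct)
  case start
  show ?case using gal_0[OF coprime_del] gal_0[OF coprime_l_N] by simp
next
  case (step v w)
  have "(\<Sum>k\<le>l. gal (del k) (Pt (red k w) - Pt (red k (0, 1))))
      = (\<Sum>k\<le>l. gal (del k) (Pt (red k w) - Pt (red k v)) + gal (del k) (Pt (red k v) - Pt (red k (0, 1))))"
    by (simp add: gal_add[OF coprime_del, symmetric])
  also have "\<dots> = ((\<Sum>i<l. Pt w - Pt v) + gal (int l) (Pt w - Pt v)) + ((\<Sum>i<l. Pt v) + gal (int l) (Pt v))"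
    unfolding sum.distrib hecke_edge_Pt[OF step(2) reach_good[OF step(1)] step(3)] step.IH ..
  also have "\<dots> = (\<Sum>i<l. (Pt w - Pt v) + Pt v) + gal (int l) ((Pt w - Pt v) + Pt v)"
    unfolding sum.distrib gal_add[OF coprime_l_N] by (simp add: add_ac)
  finally show ?case by simp
qed

lemma gv_hg: "gv k u = (case hg l k of (a, b, c, d) \<Rightarrow> (a * fst u + b * snd u, c * fst u + d * snd u))"
  by (simp add: gv_def hg_def)

text \<open>The columns of \<gamma> g_j have determinant l up to sign, so modulo l they are
  proportional and not both zero. The form \<open>lam k\<close> that vanishes on the nonzero one
  vanishes on both, and dividing by l produces \<gamma>'.\<close>

lemma hecke_dec_exists:
  assumes "\<gamma> \<in> Gamma0t N"
  shows "\<exists>k \<gamma>'. k \<le> l \<and> \<gamma>' \<in> Gamma0t N \<and> mmul \<gamma> (hg l j) = mmul (hg l k) \<gamma>'"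
proof -
  obtain a b c d where A: "mmul \<gamma> (hg l j) = (a, b, c, d)" using prod_cases4 by blast
  have l: "prime (int l)" using prime_l by simp
  have det: "a * d - b * c = int l \<or> a * d - b * c = - int l"
  proof -
    have "mdet (hg l j) = int l" by (simp add: hg_def)
    then have "mdet (a, b, c, d) = mdet \<gamma> * int l" using mdet_mmul[of \<gamma> "hg l j"] A by simp
    then show ?thesis using Gamma0t_mdet[OF assms] by auto
  qed
  have Nc: "int N dvd c"
    using assms A by (cases \<gamma>) (auto simp: Gamma0t_def hg_def split: if_splits)
  have ex: "\<exists>k\<le>l. int l dvd lam k (a, c) \<and> int l dvd lam k (b, d)"
  proof -
    have par: "int l dvd lam k q" if lp: "int l dvd lam k p" and np: "\<not> (int l dvd fst p \<and> int l dvd snd p)"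
      and w: "int l dvd wedge p q" for k p q
    proof (cases "k < l")
      case True
      have p1: "int l dvd fst p - int k * snd p" using lp True by (simp add: lam_def)
      have "\<not> int l dvd snd p" using np p1 by (metis dvd_diff_commute dvd_diff_left_iff dvd_mult)
      moreover have "snd p * lam k q = (fst p - int k * snd p) * snd q - wedge p q"
        using True by (simp add: lam_def wedge_def algebra_simps)
      then have "int l dvd snd p * lam k q" using p1 w by (metis dvd_diff dvd_mult2)
      ultimately show ?thesis using l by (simp add: prime_dvd_mult_iff)
    next
      case False
      have p1: "int l dvd snd p" using lp False by (simp add: lam_def)
      then have "\<not> int l dvd fst p" using np by simp
      moreover have "fst p * lam k q = wedge p q + snd p * fst q"
        using False by (simp add: lam_def wedge_def algebra_simps)
      then have "int l dvd fst p * lam k q" using p1 w by (metis dvd_add dvd_mult2)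
      ultimately show ?thesis using l by (simp add: prime_dvd_mult_iff)
    qed
    have w: "int l dvd wedge (a, c) (b, d)" "int l dvd wedge (b, d) (a, c)"
    proof -
      show "int l dvd wedge (a, c) (b, d)" using det by (auto simp: wedge_def)
      then show "int l dvd wedge (b, d) (a, c)" using wedge_swap[of "(b, d)" "(a, c)"] by simp
    qed
    show ?thesis
    proof (cases "int l dvd a \<and> int l dvd c")
      case False
      obtain k where "k \<le> l" "int l dvd lam k (a, c)" using lam_exists by blast
      then show ?thesis using par[of k "(a, c)" "(b, d)"] False w by auto
    next
      case True
      have "\<not> (int l dvd b \<and> int l dvd d)"
      proof
        assume "int l dvd b \<and> int l dvd d"
        then have "int l * int l dvd a * d - b * c"
          using True by (auto intro!: dvd_diff mult_dvd_mono simp: mult.commute[of b c])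
        then have "int l * int l dvd int l * 1" using det by auto
        then have "int l dvd 1" using l_pos by (metis dvd_mult_cancel_left of_nat_0_less_iff less_irrefl)
        then show False using l not_prime_unit by blast
      qed
      moreover obtain k where "k \<le> l" "int l dvd lam k (b, d)" using lam_exists by blast
      ultimately show ?thesis using par[of k "(b, d)" "(a, c)"] w by auto
    qed
  qed
  then obtain k where k: "k \<le> l" "int l dvd lam k (a, c)" "int l dvd lam k (b, d)" by blast
  show ?thesis
  proof (cases "k < l")
    case True
    obtain p q where pq: "a - int k * c = int l * p" "b - int k * d = int l * q"
      using k True by (auto simp: lam_def elim!: dvdE)
    have "int l * (p * d - q * c) = a * d - b * c" using pq by (simp add: algebra_simps)
    then have "int l * (p * d - q * c) = int l * 1 \<or> int l * (p * d - q * c) = int l * - 1" using det by simp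
    then have "p * d - q * c = 1 \<or> p * d - q * c = - 1" using l_pos by (simp only: mult_cancel_left) auto
    then have "(p, q, c, d) \<in> Gamma0t N" using Nc by (auto simp: Gamma0t_def)
    moreover have "mmul \<gamma> (hg l j) = mmul (hg l k) (p, q, c, d)"
      using A True pq by (simp add: hg_def algebra_simps)
    ultimately show ?thesis using k by blast
  next
    case False
    then have kl: "k = l" using k by simp
    obtain p q where pq: "c = int l * p" "d = int l * q"
      using k False by (auto simp: lam_def elim!: dvdE)
    have "int l * (a * q - b * p) = a * d - b * c" using pq by (simp add: algebra_simps)
    then have "int l * (a * q - b * p) = int l * 1 \<or> int l * (a * q - b * p) = int l * - 1" using det by simp
    then have "a * q - b * p = 1 \<or> a * q - b * p = - 1" using l_pos by (simp only: mult_cancel_left) auto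
    moreover have "int N dvd p"
      using Nc pq coprime_l_N by (simp add: coprime_dvd_mult_right_iff coprime_commute)
    ultimately have "(a, b, p, q) \<in> Gamma0t N" by (auto simp: Gamma0t_def)
    moreover have "mmul \<gamma> (hg l j) = mmul (hg l k) (a, b, p, q)"
      using A kl pq by (simp add: hg_def)
    ultimately show ?thesis using k by blast
  qed
qed

lemma hecke_dec_props:
  assumes "\<gamma> \<in> Gamma0t N" "hecke_dec N l \<gamma> j = (k, \<gamma>')"
  shows "k \<le> l" "\<gamma>' \<in> Gamma0t N" "mmul \<gamma> (hg l j) = mmul (hg l k) \<gamma>'"
proof -
  have "\<exists>x. case x of (k, \<gamma>') \<Rightarrow> k \<le> l \<and> \<gamma>' \<in> Gamma0t N \<and> mmul \<gamma> (hg l j) = mmul (hg l k) \<gamma>'"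
    using hecke_dec_exists[OF assms(1), of j] by auto
  from someI_ex[OF this] show "k \<le> l" "\<gamma>' \<in> Gamma0t N" "mmul \<gamma> (hg l j) = mmul (hg l k) \<gamma>'"
    using assms(2) unfolding hecke_dec_def by auto
qed

lemma gv_star:
  assumes "\<gamma> \<in> Gamma0t N" "hecke_dec N l \<gamma> j = (k, \<gamma>')"
  shows "gv k (star \<gamma>' u) = star \<gamma> (gv j u)"
proof -
  note h = hecke_dec_props[OF assms]
  obtain a b c d where g: "\<gamma> = (a, b, c, d)" using prod_cases4 by blast
  obtain a' b' c' d' where g': "\<gamma>' = (a', b', c', d')" using prod_cases4 by blast
  have "mdet (hg l i) = int l" for i by (simp add: hg_def)
  then have "mdet \<gamma> * int l = int l * mdet \<gamma>'" using h(3) by (metis mdet_mmul)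
  then have D: "mdet \<gamma>' = mdet \<gamma>" using l_pos by simp
  obtain p q r s where hj: "hg l j = (p, q, r, s)" using prod_cases4 by blast
  obtain p' q' r' s' where hk: "hg l k = (p', q', r', s')" using prod_cases4 by blast
  have e: "a * p + b * r = p' * a' + q' * c'" "a * q + b * s = p' * b' + q' * d'"
    "c * p + d * r = r' * a' + s' * c'" "c * q + d * s = r' * b' + s' * d'"
    using h(3) by (simp_all add: g g' hj hk)
  have D': "a' * d' - b' * c' = a * d - b * c" using D by (simp add: g g')
  have 1: "p' * (D * (a' * m + b' * n)) + q' * (D * (c' * m + d' * n)) = D * (a * (p * m + q * n) + b * (r * m + s * n))" for D m n
  proof -
    have "p' * (D * (a' * m + b' * n)) + q' * (D * (c' * m + d' * n)) = D * ((p' * a' + q' * c') * m + (p' * b' + q' * d') * n)"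
      by (simp add: algebra_simps)
    also have "\<dots> = D * (a * (p * m + q * n) + b * (r * m + s * n))" unfolding e[symmetric] by (simp add: algebra_simps)
    finally show ?thesis .
  qed
  have 2: "r' * (D * (a' * m + b' * n)) + s' * (D * (c' * m + d' * n)) = D * (c * (p * m + q * n) + d * (r * m + s * n))" for D m n
  proof -
    have "r' * (D * (a' * m + b' * n)) + s' * (D * (c' * m + d' * n)) = D * ((r' * a' + s' * c') * m + (r' * b' + s' * d') * n)"
      by (simp add: algebra_simps)
    also have "\<dots> = D * (c * (p * m + q * n) + d * (r * m + s * n))" unfolding e[symmetric] by (simp add: algebra_simps)
    finally show ?thesis .
  qed
  show ?thesis unfolding gv_hg hj hk g g' using 1 2 D' by simp
qed

lemma gv_prim_unique:
  assumes "prim a" "prim b" "0 < c" "0 < c'" "gv k a = (c * fst p, c * snd p)" "gv k b = (c' * fst p, c' * snd p)"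
  shows "a = b"
proof -
  have e: "c' * fst (gv k a) = c * fst (gv k b)" "c' * snd (gv k a) = c * snd (gv k b)"
    using assms(5,6) by simp_all
  have f: "c' * fst a = c * fst b" "c' * snd a = c * snd b"
  proof -
    show s: "c' * snd a = c * snd b" using e l_pos by (auto simp: gv_def split: if_splits)
    show "c' * fst a = c * fst b"
    proof (cases "k < l")
      case True
      have "c' * (int l * fst a + int k * snd a) = c * (int l * fst b + int k * snd b)" using e True by (simp add: gv_def)
      then have "int l * (c' * fst a) + int k * (c' * snd a) = int l * (c * fst b) + int k * (c * snd b)"
        by (simp add: algebra_simps)
      then have "int l * (c' * fst a) = int l * (c * fst b)" unfolding s by simp
      then show ?thesis using l_pos by simp
    qed (use e in \<open>simp add: gv_def\<close>)
  qed
  have "gcd (c' * fst a) (c' * snd a) = c'" "gcd (c * fst b) (c * snd b) = c"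
    using assms(1-4) by (simp_all add: gcd_mult_left prim_def coprime_imp_gcd_eq_1)
  then have "c' = c" using f by simp
  then show ?thesis using f assms(3) by (simp add: prod_eq_iff)
qed

text \<open>Both sides are primitive, and \<open>gv k\<close> sends both to positive multiples of
  \<open>star \<gamma> v\<close>.\<close>

lemma star_red:
  assumes "\<gamma> \<in> Gamma0t N" "hecke_dec N l \<gamma> j = (k, \<gamma>')" "prim v"
  shows "star \<gamma>' (red j v) = red k (star \<gamma> v)"
proof (rule gv_prim_unique)
  note h = hecke_dec_props[OF assms(1,2)]
  show "prim (star \<gamma>' (red j v))" "prim (red k (star \<gamma> v))"
    using star_prim prim_red assms h by blast+
  show "0 < mul j v" "0 < mul k (star \<gamma> v)" by (rule mul_pos)+
  have lin: "star \<gamma> (m * fst v, m * snd v) = (m * fst (star \<gamma> v), m * snd (star \<gamma> v))" for m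
    by (cases \<gamma>) (simp add: algebra_simps)
  show "gv k (star \<gamma>' (red j v)) = (mul j v * fst (star \<gamma> v), mul j v * snd (star \<gamma> v))"
    unfolding gv_star[OF assms(1,2)] gv_red lin ..
  show "gv k (red k (star \<gamma> v)) = (mul k (star \<gamma> v) * fst (star \<gamma> v), mul k (star \<gamma> v) * snd (star \<gamma> v))"
    by (rule gv_red)
qed

text \<open>If i and j lead to the same k, then the images of \<open>gv i\<close> and
  \<open>gv j\<close> coincide, while a primitive vector lies in only one of the l + 1
  lattices.\<close>

lemma hecke_dec_bij:
  assumes "\<gamma> \<in> Gamma0t N"
  shows "bij_betw (\<lambda>j. fst (hecke_dec N l \<gamma> j)) {..l} {..l}"
proof -
  have "inj_on (\<lambda>j. fst (hecke_dec N l \<gamma> j)) {..l}"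
  proof (rule inj_onI)
    fix i j assume ij: "i \<in> {..l}" "j \<in> {..l}" "fst (hecke_dec N l \<gamma> i) = fst (hecke_dec N l \<gamma> j)"
    obtain k \<gamma>i \<gamma>j where h: "hecke_dec N l \<gamma> i = (k, \<gamma>i)" "hecke_dec N l \<gamma> j = (k, \<gamma>j)"
      using ij(3) by (metis prod.collapse)
    \<comment> \<open>Chosen so that \<open>gv i u\<close>, which is (i, 1) or (1, 0), is
      primitive.\<close>
    define u :: "int \<times> int" where "u = (if i < l then (0, 1) else (1, 0))"
    have pu: "prim (gv i u)" by (auto simp: u_def gv_def prim_def)
    obtain hj where hj: "\<And>v. star \<gamma>j (hj v) = v"
      using star_inverse[OF hecke_dec_props(2)[OF assms h(2)]] by metis
    obtain hg' where hg': "\<And>v. hg' (star \<gamma> v) = v" using star_inverse[OF assms] by metis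
    have "star \<gamma> (gv i u) = gv k (star \<gamma>j (hj (star \<gamma>i u)))" unfolding hj gv_star[OF assms h(1)] ..
    also have "\<dots> = star \<gamma> (gv j (hj (star \<gamma>i u)))" by (rule gv_star[OF assms h(2)])
    finally have "gv i u = gv j (hj (star \<gamma>i u))" by (metis hg')
    then have "int l dvd lam j (gv i u)" using lam_gv by simp
    then show "i = j" using lam_unique[OF pu lam_gv] ij by auto
  qed
  moreover have "(\<lambda>j. fst (hecke_dec N l \<gamma> j)) ` {..l} \<subseteq> {..l}"
    using hecke_dec_props(1)[OF assms] by (auto simp: image_iff) (metis prod.collapse)
  ultimately show ?thesis
    by (simp add: bij_betw_def endo_inj_surj)
qed

text \<open>Compare the lower right entries of \<gamma> g_j = g_k \<gamma>' modulo N, where the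
  lower left entry of \<gamma> vanishes.\<close>

lemma hecke_dec_lower_right:
  assumes "\<gamma> \<in> Gamma0t N" "hecke_dec N l \<gamma> j = (k, \<gamma>')"
  shows "int N dvd del k * lower_right \<gamma>' - lower_right \<gamma> * del j"
proof -
  note h = hecke_dec_props[OF assms]
  obtain a b c d where g: "\<gamma> = (a, b, c, d)" "int N dvd c" using assms(1) by (rule Gamma0tE)
  obtain a' b' c' d' where g': "\<gamma>' = (a', b', c', d')" using prod_cases4 by blast
  define q where "q = (if j < l then int j else 0)"
  have q: "c * q + d * del j = del k * d'"
    using h(3) by (cases "j < l"; cases "k < l") (auto simp: g g' hg_def del_def q_def mult.commute)
  then have "del k * d' - d * del j = c * q" by simp
  then show ?thesis using g(2) by (simp add: g g')
qed

text \<open>The change of base points: the paths of \<Theta> at \<gamma>_j start at (0, 1), those of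
  the edge identity at \<open>red j (0, 1)\<close>. The difference of T_l \<Theta> and (l +
  \<sigma>_l) \<Theta> is the coboundary of - \<open>m0\<close>.\<close>

definition m0 :: K2fam where
  "m0 = (\<Sum>j\<le>l. gal (del j) (Pt (red j (0, 1))))"

lemma reach_red: "reach v \<Longrightarrow> reach (red k v)"
  using reach_all prim_red good_red reach_prim reach_good by blast

lemma m0_carr: "m0 \<in> carr"
  unfolding m0_def by (intro carr_sum carr_gal coprime_del Pt_carr reach_red reach.start)

lemma cls_hecke:
  assumes \<gamma>: "\<gamma> \<in> Gamma0t N"
  shows "cls N (hecke N l (Theta N) \<gamma>)
    = (\<Sum>i<l. cls N (Theta N \<gamma>)) + gal (int l) (cls N (Theta N \<gamma>)) + (m0 - gal (lower_right \<gamma>) m0)"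
proof -
  define kk where "kk j = fst (hecke_dec N l \<gamma> j)" for j
  define \<gamma>\<gamma> where "\<gamma>\<gamma> j = snd (hecke_dec N l \<gamma> j)" for j
  have h: "hecke_dec N l \<gamma> j = (kk j, \<gamma>\<gamma> j)" for j by (simp add: kk_def \<gamma>\<gamma>_def)
  note hp = hecke_dec_props[OF \<gamma> h]
  note cop = Gamma0t_lower_right_coprime[OF \<gamma>]
  have s0: "reach (0, 1)" "prim (0, 1)" using reach.start reach_prim by blast+
  have lr: "lower_right (hg l k) = del k" for k by (simp add: hg_def del_def)
  have summand: "cls N (actM N (hg l (kk j)) (Theta N (\<gamma>\<gamma> j)))
      = gal (del (kk j)) (Pt (red (kk j) (star \<gamma> (0, 1)))) - gal (lower_right \<gamma>) (gal (del j) (Pt (red j (0, 1))))" for j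
  proof -
    note cj = Gamma0t_lower_right_coprime[OF hp(2)[of j]]
    \<comment> \<open>Equivariance under \<gamma>_j moves the base point from (0, 1) to
      \<open>red j (0, 1)\<close>, which \<gamma>_j sends to
      \<open>red (kk j) (star \<gamma> (0, 1))\<close>.\<close>
    have "Pt (star (\<gamma>\<gamma> j) (0, 1)) = Pt (red (kk j) (star \<gamma> (0, 1))) - gal (lower_right (\<gamma>\<gamma> j)) (Pt (red j (0, 1)))"
      using star_equivariant[OF hp(2)[of j] reach_red[OF s0(1), of j]] star_red[OF \<gamma> h[of j] s0(2)]
      by (metis diff_diff_eq2 add_diff_cancel_left' diff_add_cancel)
    then have "cls N (actM N (hg l (kk j)) (Theta N (\<gamma>\<gamma> j)))
        = gal (del (kk j)) (Pt (red (kk j) (star \<gamma> (0, 1))) - gal (lower_right (\<gamma>\<gamma> j)) (Pt (red j (0, 1))))"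
      by (simp add: actM_def lr gal_cls[OF coprime_del, symmetric] cls_Theta[OF hp(2)])
    also have "\<dots> = gal (del (kk j)) (Pt (red (kk j) (star \<gamma> (0, 1))))
        - gal (del (kk j)) (gal (lower_right (\<gamma>\<gamma> j)) (Pt (red j (0, 1))))"
      by (rule gal_diff[OF coprime_del])
    also have "gal (del (kk j)) (gal (lower_right (\<gamma>\<gamma> j)) (Pt (red j (0, 1))))
        = gal (lower_right \<gamma>) (gal (del j) (Pt (red j (0, 1))))"
      by (rule gal_gal_Pt[OF reach_red[OF s0(1)] coprime_del cj cop coprime_del hecke_dec_lower_right[OF \<gamma> h]])
    finally show ?thesis .
  qed
  have "cls N (hecke N l (Theta N) \<gamma>) = (\<Sum>j\<le>l. cls N (actM N (hg l (kk j)) (Theta N (\<gamma>\<gamma> j))))"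
    by (simp add: hecke_def cls_sum h atMost_atLeast0)
  also have "\<dots> = (\<Sum>j\<le>l. gal (del (kk j)) (Pt (red (kk j) (star \<gamma> (0, 1))))) - gal (lower_right \<gamma>) m0"
    unfolding summand sum_subtractf m0_def gal_sum[OF cop] ..
  also have "(\<Sum>j\<le>l. gal (del (kk j)) (Pt (red (kk j) (star \<gamma> (0, 1)))))
      = (\<Sum>k\<le>l. gal (del k) (Pt (red k (star \<gamma> (0, 1)))))"
    using sum.reindex_bij_betw[OF hecke_dec_bij[OF \<gamma>], of "\<lambda>k. gal (del k) (Pt (red k (star \<gamma> (0, 1))))"]
    by (simp add: kk_def)
  also have "\<dots> = (\<Sum>k\<le>l. gal (del k) (Pt (red k (star \<gamma> (0, 1))) - Pt (red k (0, 1)))) + m0"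
    unfolding m0_def gal_diff[OF coprime_del] sum_subtractf by simp
  also have "\<dots> = (\<Sum>i<l. Pt (star \<gamma> (0, 1))) + gal (int l) (Pt (star \<gamma> (0, 1))) + m0"
    unfolding hecke_Pt[OF reach_star[OF \<gamma> s0(1)]] ..
  finally show ?thesis unfolding cls_Theta[OF \<gamma>] by simp
qed

theorem hecke_eisenstein:
  obtains m where "m \<in> M_carrier N"
    "\<And>\<gamma>. \<gamma> \<in> Gamma0t N \<Longrightarrow> cls N (hecke N l (Theta N) \<gamma>)
       - (cls N (zsmult (int l) (Theta N \<gamma>)) + cls N (galM N (int l) (Theta N \<gamma>))) = cls N (actM N \<gamma> m - m)"
proof -
  have "- m0 \<in> carr" using carr_diff[OF carr_0 m0_carr] by simp
  then obtain m where m: "m \<in> M_carrier N" "cls N m = - m0" by (auto simp: carr_def)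
  have "cls N (hecke N l (Theta N) \<gamma>)
       - (cls N (zsmult (int l) (Theta N \<gamma>)) + cls N (galM N (int l) (Theta N \<gamma>))) = cls N (actM N \<gamma> m - m)"
    if \<gamma>: "\<gamma> \<in> Gamma0t N" for \<gamma>
  proof -
    note cop = Gamma0t_lower_right_coprime[OF \<gamma>]
    have "cls N (actM N \<gamma> m - m) = m0 - gal (lower_right \<gamma>) m0"
      by (simp add: actM_def cls_diff gal_cls[OF cop, symmetric] m(2) gal_uminus[OF cop])
    then show ?thesis
      unfolding cls_hecke[OF \<gamma>] zsmult_nat gal_cls[OF coprime_l_N, symmetric] by simp
  qed
  then show ?thesis using that m(1) by blast
qed

end

theorem mainTheorem11:
  fixes N :: nat
  assumes "N \<ge> 2"
  shows "(\<forall>l::nat. prime l \<and> \<not> l dvd 2 * N \<longrightarrow>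
            cohom_eq N (hecke N l (Theta N))
              (\<lambda>\<gamma>. zsmult (int l) (Theta N \<gamma>) + galM N (int l) (Theta N \<gamma>)))
       \<and> (odd N \<longrightarrow>
            cohom_eq N
              (\<lambda>\<gamma>. zsmult 2 (hecke N 2 (Theta N) \<gamma> - zsmult 2 (Theta N \<gamma>)
                               - galM N 2 (Theta N \<gamma>)))
              (\<lambda>\<gamma>. 0))"
proof (intro conjI allI impI)
  fix l :: nat assume l: "prime l \<and> \<not> l dvd 2 * N"
  interpret hecke_prime N l by unfold_locales (use assms l in auto)
  obtain m where m: "m \<in> M_carrier N" "\<And>\<gamma>. \<gamma> \<in> Gamma0t N \<Longrightarrow> cls N (hecke N l (Theta N) \<gamma>)
       - (cls N (zsmult (int l) (Theta N \<gamma>)) + cls N (galM N (int l) (Theta N \<gamma>))) = cls N (actM N \<gamma> m - m)"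
    using hecke_eisenstein by blast
  show "cohom_eq N (hecke N l (Theta N)) (\<lambda>\<gamma>. zsmult (int l) (Theta N \<gamma>) + galM N (int l) (Theta N \<gamma>))"
    unfolding cohom_eq_def cls_eq_iff[symmetric] using m by (intro bexI[of _ m]) (auto simp: cls_diff cls_add)
next
  assume "odd N"
  \<comment> \<open>The prime 2 does not divide the odd N, so the relation with l = 2 is doubled and
    m + m gives the coboundary.\<close>
  interpret hecke_prime N 2 by unfold_locales (use assms \<open>odd N\<close> in auto)
  obtain m where m: "m \<in> M_carrier N" "\<And>\<gamma>. \<gamma> \<in> Gamma0t N \<Longrightarrow> cls N (hecke N 2 (Theta N) \<gamma>)
       - (cls N (zsmult (int 2) (Theta N \<gamma>)) + cls N (galM N (int 2) (Theta N \<gamma>))) = cls N (actM N \<gamma> m - m)"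
    using hecke_eisenstein by blast
  have two: "cls N (zsmult 2 z) = cls N z + cls N z" for z
    using zsmult_nat[of N 2 z] by (simp add: numeral_2_eq_2)
  have mm: "m + m \<in> M_carrier N"
    using m(1) Poly_Mapping.keys_add[of m m] by (auto simp: M_carrier_def)
  show "cohom_eq N (\<lambda>\<gamma>. zsmult 2 (hecke N 2 (Theta N) \<gamma> - zsmult 2 (Theta N \<gamma>) - galM N 2 (Theta N \<gamma>))) (\<lambda>\<gamma>. 0)"
    unfolding cohom_eq_def cls_eq_iff[symmetric]
  proof (intro bexI[OF _ mm] ballI)
    fix \<gamma> assume \<gamma>: "\<gamma> \<in> Gamma0t N"
    have "cls N (hecke N 2 (Theta N) \<gamma> - zsmult 2 (Theta N \<gamma>) - galM N 2 (Theta N \<gamma>)) = cls N (actM N \<gamma> m - m)"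
      using m(2)[OF \<gamma>] by (simp add: cls_diff cls_add diff_diff_eq)
    then have "cls N (zsmult 2 (hecke N 2 (Theta N) \<gamma> - zsmult 2 (Theta N \<gamma>) - galM N 2 (Theta N \<gamma>)))
        = cls N (actM N \<gamma> m - m) + cls N (actM N \<gamma> m - m)" unfolding two by simp
    also have "\<dots> = cls N (actM N \<gamma> (m + m) - (m + m))"
      unfolding actM_def galM_add cls_diff cls_add by simp
    finally show "cls N (zsmult 2 (hecke N 2 (Theta N) \<gamma> - zsmult 2 (Theta N \<gamma>) - galM N 2 (Theta N \<gamma>)) - 0)
        = cls N (actM N \<gamma> (m + m) - (m + m))" by simp
  qed
qed

end
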